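(* Let $H>0$ and let $X$ be a connected Riemannian $n$-manifold such that $\mathrm{Ent}(X)\le H$ and whose fundamental group is decomposable and without $2$-torsion. Then $$\mathrm{dias}(X)\ \ge\ \frac{\log(3)}{6H}.$$
   Context: Let $\tilde X$ be the Riemannian universal covering of $X$, with distance function $\tilde d$, on which $\pi_1(X)$ acts by deck transformations. The entropy of $X$ is $\mathrm{Ent}(X)=\lim_{R\to\infty}\frac1R\log(\mathrm{Vol}(B(\tilde x,R)))$, where $B(\tilde x,R)$ is the geodesic ball of radius $R$ centered at $\tilde x$ in $\tilde X$ (the limit is understood to exist and not to depend on $\tilde x\in\tilde X$). $X$ is not assumed compact; in the compact case this is the volume-entropy. The diastole of $X$ is $\mathrm{dias}(X)=\sup_{x\in X} l_x(X)$, where $l_x(X)$ is the length of the shortest non-nullhomotopic geodesic loop based at $x$; equivalently, $\mathrm{dias}(X)=\sup_{\tilde x\in\tilde X}\ \inf_{\gamma\in\pi_1(X)\setminus\{\mathrm{id}\}}\tilde d(\tilde x,\gamma\tilde x)$. A group is decomposable if it is isomorphic to a nontrivial free product $A*B$ (both $A$ and $B$ nontrivial). A group $\Gamma$ is without $2$-torsion if there is no element $\gamma\in\Gamma\setminus\{\mathrm{id}\}$ with $\gamma^2=\mathrm{id}$. *)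

theory Defs
  imports "HOL-Analysis.Analysis" "HOL-Algebra.Group"
begin

section \<open>Groups\<close>

subsection \<open>Free products\<close>

abbreviation free_words :: "('a, 'c) monoid_scheme \<Rightarrow> ('b, 'd) monoid_scheme \<Rightarrow> ('a + 'b) list set" where
  "free_words A B \<equiv> lists (carrier A <+> carrier B)"

text \<open>
  The congruence on words generated by multiplying adjacent letters of the same factor and by
  deleting the unit letters.
\<close>

inductive free_equiv ::
    "('a, 'c) monoid_scheme \<Rightarrow> ('b, 'd) monoid_scheme \<Rightarrow> ('a + 'b) list \<Rightarrow> ('a + 'b) list \<Rightarrow> bool"
  for A :: "('a, 'c) monoid_scheme" and B :: "('b, 'd) monoid_scheme" where
  refl: "u \<in> free_words A B \<Longrightarrow> free_equiv A B u u"
| sym: "free_equiv A B u v \<Longrightarrow> free_equiv A B v u"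
| trans: "free_equiv A B u v \<Longrightarrow> free_equiv A B v w \<Longrightarrow> free_equiv A B u w"
| one_left: "u \<in> free_words A B \<Longrightarrow> v \<in> free_words A B \<Longrightarrow>
    free_equiv A B (u @ [Inl \<one>\<^bsub>A\<^esub>] @ v) (u @ v)"
| one_right: "u \<in> free_words A B \<Longrightarrow> v \<in> free_words A B \<Longrightarrow>
    free_equiv A B (u @ [Inr \<one>\<^bsub>B\<^esub>] @ v) (u @ v)"
| mult_left: "u \<in> free_words A B \<Longrightarrow> v \<in> free_words A B \<Longrightarrow> a \<in> carrier A \<Longrightarrow> a' \<in> carrier A \<Longrightarrow>
    free_equiv A B (u @ [Inl a, Inl a'] @ v) (u @ [Inl (a \<otimes>\<^bsub>A\<^esub> a')] @ v)"
| mult_right: "u \<in> free_words A B \<Longrightarrow> v \<in> free_words A B \<Longrightarrow> b \<in> carrier B \<Longrightarrow> b' \<in> carrier B \<Longrightarrow>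
    free_equiv A B (u @ [Inr b, Inr b'] @ v) (u @ [Inr (b \<otimes>\<^bsub>B\<^esub> b')] @ v)"

definition free_product ::
    "('a, 'c) monoid_scheme \<Rightarrow> ('b, 'd) monoid_scheme \<Rightarrow> ('a + 'b) list set monoid" where
  "free_product A B =
     \<lparr> carrier = (\<lambda>u. Collect (free_equiv A B u)) ` free_words A B,
       mult = (\<lambda>U V. \<Union>u\<in>U. \<Union>v\<in>V. Collect (free_equiv A B (u @ v))),
       one = Collect (free_equiv A B []) \<rparr>"

text \<open>
  Both factors of a free product embed into it, so nothing is lost by letting the factors range
  over groups on the element type of \<open>G\<close>.
\<close>

definition decomposable :: "('a, 'c) monoid_scheme \<Rightarrow> bool" where
  "decomposable G \<longleftrightarrow>
     (\<exists>(A :: 'a monoid) (B :: 'a monoid). group A \<and> group B \<and>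
        carrier A \<noteq> {\<one>\<^bsub>A\<^esub>} \<and> carrier B \<noteq> {\<one>\<^bsub>B\<^esub>} \<and> G \<cong> free_product A B)"

definition without_2_torsion :: "('a, 'c) monoid_scheme \<Rightarrow> bool" where
  "without_2_torsion G \<longleftrightarrow> \<not> (\<exists>x \<in> carrier G - {\<one>\<^bsub>G\<^esub>}. x [^]\<^bsub>G\<^esub> (2::nat) = \<one>\<^bsub>G\<^esub>)"

lemma free_equiv_words:
  assumes "group A" "group B" "free_equiv A B u v"
  shows "u \<in> free_words A B \<and> v \<in> free_words A B"
proof -
  interpret A: group A by fact
  interpret B: group B by fact
  show ?thesis using assms(3) by induction auto
qed

lemma free_equiv_append_left:
  assumes "group A" "group B" "free_equiv A B u v" "w \<in> free_words A B"
  shows "free_equiv A B (w @ u) (w @ v)"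
  using assms(3)
proof induction
  case (refl u)
  show ?case using free_equiv.refl[of "w @ u" A B] refl assms(4) by simp
next
  case (one_left u v)
  show ?case using free_equiv.one_left[of "w @ u" A B v] one_left assms(4) by simp
next
  case (one_right u v)
  show ?case using free_equiv.one_right[of "w @ u" A B v] one_right assms(4) by simp
next
  case (mult_left u v a a')
  show ?case using free_equiv.mult_left[of "w @ u" A B v a a'] mult_left assms(4) by simp
next
  case (mult_right u v b b')
  show ?case using free_equiv.mult_right[of "w @ u" A B v b b'] mult_right assms(4) by simp
qed (blast intro: free_equiv.sym free_equiv.trans)+

lemma free_equiv_append_right:
  assumes "group A" "group B" "free_equiv A B u v" "w \<in> free_words A B"
  shows "free_equiv A B (u @ w) (v @ w)"
  using assms(3)
proof induction
  case (refl u)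
  show ?case using free_equiv.refl[of "u @ w" A B] refl assms(4) by simp
next
  case (one_left u v)
  show ?case using free_equiv.one_left[of u A B "v @ w"] one_left assms(4) by simp
next
  case (one_right u v)
  show ?case using free_equiv.one_right[of u A B "v @ w"] one_right assms(4) by simp
next
  case (mult_left u v a a')
  show ?case using free_equiv.mult_left[of u A B "v @ w" a a'] mult_left assms(4) by simp
next
  case (mult_right u v b b')
  show ?case using free_equiv.mult_right[of u A B "v @ w" b b'] mult_right assms(4) by simp
qed (blast intro: free_equiv.sym free_equiv.trans)+

lemma free_equiv_append:
  assumes "group A" "group B" "free_equiv A B u u'" "free_equiv A B v v'"
  shows "free_equiv A B (u @ v) (u' @ v')"
  using free_equiv_append_left[OF assms(1,2,4), of u] free_equiv_append_right[OF assms(1-3), of v']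
    free_equiv_words[OF assms(1-3)] free_equiv_words[OF assms(1,2,4)] free_equiv.trans by blast

lemma free_class_eq:
  assumes "free_equiv A B u v"
  shows "Collect (free_equiv A B u) = Collect (free_equiv A B v)"
  using assms free_equiv.sym free_equiv.trans by blast

lemma free_product_mult_class:
  assumes "group A" "group B" "u \<in> free_words A B" "v \<in> free_words A B"
  shows "Collect (free_equiv A B u) \<otimes>\<^bsub>free_product A B\<^esub> Collect (free_equiv A B v) =
    Collect (free_equiv A B (u @ v))"
proof -
  have "Collect (free_equiv A B (u' @ v')) = Collect (free_equiv A B (u @ v))"
    if "free_equiv A B u u'" "free_equiv A B v v'" for u' v'
    using free_class_eq[OF free_equiv_append[OF assms(1,2) that]] by simp
  then have "(\<Union>v'\<in>Collect (free_equiv A B v). Collect (free_equiv A B (u' @ v'))) =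
      Collect (free_equiv A B (u @ v))" if "free_equiv A B u u'" for u'
    using that free_equiv.refl[OF assms(4)] by (intro SUP_eq_const) auto
  then show ?thesis
    unfolding free_product_def monoid.simps partial_object.simps
    using free_equiv.refl[OF assms(3)] by (subst SUP_eq_const) auto
qed

lemma free_product_group:
  assumes "group A" "group B"
  shows "group (free_product A B)"
proof -
  interpret A: group A by fact
  interpret B: group B by fact
  let ?c = "\<lambda>u. Collect (free_equiv A B u)" and ?P = "free_product A B"
  note m = free_product_mult_class[OF assms]
  have carr: "carrier ?P = ?c ` free_words A B" and one: "\<one>\<^bsub>?P\<^esub> = ?c []"
    by (simp_all add: free_product_def)
  have inv: "\<exists>v \<in> free_words A B. free_equiv A B (v @ u) []" if "u \<in> free_words A B" for u
    using that
  proof induction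
    case Nil
    show ?case by (auto intro!: bexI[of _ "[]"] free_equiv.refl)
  next
    case (Cons x u)
    then obtain v where v: "v \<in> free_words A B" "free_equiv A B (v @ u) []" by blast
    obtain y where y: "y \<in> carrier A <+> carrier B" "free_equiv A B (v @ [y, x] @ u) (v @ u)"
    proof (cases x)
      case (Inl a)
      then have a: "a \<in> carrier A" using Cons.hyps by auto
      have "free_equiv A B (v @ [Inl (inv\<^bsub>A\<^esub> a), Inl a] @ u) (v @ [Inl \<one>\<^bsub>A\<^esub>] @ u)"
        using free_equiv.mult_left[of v A B u "inv\<^bsub>A\<^esub> a" a] v Cons.hyps a by simp
      then show ?thesis
        using that[of "Inl (inv\<^bsub>A\<^esub> a)"] free_equiv.one_left[of v A B u] free_equiv.trans
          v Cons.hyps a Inl by blast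
    next
      case (Inr b)
      then have b: "b \<in> carrier B" using Cons.hyps by auto
      have "free_equiv A B (v @ [Inr (inv\<^bsub>B\<^esub> b), Inr b] @ u) (v @ [Inr \<one>\<^bsub>B\<^esub>] @ u)"
        using free_equiv.mult_right[of v A B u "inv\<^bsub>B\<^esub> b" b] v Cons.hyps b by simp
      then show ?thesis
        using that[of "Inr (inv\<^bsub>B\<^esub> b)"] free_equiv.one_right[of v A B u] free_equiv.trans
          v Cons.hyps b Inr by blast
    qed
    show ?case
      by (rule bexI[of _ "v @ [y]"]) (use y v free_equiv.trans in auto)
  qed
  show ?thesis
  proof (rule groupI)
    fix x assume "x \<in> carrier ?P"
    then obtain u where u: "u \<in> free_words A B" "x = ?c u" by (auto simp: carr)
    obtain v where v: "v \<in> free_words A B" "free_equiv A B (v @ u) []" using inv u by blast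
    show "\<exists>y\<in>carrier ?P. y \<otimes>\<^bsub>?P\<^esub> x = \<one>\<^bsub>?P\<^esub>"
      using u v free_class_eq[OF v(2)] m[of v u] by (auto simp: carr one)
  next
    fix x y z assume "x \<in> carrier ?P" "y \<in> carrier ?P" "z \<in> carrier ?P"
    then obtain u v w where "u \<in> free_words A B" "v \<in> free_words A B" "w \<in> free_words A B"
      and "x = ?c u" "y = ?c v" "z = ?c w"
      unfolding carr by blast
    then show "x \<otimes>\<^bsub>?P\<^esub> y \<otimes>\<^bsub>?P\<^esub> z = x \<otimes>\<^bsub>?P\<^esub> (y \<otimes>\<^bsub>?P\<^esub> z)"
      using m[of u v] m[of v w] m[of "u @ v" w] m[of u "v @ w"] by simp
  next
    fix x y assume "x \<in> carrier ?P" "y \<in> carrier ?P"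
    then obtain u v where "u \<in> free_words A B" "v \<in> free_words A B" and "x = ?c u" "y = ?c v"
      unfolding carr by blast
    then show "x \<otimes>\<^bsub>?P\<^esub> y \<in> carrier ?P"
      using m[of u v] by (auto simp: carr intro!: imageI)
  next
    fix x assume "x \<in> carrier ?P"
    then obtain u where "u \<in> free_words A B" "x = ?c u"
      unfolding carr by blast
    then show "\<one>\<^bsub>?P\<^esub> \<otimes>\<^bsub>?P\<^esub> x = x"
      using m[of "[]" u] by (simp add: one)
  qed (auto simp: carr one)
qed


subsection \<open>The fundamental group\<close>

definition homotopy_class :: "'a::topological_space set \<Rightarrow> (real \<Rightarrow> 'a) \<Rightarrow> (real \<Rightarrow> 'a) set" where
  "homotopy_class S p = {q. homotopic_paths S p q}"

definition fundamental_group :: "'a::topological_space set \<Rightarrow> 'a \<Rightarrow> (real \<Rightarrow> 'a) set monoid" where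
  "fundamental_group S x =
     \<lparr> carrier = homotopy_class S `
         {p. path p \<and> path_image p \<subseteq> S \<and> pathstart p = x \<and> pathfinish p = x},
       mult = (\<lambda>U V. \<Union>p\<in>U. \<Union>q\<in>V. homotopy_class S (p +++ q)),
       one = homotopy_class S (\<lambda>_. x) \<rparr>"


section \<open>Riemannian manifolds\<close>

text \<open>\<open>k\<close> times continuously differentiable on an open set; the directional derivatives are iterated.\<close>

primrec Ck_on :: "nat \<Rightarrow> 'a::real_normed_vector set \<Rightarrow> ('a \<Rightarrow> 'b::real_normed_vector) \<Rightarrow> bool" where
  "Ck_on 0 S f \<longleftrightarrow> continuous_on S f"
| "Ck_on (Suc k) S f \<longleftrightarrow>
     (\<forall>x\<in>S. f differentiable at x) \<and> (\<forall>v. Ck_on k S (\<lambda>x. frechet_derivative f (at x) v))"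

definition smooth_on :: "'a::real_normed_vector set \<Rightarrow> ('a \<Rightarrow> 'b::real_normed_vector) \<Rightarrow> bool" where
  "smooth_on S f \<longleftrightarrow> (\<forall>k. Ck_on k S f)"

type_synonym ('a, 'n) chart = "'a set \<times> ('a \<Rightarrow> real^'n)"

text \<open>
  A chart is a domain together with a coordinate map; \<open>gram M c y\<close> is the matrix
  $(g_{ij}(y))$ of the metric in the chart \<open>c\<close>, as a function of the coordinates \<open>y\<close>.
\<close>

record ('a, 'n) riemannian =
  points :: "'a set"
  charts :: "('a, 'n) chart set"
  gram :: "('a, 'n) chart \<Rightarrow> real^'n \<Rightarrow> real^'n^'n"

definition is_chart :: "'a::topological_space set \<Rightarrow> ('a, 'n::finite) chart \<Rightarrow> bool" where
  "is_chart P c \<longleftrightarrow>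
     openin (top_of_set P) (fst c) \<and> open (snd c ` fst c) \<and>
     (\<exists>\<psi>. homeomorphism (fst c) (snd c ` fst c) (snd c) \<psi>)"

text \<open>
  For a continuous \<open>f\<close>: all coordinate expressions \<open>\<tau>\<close> of \<open>f\<close> are smooth and pull the metric of
  \<open>N\<close> back to that of \<open>M\<close>. For \<open>f = id\<close> and \<open>M = N\<close> this says that the changes of coordinates
  are smooth and that the matrices \<open>gram M c\<close> are the local expressions of one tensor field.
\<close>

definition local_isometry ::
    "('a, 'n::finite) riemannian \<Rightarrow> ('b, 'n) riemannian \<Rightarrow> ('a \<Rightarrow> 'b) \<Rightarrow> bool" where
  "local_isometry M N f \<longleftrightarrow>
     (\<forall>c\<in>charts M. \<forall>c'\<in>charts N.
        let W = snd c ` (fst c \<inter> f -` fst c');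
            \<tau> = snd c' \<circ> f \<circ> inv_into (fst c) (snd c)
        in smooth_on W \<tau> \<and>
           (\<forall>y\<in>W. \<forall>u v.
              u \<bullet> (gram M c y *v v) =
              frechet_derivative \<tau> (at y) u \<bullet> (gram N c' (\<tau> y) *v frechet_derivative \<tau> (at y) v)))"

definition riemannian_manifold ::
    "('a::{t2_space, second_countable_topology}, 'n::finite) riemannian \<Rightarrow> bool" where
  "riemannian_manifold M \<longleftrightarrow>
     (\<forall>c\<in>charts M. is_chart (points M) c) \<and>
     points M = (\<Union>c\<in>charts M. fst c) \<and>
     (\<forall>c\<in>charts M.
        smooth_on (snd c ` fst c) (gram M c) \<and>
        (\<forall>y \<in> snd c ` fst c. transpose (gram M c y) = gram M c y \<and>
           (\<forall>v. v \<noteq> 0 \<longrightarrow> v \<bullet> (gram M c y *v v) > 0))) \<and>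
     local_isometry M M id"


subsection \<open>Length, distance and volume\<close>

text \<open>
  The library's notion of piecewise $C^1$ allows an unbounded derivative near the finitely many
  exceptional parameters. This does not affect the infimum of the lengths.
\<close>

definition piecewise_C1_curve ::
    "('a::topological_space, 'n::finite) riemannian \<Rightarrow> (real \<Rightarrow> 'a) \<Rightarrow> bool" where
  "piecewise_C1_curve M \<gamma> \<longleftrightarrow>
     path \<gamma> \<and> path_image \<gamma> \<subseteq> points M \<and>
     (\<forall>c\<in>charts M. \<forall>a b. 0 \<le> a \<and> a \<le> b \<and> b \<le> 1 \<and> \<gamma> ` {a..b} \<subseteq> fst c \<longrightarrow>
        (snd c \<circ> \<gamma>) piecewise_C1_differentiable_on {a..b})"

text \<open>On a Riemannian manifold the speed does not depend on the choice of the chart.\<close>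

definition speed :: "('a, 'n::finite) riemannian \<Rightarrow> (real \<Rightarrow> 'a) \<Rightarrow> real \<Rightarrow> real" where
  "speed M \<gamma> t =
     (let c = (SOME c. c \<in> charts M \<and> \<gamma> t \<in> fst c);
          v = vector_derivative (snd c \<circ> \<gamma>) (at t)
      in sqrt (v \<bullet> (gram M c (snd c (\<gamma> t)) *v v)))"

definition curve_length :: "('a, 'n::finite) riemannian \<Rightarrow> (real \<Rightarrow> 'a) \<Rightarrow> ennreal" where
  "curve_length M \<gamma> = (\<integral>\<^sup>+t\<in>{0..1}. ennreal (speed M \<gamma> t) \<partial>lborel)"

definition rdist :: "('a::topological_space, 'n::finite) riemannian \<Rightarrow> 'a \<Rightarrow> 'a \<Rightarrow> ennreal" where
  "rdist M x y =
     (INF \<gamma> \<in> {\<gamma>. piecewise_C1_curve M \<gamma> \<and> pathstart \<gamma> = x \<and> pathfinish \<gamma> = y}. curve_length M \<gamma>)"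

definition rball :: "('a::topological_space, 'n::finite) riemannian \<Rightarrow> 'a \<Rightarrow> real \<Rightarrow> 'a set" where
  "rball M x R = {y \<in> points M. rdist M x y < ennreal R}"

text \<open>
  The Riemannian measure: the Borel measure given by $\sqrt{\det (g_{ij})}\,dy$ in every chart. By
  the change of variables formula and second countability there is exactly one such measure.
\<close>

definition riemannian_volume ::
    "('a::topological_space, 'n::finite) riemannian \<Rightarrow> 'a measure" where
  "riemannian_volume M = (THE \<mu>.
     space \<mu> = points M \<and> sets \<mu> = sets (restrict_space borel (points M)) \<and>
     (\<forall>c\<in>charts M. \<forall>B\<in>sets \<mu>. B \<subseteq> fst c \<longrightarrow>
        emeasure \<mu> B = (\<integral>\<^sup>+y\<in>snd c ` B. ennreal (sqrt (det (gram M c y))) \<partial>lborel)))"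


section \<open>Universal coverings, entropy and diastole\<close>

definition riemannian_universal_covering ::
    "('b::{t2_space, second_countable_topology}, 'n::finite) riemannian \<Rightarrow> ('b \<Rightarrow> 'a) \<Rightarrow>
     ('a::{t2_space, second_countable_topology}, 'n) riemannian \<Rightarrow> bool" where
  "riemannian_universal_covering Xt p X \<longleftrightarrow>
     riemannian_manifold Xt \<and> simply_connected (points Xt) \<and>
     covering_space (points Xt) p (points X) \<and> local_isometry Xt X p"

definition ln_ennreal :: "ennreal \<Rightarrow> ereal" where
  "ln_ennreal v =
     (if v = \<infinity> then \<infinity> else if v = 0 then -\<infinity> else ereal (ln (enn2real v)))"

text \<open>
  \<open>h\<close> is the entropy of the manifold with Riemannian universal covering \<open>Xt\<close>: the limit
  exists and equals \<open>h\<close> for every centre.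
\<close>

definition has_entropy ::
    "('b::topological_space, 'n::finite) riemannian \<Rightarrow> ereal \<Rightarrow> bool" where
  "has_entropy Xt h \<longleftrightarrow>
     (\<forall>x\<in>points Xt.
        ((\<lambda>R. ereal (1 / R) * ln_ennreal (emeasure (riemannian_volume Xt) (rball Xt x R))) \<longlongrightarrow> h)
          at_top)"

text \<open>
  For a universal covering \<open>p\<close> with total space \<open>P\<close> the deck transformations form the fundamental
  group of the base in its action on \<open>P\<close>. They are functions on the whole type, so two of them
  are the same if they agree on \<open>P\<close>.
\<close>

definition deck_transformations :: "'b::topological_space set \<Rightarrow> ('b \<Rightarrow> 'a) \<Rightarrow> ('b \<Rightarrow> 'b) set" where
  "deck_transformations P p =
     {f. (\<exists>g. homeomorphism P P f g) \<and> (\<forall>x\<in>P. p (f x) = p x)}"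

definition diastole ::
    "('b::topological_space, 'n::finite) riemannian \<Rightarrow> ('b \<Rightarrow> 'a) \<Rightarrow> ennreal" where
  "diastole Xt p =
     (SUP x \<in> points Xt.
        INF f \<in> {f \<in> deck_transformations (points Xt) p. \<exists>z\<in>points Xt. f z \<noteq> z}. rdist Xt x (f x))"

end

theory Submission
  imports Defs "HOL-Combinatorics.Permutations" "HOL-Real_Asymp.Real_Asymp"
begin

text \<open>
  Let $L = \log 3 / (6H)$ and suppose that every point \<open>x\<close> of the universal covering is moved by less
  than \<open>L\<close> by some nontrivial deck transformation. The fundamental group acts on the Bass--Serre tree
  of its decomposition as a free product; to an element $g \neq 1$ assign the edges of its axis if it
  is hyperbolic, and the edges at its fixed vertex if it is elliptic. If \<open>g\<close> and \<open>k\<close> have different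
  sets of edges, then by a ping-pong argument two products of at most three of the elements
  $g^{\pm 1}$, $k^{\pm 1}$ generate a free semigroup; here the absence of 2-torsion guarantees that no
  element reverses an axis. If both \<open>g\<close> and \<open>k\<close> move \<open>x\<close> by less than \<open>L\<close>, then these products
  move \<open>x\<close> by less than \<open>3L\<close>, so that the entropy is at least
  $\log 2 / (3L) = 2 H \log 2 / \log 3 > H$, a contradiction. Hence the set of edges depends on \<open>x\<close>
  only, it is locally constant in \<open>x\<close>, and by connectedness it is the same for all \<open>x\<close>. But conjugation
  by a deck transformation translates it, and no set of this kind is invariant under the whole group.
\<close>

section \<open>Reduced words in a free product\<close>

text \<open>The tree enters only through normal forms: the length and the first letter of
  \<open>inv e \<otimes> f\<close> give distance and side, so each geometric claim becomes the claim
  that some product is reduced as written. A hyperbolic element is compared with a conjugate of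
  itself, and this is why products of three elements occur. For two hyperbolic elements with
  overlapping axes and different translation lengths, positive words need not be readable from their
  normal forms; conjugates have equal length, and two distinct words of equal length form a prefix
  code. Attaching edges, rather than a vertex or a line, to an element treats both types by one
  formula. Moreover the group is transitive on edges, so that an invariant nonempty set of edges has
  to be everything. The constant leaves room: the contradiction only uses that \<open>L\<close> is
  less than \<open>ln 2 / (3 * H)\<close>, which for the given value means that 3 is less than 4. On
  the geometric side, deck transformations are by definition mere homeomorphisms over
  \<open>p\<close>. That they preserve lengths and volumes has to be derived before any volume can
  be counted.\<close>

locale group_pair = A: group A + B: group B
  for A :: "('a, 'c) monoid_scheme" (structure) and B :: "('b, 'd) monoid_scheme" (structure)
begin

definition letters :: "('a + 'b) set" where
  "letters = (carrier A - {\<one>\<^bsub>A\<^esub>}) <+> (carrier B - {\<one>\<^bsub>B\<^esub>})"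

definition reduced :: "('a + 'b) list \<Rightarrow> bool" where
  "reduced w \<longleftrightarrow> set w \<subseteq> letters \<and> distinct_adj (map isl w)"

text \<open>On letters of different factors the value \<open>x\<close> is a mere default:
  \<open>push\<close> forms the product only after comparing the factors.\<close>

fun letter_mult :: "'a + 'b \<Rightarrow> 'a + 'b \<Rightarrow> 'a + 'b" where
  "letter_mult (Inl a) (Inl a') = Inl (a \<otimes>\<^bsub>A\<^esub> a')"
| "letter_mult (Inr b) (Inr b') = Inr (b \<otimes>\<^bsub>B\<^esub> b')"
| "letter_mult x y = x"

fun letter_inv :: "'a + 'b \<Rightarrow> 'a + 'b" where
  "letter_inv (Inl a) = Inl (inv\<^bsub>A\<^esub> a)"
| "letter_inv (Inr b) = Inr (inv\<^bsub>B\<^esub> b)"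

text \<open>This is van der Waerden's action of single letters on reduced words. Folding it over a
  word produces the normal form, and uniqueness follows because the action respects the defining
  relations, without a confluence argument.\<close>

fun push :: "'a + 'b \<Rightarrow> ('a + 'b) list \<Rightarrow> ('a + 'b) list" where
  "push x [] = (if x \<in> letters then [x] else [])"
| "push x (y # w) =
     (if x \<notin> letters then y # w
      else if isl x \<noteq> isl y then x # y # w
      else if letter_mult x y \<in> letters then letter_mult x y # w else w)"

abbreviation normal_form :: "('a + 'b) list \<Rightarrow> ('a + 'b) list" where
  "normal_form u \<equiv> foldr push u []"

lemma Inl_letters [simp]: "Inl a \<in> letters \<longleftrightarrow> a \<in> carrier A \<and> a \<noteq> \<one>\<^bsub>A\<^esub>"
  and Inr_letters [simp]: "Inr b \<in> letters \<longleftrightarrow> b \<in> carrier B \<and> b \<noteq> \<one>\<^bsub>B\<^esub>"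
  by (auto simp: letters_def)

lemma reduced_Nil [simp]: "reduced []"
  by (simp add: reduced_def)

lemma reduced_Cons: "reduced (x # w) \<longleftrightarrow>
    x \<in> letters \<and> reduced w \<and> (w \<noteq> [] \<longrightarrow> isl x \<noteq> isl (hd w))"
  by (cases w) (auto simp: reduced_def)

lemma reduced_append: "reduced (u @ v) \<longleftrightarrow>
    reduced u \<and> reduced v \<and> (u \<noteq> [] \<longrightarrow> v \<noteq> [] \<longrightarrow> isl (last u) \<noteq> isl (hd v))"
  by (auto simp: reduced_def distinct_adj_append_iff last_map hd_map)

lemma isl_letter_mult [simp]: "isl (letter_mult x y) = isl x"
  by (cases "(x, y)" rule: letter_mult.cases) auto

lemma reduced_push: "reduced w \<Longrightarrow> reduced (push x w)"
  by (cases w) (auto simp: reduced_Cons)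

lemma letter_mult_closed:
  "x \<in> carrier A <+> carrier B \<Longrightarrow> y \<in> carrier A <+> carrier B \<Longrightarrow> isl x = isl y \<Longrightarrow>
    letter_mult x y \<in> carrier A <+> carrier B"
  by (cases "(x, y)" rule: letter_mult.cases) auto

lemma letter_mult_assoc:
  assumes "x \<in> carrier A <+> carrier B" "y \<in> carrier A <+> carrier B" "z \<in> carrier A <+> carrier B"
    "isl x = isl y" "isl y = isl z"
  shows "letter_mult (letter_mult x y) z = letter_mult x (letter_mult y z)"
  using assms by (cases x; cases y; cases z) (auto simp: A.m_assoc B.m_assoc)

lemma letter_mult_unit_left:
  "x \<in> carrier A <+> carrier B \<Longrightarrow> y \<in> carrier A <+> carrier B \<Longrightarrow> isl x = isl y \<Longrightarrow>
    x \<notin> letters \<Longrightarrow> letter_mult x y = y"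
  by (cases x; cases y) auto

lemma letter_mult_unit_right:
  "x \<in> carrier A <+> carrier B \<Longrightarrow> y \<in> carrier A <+> carrier B \<Longrightarrow> isl x = isl y \<Longrightarrow>
    y \<notin> letters \<Longrightarrow> letter_mult x y = x"
  by (cases x; cases y) auto

lemma push_unit: "x \<notin> letters \<Longrightarrow> push x w = w"
  by (cases w) auto

text \<open>Everything reduces to associativity inside one factor. If \<open>y\<close> cancels
  against the head \<open>z\<close> of \<open>w\<close>, the tail starts in the other factor, so
  \<open>x\<close> is simply prefixed to it.\<close>

lemma push_mult:
  assumes w: "reduced w" and x: "x \<in> carrier A <+> carrier B" and y: "y \<in> carrier A <+> carrier B"
    and xy: "isl x = isl y"
  shows "push x (push y w) = push (letter_mult x y) w"
proof (cases "x \<in> letters \<and> y \<in> letters")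
  case False
  then show ?thesis
    using letter_mult_unit_left[OF x y xy] letter_mult_unit_right[OF x y xy] by (auto simp: push_unit)
next
  case True
  show ?thesis
  proof (cases w)
    case Nil
    then show ?thesis using True xy by simp
  next
    case (Cons z w')
    have z: "z \<in> letters" "z \<in> carrier A <+> carrier B" and w': "w' = [] \<or> isl (hd w') \<noteq> isl z"
      using w Cons by (auto simp: reduced_Cons letters_def)
    show ?thesis
    proof (cases "isl y = isl z")
      case False
      then show ?thesis using True Cons xy by (simp add: push_unit)
    next
      case yz: True
      have push_w': "push x w' = x # w'"
        using w' True xy yz by (cases w') auto
      note assoc = letter_mult_assoc[OF x y z(2) xy yz]
      have "letter_mult x y \<notin> letters \<Longrightarrow> letter_mult x (letter_mult y z) = z"
        using letter_mult_unit_left[OF letter_mult_closed[OF x y xy] z(2)] assoc xy yz by simp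
      moreover have "letter_mult y z \<notin> letters \<Longrightarrow> letter_mult x (letter_mult y z) = x"
        using letter_mult_unit_right[OF x letter_mult_closed[OF y z(2) yz]] xy by simp
      ultimately show ?thesis
        using True z yz xy Cons assoc push_w'
        by (cases "letter_mult y z \<in> letters"; cases "letter_mult x y \<in> letters") (auto simp: push_unit)
    qed
  qed
qed

lemma foldr_push_reduced: "reduced w \<Longrightarrow> reduced (foldr push u w)"
  by (induction u) (auto simp: reduced_push)

text \<open>Since the word \<open>w\<close> acted upon is arbitrary, the contexts of a rewriting
  step cause no trouble: the right context turns \<open>w\<close> into another reduced word, and the
  left one is applied to equal words.\<close>

lemma foldr_push_equiv:
  assumes "free_equiv A B u v" "reduced w"
  shows "foldr push u w = foldr push v w"
  using assms
proof (induction arbitrary: w)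
  case (mult_left u v a a')
  have "push (Inl a) (push (Inl a') (foldr push v w)) = push (Inl (a \<otimes>\<^bsub>A\<^esub> a')) (foldr push v w)"
    using push_mult[of "foldr push v w" "Inl a" "Inl a'"] mult_left foldr_push_reduced by auto
  then show ?case by simp
next
  case (mult_right u v b b')
  have "push (Inr b) (push (Inr b') (foldr push v w)) = push (Inr (b \<otimes>\<^bsub>B\<^esub> b')) (foldr push v w)"
    using push_mult[of "foldr push v w" "Inr b" "Inr b'"] mult_right foldr_push_reduced by auto
  then show ?case by simp
qed (simp_all add: push_unit)

lemma normal_form_reduced: "reduced u \<Longrightarrow> normal_form u = u"
proof (induction u)
  case (Cons x u)
  then show ?case by (cases u) (auto simp: reduced_Cons)
qed simp

lemma reduced_words: "reduced u \<Longrightarrow> u \<in> free_words A B"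
  by (auto simp: reduced_def letters_def)

text \<open>Normalisation stays inside the congruence class; together with
  \<open>foldr_push_equiv\<close> this makes reduced words unique representatives.\<close>

lemma free_equiv_push:
  assumes "x \<in> carrier A <+> carrier B" "w \<in> free_words A B"
  shows "free_equiv A B (x # w) (push x w)"
proof -
  have unit: "free_equiv A B (y # v) v"
    if "y \<in> carrier A <+> carrier B" "y \<notin> letters" "v \<in> free_words A B" for y v
    using that free_equiv.one_left[of "[]" A B v] free_equiv.one_right[of "[]" A B v]
    by (cases y) auto
  show ?thesis
  proof (cases "x \<notin> letters")
    case True
    then show ?thesis using unit assms by (simp add: push_unit)
  next
    case x: False
    show ?thesis
    proof (cases w)
      case Nil
      then show ?thesis using x assms by (auto intro!: free_equiv.refl)
    next
      case (Cons y w')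
      show ?thesis
      proof (cases "isl x = isl y")
        case False
        then show ?thesis using x assms Cons by (auto intro!: free_equiv.refl)
      next
        case True
        have m: "free_equiv A B (x # y # w') (letter_mult x y # w')"
          "letter_mult x y \<in> carrier A <+> carrier B"
          using free_equiv.mult_left[of "[]" A B w'] free_equiv.mult_right[of "[]" A B w'] True assms Cons
          by (cases "(x, y)" rule: letter_mult.cases; auto)+
        then show ?thesis
          using unit[of "letter_mult x y" w'] x True assms Cons by (auto intro: free_equiv.trans)
      qed
    qed
  qed
qed

lemma free_equiv_normal_form:
  assumes "u \<in> free_words A B"
  shows "free_equiv A B u (normal_form u)"
  using assms
proof (induction u)
  case Nil
  show ?case by (auto intro: free_equiv.refl)
next
  case (Cons x u)
  have w: "normal_form u \<in> free_words A B"
    using foldr_push_reduced[of "[]" u] reduced_words by simp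
  have "free_equiv A B ([x] @ u) ([x] @ normal_form u)"
    using free_equiv_append_left[OF A.is_group B.is_group Cons.IH, of "[x]"] Cons.hyps by simp
  then show ?case using free_equiv_push[OF _ w, of x] Cons.hyps by (auto intro: free_equiv.trans)
qed

definition word_inv :: "('a + 'b) list \<Rightarrow> ('a + 'b) list" where
  "word_inv w = rev (map letter_inv w)"

lemma letter_inv_letters: "x \<in> letters \<Longrightarrow> letter_inv x \<in> letters"
  by (cases x) auto

lemma isl_letter_inv [simp]: "isl (letter_inv x) = isl x"
  by (cases x) auto

lemma map_isl_word_inv: "map isl (word_inv w) = rev (map isl w)"
  by (simp add: word_inv_def rev_map comp_def)

lemma reduced_word_inv: "reduced w \<Longrightarrow> reduced (word_inv w)"
  unfolding reduced_def map_isl_word_inv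
  by (auto simp: letter_inv_letters word_inv_def)

lemma word_inv_cancel:
  assumes "reduced w"
  shows "free_equiv A B (word_inv w @ w) []"
  using assms
proof (induction w)
  case Nil
  show ?case by (auto simp: word_inv_def intro: free_equiv.refl)
next
  case (Cons x w)
  let ?v = "word_inv w"
  have w: "x \<in> letters" "reduced w" "w \<in> free_words A B" "?v \<in> free_words A B"
    using Cons.prems reduced_words reduced_word_inv by (auto simp: reduced_Cons)
  have "free_equiv A B (?v @ [letter_inv x, x] @ w) (?v @ w)"
  proof (cases x)
    case (Inl a)
    then have a: "a \<in> carrier A" using w by auto
    show ?thesis
      using free_equiv.mult_left[of ?v A B w "inv\<^bsub>A\<^esub> a" a] free_equiv.one_left[of ?v A B w] w a Inl
      by (auto intro: free_equiv.trans)
  next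
    case (Inr b)
    then have b: "b \<in> carrier B" using w by auto
    show ?thesis
      using free_equiv.mult_right[of ?v A B w "inv\<^bsub>B\<^esub> b" b] free_equiv.one_right[of ?v A B w] w b Inr
      by (auto intro: free_equiv.trans)
  qed
  then show ?case using Cons.IH w by (auto simp: word_inv_def intro: free_equiv.trans)
qed

end


section \<open>Groups with normal forms\<close>

text \<open>
  The elements of the group are the edges of the Bass--Serre tree: the edge \<open>g\<close> joins the two cosets
  of the factors that contain \<open>g\<close>, and the side of the first letter of \<open>nf (inv g \<otimes> h)\<close> tells on
  which side of \<open>g\<close> the edge \<open>h\<close> lies.
\<close>

locale normal_forms = group G for G :: "'g monoid" (structure) +
  fixes nf :: "'g \<Rightarrow> 'l list" and side :: "'l \<Rightarrow> bool"
  assumes nf_inj: "x \<in> carrier G \<Longrightarrow> y \<in> carrier G \<Longrightarrow> nf x = nf y \<Longrightarrow> x = y"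
    and nf_one: "nf \<one> = []"
    and nf_mult: "x \<in> carrier G \<Longrightarrow> y \<in> carrier G \<Longrightarrow> nf x \<noteq> [] \<Longrightarrow> nf y \<noteq> [] \<Longrightarrow>
      side (last (nf x)) \<noteq> side (hd (nf y)) \<Longrightarrow> nf (x \<otimes> y) = nf x @ nf y"
    and nf_inv: "x \<in> carrier G \<Longrightarrow> map side (nf (inv x)) = rev (map side (nf x))"
    and nf_split: "x \<in> carrier G \<Longrightarrow> nf x = u @ v \<Longrightarrow>
      \<exists>y\<in>carrier G. \<exists>z\<in>carrier G. nf y = u \<and> nf z = v"
    and nf_alternating: "x \<in> carrier G \<Longrightarrow> distinct_adj (map side (nf x))"
    and nf_mult_letters: "x \<in> carrier G \<Longrightarrow> y \<in> carrier G \<Longrightarrow> nf x = [a] \<Longrightarrow> nf y = [b] \<Longrightarrow>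
      side a = side b \<Longrightarrow> nf (x \<otimes> y) = [] \<or> (\<exists>c. nf (x \<otimes> y) = [c] \<and> side c = side a)"
    and letter_exists: "\<exists>x\<in>carrier G. \<exists>a. nf x = [a] \<and> side a = s"

lemma (in group_pair) free_product_normal_forms:
  assumes "carrier A \<noteq> {\<one>\<^bsub>A\<^esub>}" "carrier B \<noteq> {\<one>\<^bsub>B\<^esub>}"
  shows "\<exists>nf :: _ \<Rightarrow> ('a + 'b) list. normal_forms (free_product A B) nf isl"
proof -
  let ?P = "free_product A B" and ?c = "\<lambda>u. Collect (free_equiv A B u)"
  interpret P: group ?P by (rule free_product_group[OF A.is_group B.is_group])
  note m = free_product_mult_class[OF A.is_group B.is_group]
  \<comment> \<open>Any representative of the class will do, because equivalent words have the same
    normal form.\<close>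
  define nf where "nf X = normal_form (SOME u. u \<in> X)" for X :: "('a + 'b) list set"
  have carr: "carrier ?P = ?c ` free_words A B" and one: "\<one>\<^bsub>?P\<^esub> = ?c []"
    by (simp_all add: free_product_def)
  have nf_class: "nf (?c u) = normal_form u" if "u \<in> free_words A B" for u
  proof -
    have "u \<in> ?c u" using that by (auto intro: free_equiv.refl)
    then have "(SOME v. v \<in> ?c u) \<in> ?c u" by (rule someI)
    then show ?thesis using foldr_push_equiv[of u _ "[]"] by (simp add: nf_def)
  qed
  have class_nf: "reduced (nf X) \<and> X = ?c (nf X)" if X: "X \<in> carrier ?P" for X
  proof -
    obtain u where u: "u \<in> free_words A B" "X = ?c u" using X carr by auto
    have "nf X = normal_form u" using u nf_class by blast
    then show ?thesis
      using free_class_eq[OF free_equiv_normal_form[OF u(1)]] u foldr_push_reduced[of "[]" u]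
      by (metis reduced_Nil)
  qed
  have nf_red: "nf (?c u) = u" if "reduced u" for u
    using nf_class normal_form_reduced reduced_words that by simp
  have closed: "?c u \<in> carrier ?P" if "reduced u" for u
    using that reduced_words carr by auto
  have mult: "X \<otimes>\<^bsub>?P\<^esub> Y = ?c (nf X @ nf Y)" if "X \<in> carrier ?P" "Y \<in> carrier ?P" for X Y
    using m[of "nf X" "nf Y"] class_nf that reduced_words by metis
  have inv_class: "inv\<^bsub>?P\<^esub> X = ?c (word_inv (nf X))" if X: "X \<in> carrier ?P" for X
  proof (rule P.inv_equality)
    have r: "reduced (nf X)" using class_nf X by blast
    show "?c (word_inv (nf X)) \<in> carrier ?P" using closed reduced_word_inv r by blast
    then show "?c (word_inv (nf X)) \<otimes>\<^bsub>?P\<^esub> X = \<one>\<^bsub>?P\<^esub>"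
      using mult[of "?c (word_inv (nf X))" X] X nf_red reduced_word_inv r
        free_class_eq[OF word_inv_cancel[OF r]] one by simp
  qed fact
  have "normal_forms ?P nf isl"
  proof
    fix X Y assume X: "X \<in> carrier ?P" and Y: "Y \<in> carrier ?P"
    have rX: "reduced (nf X)" and rY: "reduced (nf Y)" using class_nf X Y by blast+
    show "X = Y" if "nf X = nf Y" using that class_nf X Y by metis
    show "nf (X \<otimes>\<^bsub>?P\<^esub> Y) = nf X @ nf Y" 
      if "nf X \<noteq> []" "nf Y \<noteq> []" "isl (last (nf X)) \<noteq> isl (hd (nf Y))"
      using mult[OF X Y] nf_red[of "nf X @ nf Y"] rX rY that by (simp add: reduced_append)
    show "nf (X \<otimes>\<^bsub>?P\<^esub> Y) = [] \<or> (\<exists>c. nf (X \<otimes>\<^bsub>?P\<^esub> Y) = [c] \<and> isl c = isl a)"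
      if "nf X = [a]" "nf Y = [b]" "isl a = isl b" for a b
    proof -
      have "nf (X \<otimes>\<^bsub>?P\<^esub> Y) = normal_form [a, b]"
        using mult[OF X Y] nf_class[of "[a, b]"] that reduced_words[OF rX] reduced_words[OF rY] by simp
      then show ?thesis using that rX rY
        by (auto simp: reduced_Cons)
    qed
  next
    fix X assume X: "X \<in> carrier ?P"
    have r: "reduced (nf X)" using class_nf X by blast
    show "map isl (nf (inv\<^bsub>?P\<^esub> X)) = rev (map isl (nf X))"
      using inv_class[OF X] nf_red reduced_word_inv[OF r] map_isl_word_inv by simp
    show "distinct_adj (map isl (nf X))" using r by (simp add: reduced_def)
    show "\<exists>Y\<in>carrier ?P. \<exists>Z\<in>carrier ?P. nf Y = u \<and> nf Z = v" if "nf X = u @ v" for u v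
      using closed nf_red r that by (metis reduced_append)
  next
    show "nf \<one>\<^bsub>?P\<^esub> = []" using nf_red[of "[]"] one by simp
  next
    fix s :: bool
    obtain a b where "a \<in> carrier A" "a \<noteq> \<one>\<^bsub>A\<^esub>" "b \<in> carrier B" "b \<noteq> \<one>\<^bsub>B\<^esub>"
      using assms A.one_closed B.one_closed by blast
    then have r: "reduced [if s then Inl a else Inr b]" by (simp add: reduced_Cons)
    show "\<exists>X\<in>carrier ?P. \<exists>c. nf X = [c] \<and> isl c = s"
      by (intro bexI[OF _ closed[OF r]] exI conjI, rule nf_red[OF r]) auto
  qed
  then show ?thesis by blast
qed

section \<open>Free semigroups and ping-pong\<close>

primrec (in monoid) word_product :: "'a \<Rightarrow> 'a \<Rightarrow> bool list \<Rightarrow> 'a" where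
  "word_product a b [] = \<one>"
| "word_product a b (s # w) = (if s then a else b) \<otimes> word_product a b w"

text \<open>Only words of equal length are compared, since the volume count treats the
  \<open>2 ^ n\<close> words of each length \<open>n\<close> separately.\<close>

definition (in monoid) free_pair :: "'a \<Rightarrow> 'a \<Rightarrow> bool" where
  "free_pair a b \<longleftrightarrow> (\<forall>n. inj_on (word_product a b) {w. length w = n})"

context group begin

lemma inv_cancel [simp]:
  "x \<in> carrier G \<Longrightarrow> y \<in> carrier G \<Longrightarrow> inv x \<otimes> (x \<otimes> y) = y"
  "x \<in> carrier G \<Longrightarrow> y \<in> carrier G \<Longrightarrow> x \<otimes> (inv x \<otimes> y) = y"
  by (simp_all add: m_assoc[symmetric])

lemma word_product_closed [simp]:
  "a \<in> carrier G \<Longrightarrow> b \<in> carrier G \<Longrightarrow> word_product a b w \<in> carrier G"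
  by (induction w) auto

lemma word_product_conj:
  assumes "a \<in> carrier G" "b \<in> carrier G" "g \<in> carrier G"
  shows "word_product (g \<otimes> a \<otimes> inv g) (g \<otimes> b \<otimes> inv g) w = g \<otimes> word_product a b w \<otimes> inv g"
  using assms by (induction w) (auto simp: m_assoc)

lemma free_pair_conj:
  assumes "a \<in> carrier G" "b \<in> carrier G" "g \<in> carrier G" "free_pair (inv g \<otimes> a \<otimes> g) (inv g \<otimes> b \<otimes> g)"
  shows "free_pair a b"
  using assms word_product_conj[of a b "inv g"] unfolding free_pair_def inj_on_def by auto

text \<open>Two different words of equal length have a first place where they differ; cancelling the
  common prefix leaves one product starting with \<open>a\<close> and one starting with
  \<open>b\<close>.\<close>

lemma free_pairI:
  assumes ab: "a \<in> carrier G" "b \<in> carrier G"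
    and ne: "\<And>v w. a \<otimes> word_product a b v \<noteq> b \<otimes> word_product a b w"
  shows "free_pair a b"
  unfolding free_pair_def
proof
  fix n
  have "v = w" if "length v = n" "length w = n" "word_product a b v = word_product a b w" for v w
    using that
  proof (induction n arbitrary: v w)
    case (Suc n)
    then obtain s v' t w' where vw: "v = s # v'" "w = t # w'" by (metis length_Suc_conv)
    have "s = t" using Suc.prems ne[of v' w'] ne[of w' v'] vw by (auto split: if_splits)
    then have "word_product a b v' = word_product a b w'"
      using Suc.prems vw ab by (auto split: if_splits)
    then show ?case using Suc vw \<open>s = t\<close> by auto
  qed simp
  then show "inj_on (word_product a b) {w. length w = n}" by (auto intro: inj_onI)
qed

text \<open>Semigroup form: inverses never occur, so \<open>a\<close> may move both table sets into
  \<open>P\<close>, and \<open>b\<close> both into \<open>Q\<close>. The set containing the image of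
  \<open>x\<close> then betrays the first letter of a word.\<close>

lemma ping_pong:
  assumes ab: "a \<in> carrier G" "b \<in> carrier G"
    and "P \<subseteq> carrier G" "Q \<subseteq> carrier G" "P \<inter> Q = {}" "x \<in> P \<union> Q"
    and "\<And>y. y \<in> P \<union> Q \<Longrightarrow> a \<otimes> y \<in> P" "\<And>y. y \<in> P \<union> Q \<Longrightarrow> b \<otimes> y \<in> Q"
  shows "free_pair a b"
proof (rule free_pairI[OF ab])
  have x: "x \<in> carrier G" using assms by auto
  have *: "word_product a b w \<otimes> x \<in> P \<union> Q" for w
  proof (induction w)
    case (Cons s w)
    then show ?case using assms(7,8)[OF Cons.IH] ab x by (auto simp: m_assoc)
  qed (use assms x in auto)
  fix v w
  show "a \<otimes> word_product a b v \<noteq> b \<otimes> word_product a b w"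
    using assms(5) assms(7)[OF *[of v]] assms(8)[OF *[of w]] ab x
    by (metis IntI empty_iff m_assoc word_product_closed)
qed

end

context normal_forms begin

section \<open>Word length, initial letters and the two factors\<close>

definition len :: "'g \<Rightarrow> nat" where "len x = length (nf x)"

text \<open>At the unit this is the unspecified value \<open>side (hd [])\<close>; hence the
  recurring conditions that an element differs from \<open>\<one>\<close>.\<close>

definition first :: "'g \<Rightarrow> bool" where "first x = side (hd (nf x))"

lemma nf_Nil_iff: "x \<in> carrier G \<Longrightarrow> nf x = [] \<longleftrightarrow> x = \<one>"
  using nf_inj nf_one by fastforce

lemma len_0_iff [simp]: "x \<in> carrier G \<Longrightarrow> len x = 0 \<longleftrightarrow> x = \<one>"
  by (simp add: len_def nf_Nil_iff)

lemma len_one [simp]: "len \<one> = 0" by simp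

lemma len_inv [simp]: "x \<in> carrier G \<Longrightarrow> len (inv x) = len x"
  using nf_inv[of x] by (metis len_def length_map length_rev)

lemma first_inv: "x \<in> carrier G \<Longrightarrow> x \<noteq> \<one> \<Longrightarrow> first (inv x) = side (last (nf x))"
  using nf_inv[of x] nf_Nil_iff[of x] nf_Nil_iff[of "inv x"]
  by (metis first_def hd_map hd_rev inv_closed last_map map_is_Nil_conv rev_is_Nil_conv)

text \<open>As \<open>first (inv x)\<close> is the side of the last letter of \<open>x\<close>, the
  condition says that the two words meet in letters of different factors, where nothing cancels or
  merges.\<close>

lemma reduced_mult:
  assumes "x \<in> carrier G" "y \<in> carrier G" "x \<noteq> \<one>" "y \<noteq> \<one>" "first (inv x) \<noteq> first y"
  shows "nf (x \<otimes> y) = nf x @ nf y" "len (x \<otimes> y) = len x + len y" "first (x \<otimes> y) = first x"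
    "x \<otimes> y \<noteq> \<one>"
proof -
  show *: "nf (x \<otimes> y) = nf x @ nf y"
    using nf_mult[of x y] assms first_inv[of x] nf_Nil_iff by (auto simp: first_def)
  then show "len (x \<otimes> y) = len x + len y" "first (x \<otimes> y) = first x" "x \<otimes> y \<noteq> \<one>"
    using assms nf_Nil_iff by (auto simp: len_def first_def nf_one)
qed

text \<open>Both products are reduced as written, so their common normal form has
  \<open>nf x\<close> and \<open>nf y\<close> as prefixes of the same length.\<close>

lemma reduced_mult_eq:
  assumes "x \<in> carrier G" "u \<in> carrier G" "y \<in> carrier G" "v \<in> carrier G" "x \<noteq> \<one>" "y \<noteq> \<one>"
    and "u = \<one> \<or> first (inv x) \<noteq> first u" "v = \<one> \<or> first (inv y) \<noteq> first v"
    and "x \<otimes> u = y \<otimes> v" "len x = len y"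
  shows "x = y"
proof -
  have *: "nf (z \<otimes> w) = nf z @ nf w"
    if "z \<in> carrier G" "w \<in> carrier G" "z \<noteq> \<one>" "w = \<one> \<or> first (inv z) \<noteq> first w" for z w
    using that reduced_mult(1)[of z w] nf_one by (cases "w = \<one>") auto
  have "nf x @ nf u = nf y @ nf v"
    using *[of x u] *[of y v] assms by metis
  then have "nf x = nf y" using assms(10) by (simp add: len_def)
  then show ?thesis using assms(1,3) nf_inj by blast
qed

lemma decompose:
  assumes "x \<in> carrier G" "x \<noteq> \<one>"
  obtains l y where "l \<in> carrier G" "y \<in> carrier G" "x = l \<otimes> y" "len l = 1" "len x = Suc (len y)"
    "first l = first x" "y \<noteq> \<one> \<Longrightarrow> first y \<noteq> first x" "y \<noteq> \<one> \<Longrightarrow> first (inv y) = first (inv x)"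
proof -
  obtain a w where w: "nf x = a # w" using assms nf_Nil_iff by (cases "nf x") auto
  then obtain l y where ly: "l \<in> carrier G" "y \<in> carrier G" "nf l = [a]" "nf y = w"
    using nf_split[of x "[a]" w] assms by auto
  show ?thesis
  proof (cases "y = \<one>")
    case True
    then have "x = l" using nf_inj[of x l] ly w assms nf_one by simp
    then show ?thesis using that[of l y] ly True w nf_one by (simp add: len_def first_def)
  next
    case False
    then have ne: "w \<noteq> []" using nf_Nil_iff ly by auto
    have l1: "l \<noteq> \<one>" using ly nf_one by auto
    have s: "side a \<noteq> side (hd w)"
      using nf_alternating[OF assms(1)] w ne by (cases w) auto
    have f: "first l = side a" "first (inv l) = side a" "first y = side (hd w)"
      using ly first_inv[of l] l1 by (auto simp: first_def)
    have "x = l \<otimes> y"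
      using nf_inj[of x "l \<otimes> y"] reduced_mult(1)[of l y] assms ly w f s False l1 by simp
    moreover have "first (inv y) = first (inv x)"
      using first_inv[of y] first_inv[of x] assms ly False w ne by simp
    ultimately show ?thesis using that[of l y] ly f s w by (auto simp: len_def first_def)
  qed
qed

text \<open>These are the stabilisers of the two ends of the edge \<open>\<one>\<close>. Thus
  \<open>inv g \<otimes> e \<in> factor s\<close> says that the edges \<open>g\<close> and
  \<open>e\<close> share their end of type \<open>s\<close>.\<close>

definition factor :: "bool \<Rightarrow> 'g set" where
  "factor s = {x \<in> carrier G. x = \<one> \<or> len x = 1 \<and> first x = s}"

lemma letterE:
  assumes "x \<in> carrier G" "len x = 1"
  obtains a where "nf x = [a]" "first x = side a" "first (inv x) = side a" "x \<noteq> \<one>"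
proof -
  obtain a where "nf x = [a]" using assms by (auto simp: len_def length_Suc_conv)
  moreover from this have "x \<noteq> \<one>" using nf_one by auto
  ultimately show ?thesis using that[of a] assms first_inv[of x] by (simp add: first_def)
qed

lemma factor_inv: "x \<in> factor s \<Longrightarrow> inv x \<in> factor s"
  by (auto simp: factor_def elim: letterE)

lemma factor_mult: "x \<in> factor s \<Longrightarrow> y \<in> factor s \<Longrightarrow> x \<otimes> y \<in> factor s"
proof -
  assume x: "x \<in> factor s" and y: "y \<in> factor s"
  show "x \<otimes> y \<in> factor s"
  proof (cases "x = \<one> \<or> y = \<one>")
    case False
    then obtain a b where "nf x = [a]" "nf y = [b]" "side a = s" "side b = s"
      using x y by (auto simp: factor_def elim!: letterE)
    then show ?thesis using nf_mult_letters[of x y a b] nf_Nil_iff[of "x \<otimes> y"] x y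
      by (auto simp: factor_def len_def first_def)
  qed (use x y in \<open>auto simp: factor_def\<close>)
qed

lemma factor_first:
  "x \<in> factor s \<Longrightarrow> x \<noteq> \<one> \<Longrightarrow> x \<in> carrier G \<and> len x = 1 \<and> first x = s \<and> first (inv x) = s"
  by (auto simp: factor_def elim!: letterE)

text \<open>The second bound comes from merging: a first letter of the same factor is at worst
  replaced by another letter, so none is added.\<close>

lemma len_letter_mult_le:
  assumes "l \<in> factor s" "y \<in> carrier G"
  shows "len (l \<otimes> y) \<le> Suc (len y)" "y \<noteq> \<one> \<Longrightarrow> first y = s \<Longrightarrow> len (l \<otimes> y) \<le> len y"
proof -
  have l: "l \<in> carrier G" using assms by (simp add: factor_def)
  have *: "len (l \<otimes> y) \<le> len y" if y: "y \<noteq> \<one>" "first y = s"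
  proof -
    obtain m z where mz: "m \<in> carrier G" "z \<in> carrier G" "y = m \<otimes> z" "len m = 1" "len y = Suc (len z)"
      "first m = first y" "z \<noteq> \<one> \<Longrightarrow> first z \<noteq> first y" using decompose[OF assms(2) y(1)] by metis
    have lm: "l \<otimes> m \<in> factor s" using factor_mult[OF assms(1), of m] mz y by (simp add: factor_def)
    have "l \<otimes> y = (l \<otimes> m) \<otimes> z" using mz l by (simp add: m_assoc)
    moreover have "len ((l \<otimes> m) \<otimes> z) \<le> Suc (len z)"
    proof (cases "l \<otimes> m = \<one> \<or> z = \<one>")
      case True
      then show ?thesis
      proof
        assume "z = \<one>"
        then show ?thesis using lm by (auto simp: factor_def)
      qed (simp add: mz(2))
    next
      case False
      then have "len ((l \<otimes> m) \<otimes> z) = len (l \<otimes> m) + len z"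
        using reduced_mult(2)[of "l \<otimes> m" z] factor_first[OF lm] mz(2,7) y(2) by simp
      then show ?thesis using factor_first[OF lm] False by simp
    qed
    ultimately show ?thesis using mz(5) by simp
  qed
  then show "y \<noteq> \<one> \<Longrightarrow> first y = s \<Longrightarrow> len (l \<otimes> y) \<le> len y" by blast
  show "len (l \<otimes> y) \<le> Suc (len y)"
  proof (cases "l = \<one> \<or> y = \<one> \<or> first y = s")
    case True
    then show ?thesis using * assms l factor_first[OF assms(1)] by fastforce
  next
    case False
    then show ?thesis using reduced_mult(2)[of l y] assms factor_first[OF assms(1)] by simp
  qed
qed

lemma len_mult_le:
  assumes "x \<in> carrier G" "y \<in> carrier G"
  shows "len (x \<otimes> y) \<le> len x + len y"
  using assms(1)
proof (induction "len x" arbitrary: x)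
  case 0
  then show ?case using assms by simp
next
  case (Suc n)
  then have "x \<noteq> \<one>" by auto
  then obtain l z where lz: "l \<in> carrier G" "z \<in> carrier G" "x = l \<otimes> z" "len l = 1" "len x = Suc (len z)"
    using decompose Suc.prems by metis
  have "len (z \<otimes> y) \<le> len z + len y" using Suc lz by auto
  moreover have "len (l \<otimes> (z \<otimes> y)) \<le> Suc (len (z \<otimes> y))"
    using len_letter_mult_le(1)[of l "first l" "z \<otimes> y"] lz assms by (simp add: factor_def)
  ultimately show ?case using lz assms by (simp add: m_assoc)
qed

section \<open>Sides, distances and axes in the tree\<close>

definition edge_side :: "'g \<Rightarrow> 'g \<Rightarrow> bool" where
  "edge_side e f = first (inv e \<otimes> f)"

text \<open>In this metric distinct edges with a common end are at distance one: every letter of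
  \<open>inv e \<otimes> f\<close> is a turn at one vertex.\<close>

definition edge_dist :: "'g \<Rightarrow> 'g \<Rightarrow> nat" where
  "edge_dist e f = len (inv e \<otimes> f)"

lemma edge_translate [simp]:
  assumes "g \<in> carrier G" "e \<in> carrier G" "f \<in> carrier G"
  shows "edge_side (g \<otimes> e) (g \<otimes> f) = edge_side e f" "edge_dist (g \<otimes> e) (g \<otimes> f) = edge_dist e f"
  using assms by (simp_all add: edge_side_def edge_dist_def inv_mult_group m_assoc)

lemma edge_side_translate:
  assumes "g \<in> carrier G" "e \<in> carrier G" "f \<in> carrier G"
  shows "edge_side (g \<otimes> e) f = edge_side e (inv g \<otimes> f)"
  using edge_translate(1)[of g e "inv g \<otimes> f"] assms by simp

lemma edge_dist_0_iff:
  assumes "e \<in> carrier G" "f \<in> carrier G"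
  shows "edge_dist e f = 0 \<longleftrightarrow> e = f"
proof -
  have "e = f" if "inv e \<otimes> f = \<one>"
    using inv_cancel(2)[of e f] that assms by simp
  then show ?thesis using assms by (auto simp: edge_dist_def)
qed

text \<open>An edge \<open>h\<close> with \<open>e\<close> and \<open>f\<close> on different sides
  is passed on the way from one to the other, because
  \<open>(inv e \<otimes> h) \<otimes> (inv h \<otimes> f)\<close> is reduced as written. This is
  the tree property behind all later arguments with half-spaces.\<close>

lemma separates:
  assumes "e \<in> carrier G" "f \<in> carrier G" "h \<in> carrier G" "e \<noteq> h" "f \<noteq> h"
    and "edge_side h e \<noteq> edge_side h f"
  shows "e \<noteq> f" "edge_side e f = edge_side e h" "edge_dist e f = edge_dist e h + edge_dist h f"
proof -
  have "inv e \<otimes> h \<noteq> \<one>" "inv h \<otimes> f \<noteq> \<one>"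
    using assms by (metis inv_cancel(2) inv_closed r_one)+
  moreover have "inv (inv e \<otimes> h) = inv h \<otimes> e" using assms by (simp add: inv_mult_group)
  moreover have "(inv e \<otimes> h) \<otimes> (inv h \<otimes> f) = inv e \<otimes> f" using assms by (simp add: m_assoc)
  ultimately have "inv e \<otimes> f \<noteq> \<one> \<and> first (inv e \<otimes> f) = first (inv e \<otimes> h) \<and>
      len (inv e \<otimes> f) = len (inv e \<otimes> h) + len (inv h \<otimes> f)"
    using reduced_mult[of "inv e \<otimes> h" "inv h \<otimes> f"] assms by (simp add: edge_side_def)
  then show "e \<noteq> f" "edge_side e f = edge_side e h" "edge_dist e f = edge_dist e h + edge_dist h f"
    using assms by (auto simp: edge_side_def edge_dist_def)
qed

text \<open>An edge of the axis separates its translates by \<open>a\<close> and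
  \<open>inv a\<close>; equivalently, \<open>inv e \<otimes> a \<otimes> e\<close> is cyclically
  reduced. For an elliptic element the set is empty.\<close>

definition axis :: "'g \<Rightarrow> 'g set" where
  "axis a = {e \<in> carrier G. a \<noteq> \<one> \<and> edge_side e (a \<otimes> e) \<noteq> edge_side e (inv a \<otimes> e)}"

lemma axis_iff:
  assumes "a \<in> carrier G" "e \<in> carrier G"
  shows "e \<in> axis a \<longleftrightarrow> a \<noteq> \<one> \<and> first (inv e \<otimes> a \<otimes> e) \<noteq> first (inv (inv e \<otimes> a \<otimes> e))"
  using assms by (simp add: axis_def edge_side_def inv_mult_group m_assoc)

lemma axis_inv: "a \<in> carrier G \<Longrightarrow> axis (inv a) = axis a"
  by (auto simp: axis_def inv_eq_1_iff)

lemma mult_neq_self: "a \<in> carrier G \<Longrightarrow> e \<in> carrier G \<Longrightarrow> a \<noteq> \<one> \<Longrightarrow> a \<otimes> e \<noteq> e"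
  by simp

lemma conj_one_iff:
  assumes "g \<in> carrier G" "a \<in> carrier G"
  shows "g \<otimes> a \<otimes> inv g = \<one> \<longleftrightarrow> a = \<one>"
proof
  assume *: "g \<otimes> a \<otimes> inv g = \<one>"
  have "a = inv g \<otimes> (g \<otimes> a \<otimes> inv g) \<otimes> g" using assms by (simp add: m_assoc)
  then show "a = \<one>" using assms by (simp add: *)
qed (use assms in simp)

lemma axis_translate:
  assumes "a \<in> carrier G" "g \<in> carrier G" "g \<otimes> a = a \<otimes> g" "e \<in> axis a"
  shows "g \<otimes> e \<in> axis a"
proof -
  have e: "e \<in> carrier G" "a \<noteq> \<one>" using assms by (auto simp: axis_def)
  have "inv (g \<otimes> e) \<otimes> a \<otimes> (g \<otimes> e) = inv e \<otimes> (inv g \<otimes> (a \<otimes> g)) \<otimes> e"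
    using assms(1,2) e by (simp add: inv_mult_group m_assoc)
  also have "inv g \<otimes> (a \<otimes> g) = a"
    using assms(1-3) by (metis inv_cancel(1))
  finally have "inv (g \<otimes> e) \<otimes> a \<otimes> (g \<otimes> e) = inv e \<otimes> a \<otimes> e" .
  then show ?thesis using assms(1,2,4) e axis_iff[of a "g \<otimes> e"] axis_iff[of a e] by simp
qed

lemma axis_conj:
  assumes "a \<in> carrier G" "g \<in> carrier G" "e \<in> axis a"
  shows "g \<otimes> e \<in> axis (g \<otimes> a \<otimes> inv g)"
proof -
  have e: "e \<in> carrier G" "a \<noteq> \<one>" using assms by (auto simp: axis_def)
  have "inv (g \<otimes> e) \<otimes> (g \<otimes> a \<otimes> inv g) \<otimes> (g \<otimes> e) = inv e \<otimes> a \<otimes> e"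
    using assms(1,2) e by (simp add: inv_mult_group m_assoc)
  moreover have "g \<otimes> a \<otimes> inv g \<noteq> \<one>"
    using e(2) assms(1,2) conj_one_iff by blast
  ultimately show ?thesis using assms e axis_iff[of a e] axis_iff[of "g \<otimes> a \<otimes> inv g" "g \<otimes> e"] by simp
qed

lemma axis_closed: "e \<in> axis a \<Longrightarrow> e \<in> carrier G"
  by (simp add: axis_def)

lemma axis_translate_self:
  assumes "a \<in> carrier G" "e \<in> axis a"
  shows "a \<otimes> e \<in> axis a" "inv a \<otimes> e \<in> axis a"
  using assms axis_translate[of a a e] axis_translate[of a "inv a" e] by simp_all

section \<open>Ping-pong with half-spaces of the tree\<close>

text \<open>The half-space at \<open>e\<close> that contains \<open>a \<otimes> e\<close> is moved
  into itself, since \<open>a \<otimes> e\<close> separates \<open>e\<close> from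
  \<open>a \<otimes> h\<close>. Here \<open>s\<close> names the opposite side.\<close>

lemma half_space_push:
  assumes a: "a \<in> carrier G" and e: "e \<in> axis a" and s: "edge_side e (a \<otimes> e) \<noteq> s"
    and h: "h \<in> carrier G" "h \<noteq> e" "edge_side e h \<noteq> s"
  shows "a \<otimes> h \<noteq> e" "edge_side e (a \<otimes> h) \<noteq> s"
proof -
  have e': "e \<in> carrier G" "a \<noteq> \<one>" "edge_side e (a \<otimes> e) \<noteq> edge_side e (inv a \<otimes> e)"
    using e by (auto simp: axis_def)
  have "edge_side (a \<otimes> e) (a \<otimes> h) = edge_side e h"
    "edge_side (a \<otimes> e) e = edge_side e (inv a \<otimes> e)"
    using a e' h edge_side_translate by auto
  then have "edge_side (a \<otimes> e) e \<noteq> edge_side (a \<otimes> e) (a \<otimes> h)" using e' s h by auto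
  then show "a \<otimes> h \<noteq> e" "edge_side e (a \<otimes> h) \<noteq> s"
    using separates[of e "a \<otimes> h" "a \<otimes> e"] a e' h s mult_neq_self[of a e] by auto
qed

text \<open>Because \<open>e\<close> is not farther from \<open>f\<close> than
  \<open>inv a \<otimes> e\<close>, the edge \<open>f\<close> lies on a branch that leaves the axis
  between these two. What is behind \<open>f\<close> as seen from \<open>e\<close> is also behind
  \<open>f\<close> as seen from \<open>inv a \<otimes> e\<close>, and \<open>a\<close> carries it to
  the far side of \<open>e\<close>.\<close>

lemma half_space_swap:
  assumes a: "a \<in> carrier G" and e: "e \<in> axis a" and f: "f \<in> carrier G" "f \<notin> axis a"
    and s: "edge_side e (a \<otimes> e) \<noteq> edge_side e f"
    and min: "edge_dist e f \<le> edge_dist (inv a \<otimes> e) f"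
    and h: "h \<in> carrier G" "h \<noteq> f" "edge_side f h \<noteq> edge_side f e"
  shows "a \<otimes> h \<noteq> e" "edge_side e (a \<otimes> h) \<noteq> edge_side e f"
proof -
  let ?e = "inv a \<otimes> e"
  have e': "e \<in> carrier G" "?e \<in> carrier G" "a \<noteq> \<one>" "edge_side e (a \<otimes> e) \<noteq> edge_side e (inv a \<otimes> e)"
    using e a by (auto simp: axis_def)
  have ne: "e \<noteq> f" "?e \<noteq> f" "?e \<noteq> e"
    using axis_translate_self[OF a e] f e a e' by (auto dest: mult_neq_self[of "inv a" e])
  have te: "edge_side ?e g = edge_side e (a \<otimes> g)" if "g \<in> carrier G" for g
    using edge_side_translate[of "inv a" e g] that a e' by simp
  \<comment> \<open>Otherwise \<open>inv a \<otimes> e\<close> would lie between \<open>e\<close>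
    and \<open>f\<close> and be nearer to \<open>f\<close>.\<close>
  have 1: "edge_side ?e f \<noteq> edge_side e f"
  proof
    assume "edge_side ?e f = edge_side e f"
    then have "edge_side ?e e \<noteq> edge_side ?e f" using te[of e] e' s by simp
    then have "edge_dist e f = edge_dist e ?e + edge_dist ?e f"
      using separates[of e f ?e] e' f ne by auto
    then show False using min edge_dist_0_iff[of e ?e] ne e' by simp
  qed
  \<comment> \<open>Otherwise the ways from \<open>f\<close> to \<open>a \<otimes> f\<close> and to
    \<open>inv a \<otimes> f\<close> would pass through \<open>e\<close> and through
    \<open>inv a \<otimes> e\<close>, on different sides of \<open>f\<close>, and \<open>f\<close>
    would be on the axis.\<close>
  have 2: "edge_side f ?e = edge_side f e"
  proof (rule ccontr)
    assume n: "edge_side f ?e \<noteq> edge_side f e"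
    have "edge_side e f \<noteq> edge_side e (a \<otimes> f)" using te[of f] f 1 by simp
    moreover have "a \<otimes> f \<noteq> e" using ne a f e' by (metis inv_cancel(1))
    ultimately have "edge_side f (a \<otimes> f) = edge_side f e"
      using separates[of f "a \<otimes> f" e] f e' a ne by auto
    moreover have "edge_side ?e (inv a \<otimes> f) = edge_side e f" using a e' f by simp
    then have "edge_side f (inv a \<otimes> f) = edge_side f ?e"
      using separates[of f "inv a \<otimes> f" ?e] f e' a ne 1 by auto
    ultimately have "f \<in> axis a" using n f e' by (auto simp: axis_def)
    then show False using f by blast
  qed
  have "h \<noteq> ?e" "edge_side ?e h = edge_side ?e f"
    using separates[of ?e h f] h 2 e' f ne by auto
  then show "a \<otimes> h \<noteq> e" "edge_side e (a \<otimes> h) \<noteq> edge_side e f"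
    using te[of h] h 1 a e' by auto
qed

text \<open>Take \<open>e\<close> and \<open>f\<close> as close as possible and orient both elements
  to move away from the other axis. The half-spaces at \<open>e\<close> and \<open>f\<close> facing
  away from each other are the table sets: \<open>half_space_push\<close> handles the half-space of
  the element itself, \<open>half_space_swap\<close> that of the other one.\<close>

lemma free_pair_disjoint_axes:
  assumes a: "a \<in> carrier G" and b: "b \<in> carrier G"
    and ne: "axis a \<noteq> {}" "axis b \<noteq> {}" and dj: "axis a \<inter> axis b = {}"
  shows "\<exists>a'\<in>{a, inv a}. \<exists>b'\<in>{b, inv b}. free_pair a' b'"
proof -
  define D where "D = (\<lambda>(e, f). edge_dist e f)"
  obtain p where "p \<in> axis a \<times> axis b" using ne by auto
  then have "\<exists>p. p \<in> axis a \<times> axis b \<and> (\<forall>q. q \<in> axis a \<times> axis b \<longrightarrow> D p \<le> D q)"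
    by (rule ex_has_least_nat)
  then obtain e f where ef: "e \<in> axis a" "f \<in> axis b"
    and min: "\<And>e' f'. e' \<in> axis a \<Longrightarrow> f' \<in> axis b \<Longrightarrow> edge_dist e f \<le> edge_dist e' f'"
    by (auto simp: D_def)
  have dist_sym: "edge_dist x y = edge_dist y x" if "x \<in> carrier G" "y \<in> carrier G" for x y
    using len_inv[of "inv x \<otimes> y"] that by (simp add: edge_dist_def inv_mult_group)
  \<comment> \<open>An edge of the axis is moved to opposite sides by an element and its inverse, so
    one of the two avoids the prescribed side \<open>s\<close>.\<close>
  have sign: "\<exists>c'\<in>{c, inv c}. c' \<in> carrier G \<and> axis c' = axis c \<and> edge_side g (c' \<otimes> g) \<noteq> s"
    if "c \<in> carrier G" "g \<in> axis c" for c g s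
    using that axis_inv[of c] by (auto simp: axis_def)
  obtain a' where a': "a' \<in> {a, inv a}" "a' \<in> carrier G" "axis a' = axis a" "edge_side e (a' \<otimes> e) \<noteq> edge_side e f"
    using sign[OF a ef(1)] by blast
  obtain b' where b': "b' \<in> {b, inv b}" "b' \<in> carrier G" "axis b' = axis b" "edge_side f (b' \<otimes> f) \<noteq> edge_side f e"
    using sign[OF b ef(2)] by blast
  have cl: "e \<in> carrier G" "f \<in> carrier G" "f \<notin> axis a" "e \<notin> axis b" "e \<noteq> f"
    using ef dj axis_closed by auto
  define P where "P = {h \<in> carrier G. h \<noteq> e \<and> edge_side e h \<noteq> edge_side e f}"
  define Q where "Q = {h \<in> carrier G. h \<noteq> f \<and> edge_side f h \<noteq> edge_side f e}"
  have "free_pair a' b'"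
  proof (rule ping_pong[OF a'(2) b'(2), of P Q "a' \<otimes> e"])
    have "h \<notin> Q" if "h \<in> P" for h
      using separates(2)[of f h e] cl that by (auto simp: P_def Q_def)
    then show "P \<inter> Q = {}" by blast
    have "a' \<noteq> \<one>" using ef(1) unfolding a'(3)[symmetric] by (simp add: axis_def)
    then show "a' \<otimes> e \<in> P \<union> Q" using a'(2,4) cl(1) by (simp add: P_def)
    fix h assume h: "h \<in> P \<union> Q"
    have ha: "a' \<otimes> h \<noteq> e \<and> edge_side e (a' \<otimes> h) \<noteq> edge_side e f"
    proof (cases "h \<in> P")
      case True
      then show ?thesis using half_space_push[of a' e "edge_side e f" h] a'(2-4) ef(1)
        by (simp add: P_def)
    next
      case False
      then have hQ: "h \<in> Q" using h by blast
      have "edge_dist e f \<le> edge_dist (inv a' \<otimes> e) f"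
        using min[of "inv a' \<otimes> e" f] axis_translate_self[of a' e] a'(2,3) ef by simp
      then show ?thesis using half_space_swap[of a' e f h] a'(2-4) ef(1) cl hQ
        by (simp add: Q_def)
    qed
    then show "a' \<otimes> h \<in> P" using h a'(2) by (auto simp: P_def Q_def)
    have hb: "b' \<otimes> h \<noteq> f \<and> edge_side f (b' \<otimes> h) \<noteq> edge_side f e"
    proof (cases "h \<in> Q")
      case True
      then show ?thesis using half_space_push[of b' f "edge_side f e" h] b'(2-4) ef(2)
        by (simp add: Q_def)
    next
      case False
      then have hP: "h \<in> P" using h by blast
      have "edge_dist f e \<le> edge_dist (inv b' \<otimes> f) e"
        using min[of e "inv b' \<otimes> f"] axis_translate_self[of b' f] b'(2,3) ef cl
          dist_sym[of e f] dist_sym[of e "inv b' \<otimes> f"] by simp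
      then show ?thesis using half_space_swap[of b' f e h] b'(2-4) ef(2) cl hP
        by (simp add: P_def)
    qed
    then show "b' \<otimes> h \<in> Q" using h b'(2) by (auto simp: P_def Q_def)
  qed (auto simp: P_def Q_def)
  then show ?thesis using a' b' by blast
qed

section \<open>Free pairs from conjugate hyperbolic elements\<close>

text \<open>Positive words in \<open>a\<close> and \<open>b\<close> are reduced as written, since
  both elements start on one side and end on the other. Equal length and \<open>a \<noteq> b\<close>
  make the first block readable from the normal form.\<close>

lemma free_pair_same_len:
  assumes a: "a \<in> carrier G" "a \<noteq> \<one>" "first a \<noteq> first (inv a)" and b: "b \<in> carrier G" "b \<noteq> \<one>"
    and ab: "first b = first a" "first (inv b) = first (inv a)" "len a = len b" "a \<noteq> b"
  shows "free_pair a b"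
proof (rule free_pairI[OF a(1) b(1)])
  have *: "word_product a b w = \<one> \<or> first (word_product a b w) = first a" for w
  proof (induction w)
    case (Cons s w)
    let ?c = "if s then a else b"
    have c: "?c \<in> carrier G" "?c \<noteq> \<one>" "first ?c = first a" "first (inv ?c) \<noteq> first a"
      using a b ab by auto
    show ?case
    proof (cases "word_product a b w = \<one>")
      case True
      then show ?thesis using c by simp
    next
      case False
      then show ?thesis using reduced_mult(3)[of ?c "word_product a b w"] Cons c a b by auto
    qed
  qed simp
  fix v w
  show "a \<otimes> word_product a b v \<noteq> b \<otimes> word_product a b w"
    using reduced_mult_eq[of a "word_product a b v" b "word_product a b w"] *[of v] *[of w] a b ab by auto
qed

lemma pow_cyclically_reduced:
  assumes x: "x \<in> carrier G" "x \<noteq> \<one>" "first x \<noteq> first (inv x)"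
  shows "len (x [^] (n::nat)) = n * len x \<and> (n > 0 \<longrightarrow> x [^] n \<noteq> \<one> \<and> first (inv (x [^] n)) = first (inv x))"
proof (induction n)
  case (Suc n)
  show ?case
  proof (cases "n = 0")
    case False
    let ?y = "inv (x [^] n)"
    have y: "?y \<in> carrier G" "?y \<noteq> \<one>" "first ?y = first (inv x)"
      using Suc False x by (auto simp: inv_eq_1_iff)
    have "inv (x [^] Suc n) = inv x \<otimes> ?y" using x by (simp add: inv_mult_group)
    moreover have "len (inv x \<otimes> ?y) = len x + len ?y \<and> first (inv x \<otimes> ?y) = first (inv x) \<and> inv x \<otimes> ?y \<noteq> \<one>"
      using reduced_mult[of "inv x" ?y] x y by (simp add: inv_eq_1_iff)
    ultimately show ?thesis using Suc x
      by (metis inv_closed inv_one len_inv monoid.nat_pow_closed mult_Suc monoid_axioms)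
  qed (use x in auto)
qed simp

lemma conj_pow:
  assumes "x \<in> carrier G" "g \<in> carrier G"
  shows "(g \<otimes> x \<otimes> inv g) [^] (n::nat) = g \<otimes> x [^] n \<otimes> inv g"
  using assms by (induction n) (auto simp: m_assoc)

text \<open>The length of a cyclically reduced element is its translation length, a conjugacy
  invariant: lengths of powers grow linearly, while conjugation by \<open>g\<close> changes each of
  them by at most \<open>2 * len g\<close>.\<close>

lemma len_conj_le:
  assumes x: "x \<in> carrier G" "x \<noteq> \<one>" "first x \<noteq> first (inv x)" and g: "g \<in> carrier G"
    and y: "y = g \<otimes> x \<otimes> inv g" "y \<noteq> \<one>" "first y \<noteq> first (inv y)"
  shows "len y \<le> len x"
proof (rule ccontr)
  assume "\<not> len y \<le> len x"
  \<comment> \<open>The exponent exceeds the error \<open>2 * len g\<close>, so a gain of one letter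
    per factor would be visible.\<close>
  define n where "n = Suc (2 * len g)"
  have "n * len y = len (y [^] n)"
    using pow_cyclically_reduced[of y n] x g y by simp
  also have "\<dots> = len (g \<otimes> (x [^] n \<otimes> inv g))"
    using conj_pow[of x g n] x g y by (simp add: m_assoc)
  also have "\<dots> \<le> len g + len (x [^] n \<otimes> inv g)"
    using len_mult_le[of g] x g by simp
  also have "\<dots> \<le> len g + (len (x [^] n) + len g)"
    using len_mult_le[of "x [^] n" "inv g"] x g by simp
  also have "\<dots> = 2 * len g + n * len x"
    using pow_cyclically_reduced[of x n] x by simp
  finally have "n * len y < n * len x + n" by (simp add: n_def)
  then have "n * len y < n * Suc (len x)" by simp
  then show False using \<open>\<not> len y \<le> len x\<close> by (metis Suc_leI leD linorder_not_le mult_le_mono2)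
qed

text \<open>Disjoint axes allow ping-pong. If the axes share an edge \<open>e\<close>, conjugation
  to \<open>e\<close> makes both elements cyclically reduced, of equal length because they are
  conjugate; after a possible inversion they have the same direction, and
  \<open>free_pair_same_len\<close> applies unless they coincide.\<close>

lemma free_pair_hyperbolic_conj:
  assumes a: "a \<in> carrier G" "axis a \<noteq> {}" and g: "g \<in> carrier G"
  shows "(\<exists>a'\<in>{a, inv a}. \<exists>b'\<in>{g \<otimes> a \<otimes> inv g, g \<otimes> inv a \<otimes> inv g}. free_pair a' b') \<or>
    g \<otimes> a \<otimes> inv g \<in> {a, inv a}"
proof (rule disjCI)
  assume n: "g \<otimes> a \<otimes> inv g \<notin> {a, inv a}"
  let ?b = "g \<otimes> a \<otimes> inv g"
  have b: "?b \<in> carrier G" "inv ?b = g \<otimes> inv a \<otimes> inv g" using a g by (auto simp: inv_mult_group m_assoc)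
  have ne: "axis ?b \<noteq> {}" using a g axis_conj by blast
  show "\<exists>a'\<in>{a, inv a}. \<exists>b'\<in>{?b, g \<otimes> inv a \<otimes> inv g}. free_pair a' b'"
  proof (cases "axis a \<inter> axis ?b = {}")
    case True
    then show ?thesis using free_pair_disjoint_axes[of a ?b] a b ne by simp
  next
    case False
    then obtain e where e: "e \<in> axis a" "e \<in> axis ?b" "e \<in> carrier G" by (auto simp: axis_def)
    define x where "x = inv e \<otimes> a \<otimes> e"
    define y where "y = inv e \<otimes> ?b \<otimes> e"
    define u where "u = inv e \<otimes> g \<otimes> e"
    have cl: "x \<in> carrier G" "y \<in> carrier G" "u \<in> carrier G" using a b e g by (auto simp: x_def y_def u_def)
    have ne: "x \<noteq> \<one>" "y \<noteq> \<one>" "first x \<noteq> first (inv x)" "first y \<noteq> first (inv y)"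
      using e a b axis_iff conj_one_iff[of "inv e" a] conj_one_iff[of "inv e" ?b]
      by (auto simp: x_def y_def)
    have yx: "y = u \<otimes> x \<otimes> inv u" using a g e by (simp add: x_def y_def u_def inv_mult_group m_assoc)
    then have "x = inv u \<otimes> y \<otimes> inv (inv u)" using cl by (simp add: m_assoc)
    then have len: "len x = len y"
      using len_conj_le[OF cl(1) ne(1,3) cl(3) yx ne(2,4)]
        len_conj_le[OF cl(2) ne(2,4) _ _ ne(1,3), of "inv u"] cl by simp
    have "inv e \<otimes> inv a \<otimes> e = inv x" using a e by (simp add: x_def inv_mult_group m_assoc)
    then have "first (inv e \<otimes> a \<otimes> e) = first y \<or> first (inv e \<otimes> inv a \<otimes> e) = first y"
      using ne by (auto simp: x_def)
    then obtain a' where a': "a' \<in> {a, inv a}" "first (inv e \<otimes> a' \<otimes> e) = first y"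
      by blast
    have a'': "a' \<in> carrier G" using a' a by auto
    have x': "inv e \<otimes> a' \<otimes> e = x \<or> inv e \<otimes> a' \<otimes> e = inv x"
      using a' a e by (auto simp: x_def inv_mult_group m_assoc)
    have "inv e \<otimes> a' \<otimes> e \<noteq> y"
    proof
      assume *: "inv e \<otimes> a' \<otimes> e = y"
      have "a' = e \<otimes> (inv e \<otimes> a' \<otimes> e) \<otimes> inv e" using a'' e by (simp add: m_assoc)
      also have "\<dots> = e \<otimes> (inv e \<otimes> ?b \<otimes> e) \<otimes> inv e" by (simp only: * y_def)
      also have "\<dots> = ?b" using a g e by (simp add: m_assoc)
      finally have "a' = ?b" .
      then show False using n a' by auto
    qed
    moreover define t where "t = inv e \<otimes> a' \<otimes> e"
    moreover have "t \<in> carrier G \<and> t \<noteq> \<one> \<and> first t \<noteq> first (inv t) \<and> len t = len y"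
    proof -
      have "inv x \<noteq> \<one>" "inv (inv x) = x" "len (inv x) = len x" using ne cl by simp_all
      then show ?thesis using x' ne(1,3) cl(1) len inv_closed unfolding t_def[symmetric] by metis
    qed
    ultimately have "free_pair (inv e \<otimes> a' \<otimes> e) y"
      using free_pair_same_len[of t y] a'(2) ne cl(2) by auto
    then have "free_pair a' ?b" using free_pair_conj[of a' ?b e] a'' b e by (simp add: y_def)
    then show ?thesis using a' by blast
  qed
qed

text \<open>If \<open>e\<close> is not on the axis of \<open>g\<close>, let \<open>y\<close> be the
  one of \<open>d\<close> and \<open>inv d\<close> that moves \<open>e\<close> away from
  \<open>g \<otimes> e\<close>. Then \<open>y \<otimes> e\<close>, \<open>e\<close>,
  \<open>g \<otimes> e\<close> and \<open>g \<otimes> (y \<otimes> e)\<close> follow each other on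
  one path, and the isometry \<open>y\<close> would lengthen the distance from \<open>e\<close> to
  \<open>g \<otimes> e\<close>.\<close>

lemma axis_commuting_subset:
  assumes d: "d \<in> carrier G" and g: "g \<in> carrier G" "g \<noteq> \<one>" and c: "g \<otimes> d = d \<otimes> g"
  shows "axis d \<subseteq> axis g"
proof
  fix e assume e: "e \<in> axis d"
  then have e': "e \<in> carrier G" "d \<noteq> \<one>" by (auto simp: axis_def)
  show "e \<in> axis g"
  proof (rule ccontr)
    assume "e \<notin> axis g"
    then have s: "edge_side e (g \<otimes> e) = edge_side e (inv g \<otimes> e)" using e' g by (auto simp: axis_def)
    obtain y where y: "y \<in> {d, inv d}" "edge_side e (y \<otimes> e) \<noteq> edge_side e (g \<otimes> e)"
      using e by (auto simp: axis_def)
    have "inv d \<noteq> \<one>" using d e' inv_eq_1_iff by blast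
    then have "y \<noteq> \<one>" using y(1) e'(2) by (metis insertE singletonD)
    then have y': "y \<in> carrier G" "y \<noteq> \<one>" using y(1) d by auto
    have "g \<otimes> inv d = inv d \<otimes> (d \<otimes> (g \<otimes> inv d))" using d g by simp
    also have "d \<otimes> (g \<otimes> inv d) = (d \<otimes> g) \<otimes> inv d" using d g by (simp add: m_assoc)
    also have "\<dots> = g" using c d g by (metis m_assoc inv_closed r_inv r_one)
    finally have yg: "g \<otimes> y = y \<otimes> g" using y c by auto
    let ?f = "g \<otimes> e"
    have f: "?f \<in> carrier G" "?f \<noteq> e" "y \<otimes> e \<noteq> e" "y \<otimes> ?f \<noteq> ?f"
      using g e' y' mult_neq_self[of g e] mult_neq_self[of y e] mult_neq_self[of y ?f] by auto
    have sf: "edge_side ?f e = edge_side e ?f" using edge_side_translate[of g e e] g e' s by simp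
    have "y \<otimes> ?f = g \<otimes> (y \<otimes> e)" using yg y' g e' by (metis m_assoc)
    then have sy: "edge_side ?f (y \<otimes> ?f) = edge_side e (y \<otimes> e)" using g e' y' by simp
    have 1: "?f \<noteq> y \<otimes> e" "edge_side ?f (y \<otimes> e) = edge_side ?f e"
      "edge_dist (y \<otimes> e) ?f = edge_dist (y \<otimes> e) e + edge_dist e ?f"
      using separates[of ?f "y \<otimes> e" e] separates[of "y \<otimes> e" ?f e] y f e' y' by auto
    have 2: "edge_dist (y \<otimes> e) (y \<otimes> ?f) = edge_dist (y \<otimes> e) ?f + edge_dist ?f (y \<otimes> ?f)"
      using separates[of "y \<otimes> e" "y \<otimes> ?f" ?f] 1 sf sy y f e' y' by auto
    then show False
      using 1 edge_dist_0_iff[of "y \<otimes> e" e] f e' y' g by simp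
  qed
qed

text \<open>The edges of the axis of a hyperbolic element; the edges at the fixed vertex of an elliptic one.\<close>

definition min_edges :: "'g \<Rightarrow> 'g set" where
  "min_edges x = {e \<in> carrier G. len (inv e \<otimes> x \<otimes> e) \<le> 1 \<or>
     first (inv e \<otimes> x \<otimes> e) \<noteq> first (inv (inv e \<otimes> x \<otimes> e))}"

section \<open>Minimal edges of elliptic and hyperbolic elements\<close>

text \<open>The word formed by \<open>inv u\<close>, \<open>c\<close> and \<open>u\<close> is
  reduced as written: it is the way to the fixed vertex, a turn there, and the way back. So it
  begins and ends on the same side.\<close>

lemma first_conj:
  assumes c: "c \<in> factor s" "c \<noteq> \<one>" and u: "u \<in> carrier G" "u \<noteq> \<one>" "first u \<noteq> s"
  shows "inv u \<otimes> c \<otimes> u \<noteq> \<one>" "first (inv u \<otimes> c \<otimes> u) = first (inv u)"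
    "first (inv (inv u \<otimes> c \<otimes> u)) = first (inv u)" "len (inv u \<otimes> c \<otimes> u) = 2 * len u + 1"
proof -
  have *: "inv u \<otimes> d \<otimes> u \<noteq> \<one> \<and> first (inv u \<otimes> d \<otimes> u) = first (inv u) \<and>
      len (inv u \<otimes> d \<otimes> u) = 2 * len u + 1"
    if d: "d \<in> factor s" "d \<noteq> \<one>" for d
  proof -
    note f = factor_first[OF d]
    have 1: "d \<otimes> u \<noteq> \<one>" "first (d \<otimes> u) = s" "len (d \<otimes> u) = 1 + len u"
      using reduced_mult[of d u] f u d by auto
    have "inv u \<noteq> \<one>" using u inv_eq_1_iff by blast
    then show ?thesis using reduced_mult[of "inv u" "d \<otimes> u"] 1 f u by (simp add: m_assoc)
  qed
  have "inv c \<noteq> \<one>" "c \<in> carrier G" using c factor_first inv_eq_1_iff by blast+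
  moreover from this have "inv (inv u \<otimes> c \<otimes> u) = inv u \<otimes> inv c \<otimes> u"
    using u by (simp add: inv_mult_group m_assoc)
  ultimately show "inv u \<otimes> c \<otimes> u \<noteq> \<one>" "first (inv u \<otimes> c \<otimes> u) = first (inv u)"
    "first (inv (inv u \<otimes> c \<otimes> u)) = first (inv u)" "len (inv u \<otimes> c \<otimes> u) = 2 * len u + 1"
    using *[OF c] *[of "inv c"] factor_inv[OF c(1)] by auto
qed

text \<open>For an edge not at the fixed vertex, a first letter of \<open>u\<close> from the factor
  of \<open>s\<close> is absorbed into the rotation; what remains is a conjugate as in
  \<open>first_conj\<close>, of length at least three with both ends on one side.\<close>

lemma min_edges_elliptic:
  assumes x: "x \<in> carrier G" "x \<noteq> \<one>" and g: "g \<in> carrier G" "inv g \<otimes> x \<otimes> g \<in> factor s"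
  shows "min_edges x = {e \<in> carrier G. inv g \<otimes> e \<in> factor s}"
proof -
  let ?c = "inv g \<otimes> x \<otimes> g"
  have c: "?c \<noteq> \<one>" "?c \<in> carrier G" using conj_one_iff[of "inv g" x] x g by auto
  have "e \<in> min_edges x \<longleftrightarrow> inv g \<otimes> e \<in> factor s" if e: "e \<in> carrier G" for e
  proof -
    define u where "u = inv g \<otimes> e"
    have u: "u \<in> carrier G" using e g by (simp add: u_def)
    have eq: "inv e \<otimes> x \<otimes> e = inv u \<otimes> ?c \<otimes> u"
      using e g x by (simp add: u_def inv_mult_group m_assoc)
    have m: "e \<in> min_edges x \<longleftrightarrow> len (inv u \<otimes> ?c \<otimes> u) \<le> 1 \<or>
       first (inv u \<otimes> ?c \<otimes> u) \<noteq> first (inv (inv u \<otimes> ?c \<otimes> u))"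
      using e by (simp add: min_edges_def eq)
    show ?thesis
    proof (cases "u \<in> factor s")
      case True
      then have "inv u \<otimes> ?c \<otimes> u \<in> factor s" using g factor_mult factor_inv by blast
      then have "len (inv u \<otimes> ?c \<otimes> u) \<le> 1" by (auto simp: factor_def)
      then show ?thesis using m True by (simp add: u_def)
    next
      case False
      then have "u \<noteq> \<one>" by (auto simp: factor_def)
      have n: "e \<notin> min_edges x" if "v \<in> carrier G" "d \<in> factor s" "d \<noteq> \<one>" "v \<noteq> \<one>" "first v \<noteq> s"
        "inv u \<otimes> ?c \<otimes> u = inv v \<otimes> d \<otimes> v" for v d
      proof -
        have "len v > 0" using that by (simp add: zero_less_iff_neq_zero)
        then show ?thesis using first_conj[of d s v] that m by simp
      qed
      have "e \<notin> min_edges x"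
      proof (cases "first u = s")
        case False
        then show ?thesis using n[of u ?c] u c g \<open>u \<noteq> \<one>\<close> by simp
      next
        case True
        obtain l v where lv: "l \<in> carrier G" "v \<in> carrier G" "u = l \<otimes> v" "len l = 1"
          "first l = first u" "v \<noteq> \<one> \<Longrightarrow> first v \<noteq> first u" using decompose[OF u \<open>u \<noteq> \<one>\<close>] by metis
        have l: "l \<in> factor s" using lv True by (simp add: factor_def)
        have "v \<noteq> \<one>" using False l lv by auto
        have d: "inv l \<otimes> ?c \<otimes> l \<in> factor s" using g l factor_mult factor_inv by blast
        have "inv l \<otimes> ?c \<otimes> l \<noteq> \<one>" using conj_one_iff[of "inv l" ?c] c lv by simp
        moreover have "inv u \<otimes> ?c \<otimes> u = inv v \<otimes> (inv l \<otimes> ?c \<otimes> l) \<otimes> v"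
          using lv c by (simp add: inv_mult_group m_assoc)
        ultimately show ?thesis using n[of v] d lv \<open>v \<noteq> \<one>\<close> True by auto
      qed
      then show ?thesis using False by (simp add: u_def)
    qed
  qed
  then show ?thesis by (auto simp: min_edges_def)
qed

text \<open>A minimal edge off the axis would make \<open>x\<close> a rotation about one of its
  ends. By \<open>min_edges_elliptic\<close> the edges of the axis would then be at the same vertex,
  where the conjugate of \<open>x\<close> lies in a factor and is not cyclically reduced.\<close>

lemma min_edges_hyperbolic:
  assumes x: "x \<in> carrier G" "axis x \<noteq> {}"
  shows "min_edges x = axis x"
proof
  have x1: "x \<noteq> \<one>" using x unfolding axis_def by blast
  have axis_min: "e \<in> min_edges x" if "e \<in> axis x" for e
    using that axis_iff[of x e] x(1) axis_closed[of e x] unfolding min_edges_def by blast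
  then show "axis x \<subseteq> min_edges x" by blast
  show "min_edges x \<subseteq> axis x"
  proof
    fix e assume e: "e \<in> min_edges x"
    then have e': "e \<in> carrier G" by (simp add: min_edges_def)
    show "e \<in> axis x"
    proof (rule ccontr)
      assume "e \<notin> axis x"
      then have "first (inv e \<otimes> x \<otimes> e) = first (inv (inv e \<otimes> x \<otimes> e))" using axis_iff x e' x1 by blast
      moreover have ne: "inv e \<otimes> x \<otimes> e \<noteq> \<one>" using conj_one_iff[of "inv e" x] x e' x1 by simp
      ultimately have l: "len (inv e \<otimes> x \<otimes> e) \<le> 1" using e by (simp add: min_edges_def)
      have "len (inv e \<otimes> x \<otimes> e) \<noteq> 0" using ne x e' by simp
      then have "len (inv e \<otimes> x \<otimes> e) = 1" using l by linarith
      then obtain s where s: "inv e \<otimes> x \<otimes> e \<in> factor s" using x e' by (auto simp: factor_def)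
      obtain f where f: "f \<in> axis x" using x by auto
      then have f': "f \<in> carrier G" "f \<in> min_edges x" using axis_min axis_closed by blast+
      then have u: "inv e \<otimes> f \<in> factor s" using min_edges_elliptic[OF x(1) x1 e' s] by simp
      have "inv f \<otimes> x \<otimes> f = inv (inv e \<otimes> f) \<otimes> (inv e \<otimes> x \<otimes> e) \<otimes> (inv e \<otimes> f)"
        using e' f' x by (simp add: inv_mult_group m_assoc)
      then have "inv f \<otimes> x \<otimes> f \<in> factor s" using u s factor_mult factor_inv by metis
      moreover have "inv f \<otimes> x \<otimes> f \<noteq> \<one>" using conj_one_iff[of "inv f" x] x f' x1 by simp
      ultimately have "first (inv f \<otimes> x \<otimes> f) = first (inv (inv f \<otimes> x \<otimes> f))" using factor_first by metis
      then show False using f axis_iff[of x f] x(1) f'(1) by blast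
    qed
  qed
qed

lemma min_edges_conj:
  assumes "x \<in> carrier G" "g \<in> carrier G"
  shows "min_edges (g \<otimes> x \<otimes> inv g) = (\<otimes>) g ` min_edges x"
proof -
  have *: "g \<otimes> e \<in> min_edges (g \<otimes> x \<otimes> inv g)" if "x \<in> carrier G" "g \<in> carrier G" "e \<in> min_edges x" for x g e
  proof -
    have e: "e \<in> carrier G" using that by (simp add: min_edges_def)
    have "inv (g \<otimes> e) \<otimes> (g \<otimes> x \<otimes> inv g) \<otimes> (g \<otimes> e) = inv e \<otimes> x \<otimes> e"
      using that(1,2) e by (simp add: inv_mult_group m_assoc)
    then show ?thesis using that e by (simp add: min_edges_def)
  qed
  have "e \<in> (\<otimes>) g ` min_edges x" if e: "e \<in> min_edges (g \<otimes> x \<otimes> inv g)" for e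
  proof -
    have e': "e \<in> carrier G" using e by (simp add: min_edges_def)
    have "inv g \<otimes> e \<in> min_edges x"
      using *[OF _ _ e, of "inv g"] assms by (simp add: m_assoc)
    moreover have "e = g \<otimes> (inv g \<otimes> e)" using e' assms by simp
    ultimately show ?thesis by blast
  qed
  then show ?thesis using * assms by blast
qed

text \<open>Cyclic reduction: a word of length above one with both ends in the same factor becomes
  shorter when its first letter is moved to the end.\<close>

lemma min_edges_nonempty:
  assumes "x \<in> carrier G"
  shows "min_edges x \<noteq> {}"
  using assms
proof (induction "len x" arbitrary: x rule: less_induct)
  case less
  show ?case
  proof (cases "\<one> \<in> min_edges x")
    case False
    then have x: "len x > 1" "first x = first (inv x)" using less.prems by (auto simp: min_edges_def)
    then have "x \<noteq> \<one>" by auto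
    then obtain l y where ly: "l \<in> carrier G" "y \<in> carrier G" "x = l \<otimes> y" "len l = 1"
      "len x = Suc (len y)" "first l = first x" "y \<noteq> \<one> \<Longrightarrow> first (inv y) = first (inv x)"
      using decompose[OF less.prems] by metis
    have y: "y \<noteq> \<one>" using ly x by auto
    have "inv l \<in> factor (first x)" using ly factor_inv[of l "first x"] by (simp add: factor_def)
    moreover have "inv y \<noteq> \<one>" using y ly inv_eq_1_iff by blast
    ultimately have "len (inv l \<otimes> inv y) \<le> len (inv y)"
      using len_letter_mult_le(2)[of "inv l" "first x" "inv y"] ly y x by simp
    then have "len (y \<otimes> l) \<le> len y"
      using len_inv[of "y \<otimes> l"] ly by (simp add: inv_mult_group)
    then have ne: "min_edges (y \<otimes> l) \<noteq> {}" using less.hyps[of "y \<otimes> l"] ly by simp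
    have "l \<otimes> (y \<otimes> l) \<otimes> inv l = x" using ly by (simp add: m_assoc)
    then show ?thesis using min_edges_conj[of "y \<otimes> l" l] ne ly by (metis image_is_empty m_closed)
  qed blast
qed

lemma elliptic_or_hyperbolic:
  assumes x: "x \<in> carrier G" "x \<noteq> \<one>" "axis x = {}"
  shows "\<exists>g\<in>carrier G. \<exists>s. inv g \<otimes> x \<otimes> g \<in> factor s"
proof -
  obtain e where e: "e \<in> min_edges x" using min_edges_nonempty x by blast
  then have "len (inv e \<otimes> x \<otimes> e) \<le> 1" "e \<in> carrier G" using axis_iff[of x e] x by (auto simp: min_edges_def)
  then have "inv e \<otimes> x \<otimes> e \<in> factor (first (inv e \<otimes> x \<otimes> e))"
    using len_0_iff[of "inv e \<otimes> x \<otimes> e"] x by (auto simp: factor_def le_Suc_eq simp del: len_0_iff)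
  then show ?thesis using \<open>e \<in> carrier G\<close> by blast
qed

end

section \<open>Consequences of the absence of 2-torsion\<close>

locale normal_forms_no_2_torsion = normal_forms +
  assumes no_2_torsion: "x \<in> carrier G \<Longrightarrow> x \<otimes> x = \<one> \<Longrightarrow> x = \<one>"
begin

lemma commuting_min_edges:
  assumes d: "d \<in> carrier G" "axis d \<noteq> {}" and g: "g \<in> carrier G" "g \<noteq> \<one>" and c: "g \<otimes> d = d \<otimes> g"
  shows "axis g = axis d"
  using axis_commuting_subset[of d g] axis_commuting_subset[of g d] d g c by (auto simp: axis_def)

text \<open>If \<open>g\<close> reverses \<open>d\<close>, its square commutes with \<open>d\<close>
  and is nontrivial without 2-torsion; hence \<open>g\<close> has the same axis as \<open>d\<close>.
  But \<open>g = x \<otimes> (g \<otimes> x)\<close> for both choices of \<open>x\<close> among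
  \<open>d\<close> and \<open>inv d\<close>, and for the one that points in the direction of
  \<open>g\<close> this product is too long.\<close>

lemma not_inverted:
  assumes d: "d \<in> carrier G" "axis d \<noteq> {}" and g: "g \<in> carrier G" and c: "g \<otimes> d \<otimes> inv g = inv d"
  shows False
proof -
  have g1: "g \<noteq> \<one>"
  proof
    assume "g = \<one>"
    then have "d \<otimes> d = \<one>" using c d(1) by (metis inv_one l_one r_inv r_one)
    then show False using no_2_torsion[OF d(1)] d by (auto simp: axis_def)
  qed
  have gd: "g \<otimes> d = inv d \<otimes> g"
    using arg_cong[OF c, of "\<lambda>z. z \<otimes> g"] d g by (simp add: m_assoc)
  then have g': "g = d \<otimes> (g \<otimes> d)" using d g by simp
  have gd': "g \<otimes> inv d = d \<otimes> g"
    using arg_cong[OF g', of "\<lambda>z. z \<otimes> inv d"] d g by (simp add: m_assoc)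
  let ?z = "g \<otimes> g"
  have z: "?z \<noteq> \<one>" using no_2_torsion g g1 by blast
  have "?z \<otimes> d = g \<otimes> (inv d \<otimes> g)" using gd d g by (simp add: m_assoc)
  also have "\<dots> = (g \<otimes> inv d) \<otimes> g" using d g by (simp add: m_assoc)
  also have "\<dots> = d \<otimes> ?z" using gd' d g by (simp add: m_assoc)
  finally have "axis ?z = axis d" using commuting_min_edges[of d ?z] d g z by simp
  moreover have "axis g = axis ?z"
    using commuting_min_edges[of ?z g] calculation d g g1 by (simp add: m_assoc)
  ultimately obtain e where e: "e \<in> axis g" "e \<in> axis d" "e \<in> carrier G" using d by (auto simp: axis_def)
  let ?c = "\<lambda>x. inv e \<otimes> x \<otimes> e"
  obtain x where x: "x \<in> {d, inv d}" "first (?c x) = first (?c g)"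
    and x': "x \<in> carrier G" "?c x \<noteq> \<one>" "first (inv (?c x)) \<noteq> first (?c g)"
  proof -
    have i: "?c (inv d) = inv (?c d)" using d e by (simp add: inv_mult_group m_assoc)
    have cd: "?c d \<in> carrier G" using d(1) e(3) by simp
    have "d \<noteq> \<one>" and *: "first (?c d) \<noteq> first (inv (?c d))" using axis_iff[of d e] d(1) e by blast+
    then have "?c d \<noteq> \<one>" using conj_one_iff[of "inv e" d] d(1) e(3) by simp
    moreover from this have "inv (?c d) \<noteq> \<one>" using inv_eq_1_iff[OF cd] by blast
    moreover have "inv (inv (?c d)) = ?c d" using d e by simp
    ultimately show thesis
      using that[of d] that[of "inv d"] i * d(1) by (cases "first (?c d) = first (?c g)") simp_all
  qed
  have cg: "?c g \<noteq> \<one>" "first (inv (?c g)) \<noteq> first (?c g)"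
    using axis_iff[of g e] g g1 e conj_one_iff[of "inv e" g] by simp_all
  have geq: "g = x \<otimes> (g \<otimes> x)"
  proof -
    have "inv d \<otimes> (g \<otimes> inv d) = g" using gd' d g by simp
    then show ?thesis using x g' by auto
  qed
  have "?c x \<otimes> (?c g \<otimes> ?c x) = ?c (x \<otimes> (g \<otimes> x))" using x'(1) g e(3) by (simp add: m_assoc)
  also have "\<dots> = ?c g" by (simp only: geq[symmetric])
  finally have eq: "?c x \<otimes> (?c g \<otimes> ?c x) = ?c g" .
  have cl: "?c g \<in> carrier G" "?c x \<in> carrier G" using x' g e by auto
  have 1: "len (?c g \<otimes> ?c x) = len (?c g) + len (?c x)" "first (?c g \<otimes> ?c x) = first (?c g)" "?c g \<otimes> ?c x \<noteq> \<one>"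
    using reduced_mult[OF cl cg(1) x'(2)] cg x by auto
  have "len (?c x \<otimes> (?c g \<otimes> ?c x)) = len (?c x) + (len (?c g) + len (?c x))"
    using reduced_mult(2)[of "?c x" "?c g \<otimes> ?c x"] 1 cl x' by simp
  moreover have "len (?c x) \<noteq> 0" using cl x' by simp
  ultimately show False using eq by simp
qed

text \<open>The exceptional cases of \<open>free_pair_hyperbolic_conj\<close> are excluded:
  commuting elements share their axis, and an axis is never reversed.\<close>

lemma free_pair_hyperbolic:
  assumes d: "d \<in> carrier G" "axis d \<noteq> {}" and g: "g \<in> carrier G" "g \<noteq> \<one>"
    and ne: "min_edges g \<noteq> min_edges d"
  shows "\<exists>a\<in>{d, inv d}. \<exists>b\<in>{g \<otimes> d \<otimes> inv g, g \<otimes> inv d \<otimes> inv g}. free_pair a b"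
proof -
  have "g \<otimes> d \<otimes> inv g \<noteq> d"
  proof
    assume *: "g \<otimes> d \<otimes> inv g = d"
    have "g \<otimes> d = d \<otimes> g" using arg_cong[OF *, of "\<lambda>z. z \<otimes> g"] d g by (simp add: m_assoc)
    then have "axis g = axis d" using commuting_min_edges d g by blast
    then show False using ne min_edges_hyperbolic[of g] min_edges_hyperbolic[of d] d g by simp
  qed
  moreover have "g \<otimes> d \<otimes> inv g \<noteq> inv d" using not_inverted d g by blast
  ultimately show ?thesis using free_pair_hyperbolic_conj[of d g] d g by blast
qed

text \<open>Seen from an edge at the fixed vertex of \<open>x\<close> that is nearest to the fixed
  vertex of \<open>y\<close>, the elements become a letter \<open>c\<close> of one factor and a word
  \<open>y'\<close> that starts and ends in the other. So \<open>c \<otimes> y'\<close> and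
  \<open>c \<otimes> inv y'\<close> are cyclically reduced, of equal length and with equal end
  sides.\<close>

lemma free_pair_elliptic:
  assumes x: "x \<in> carrier G" "x \<noteq> \<one>" "axis x = {}" and y: "y \<in> carrier G" "y \<noteq> \<one>" "axis y = {}"
    and ne: "min_edges x \<noteq> min_edges y"
  shows "free_pair (x \<otimes> y) (x \<otimes> inv y)"
proof -
  obtain g0 s h0 r where gh0: "g0 \<in> carrier G" "inv g0 \<otimes> x \<otimes> g0 \<in> factor s"
    "h0 \<in> carrier G" "inv h0 \<otimes> y \<otimes> h0 \<in> factor r"
    using elliptic_or_hyperbolic x y by meson
  define V where "V = {(g, h). g \<in> carrier G \<and> h \<in> carrier G \<and>
    inv g \<otimes> x \<otimes> g \<in> factor s \<and> inv h \<otimes> y \<otimes> h \<in> factor r}"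
  have "(g0, h0) \<in> V" using gh0 by (simp add: V_def)
  then have "\<exists>p. p \<in> V \<and> (\<forall>q. q \<in> V \<longrightarrow> (\<lambda>(g, h). edge_dist g h) p \<le> (\<lambda>(g, h). edge_dist g h) q)"
    by (rule ex_has_least_nat)
  then obtain g h where gh: "(g, h) \<in> V" and min: "\<And>g' h'. (g', h') \<in> V \<Longrightarrow> edge_dist g h \<le> edge_dist g' h'"
    by auto
  define u where "u = inv g \<otimes> h"
  define c where "c = inv g \<otimes> x \<otimes> g"
  define d where "d = inv h \<otimes> y \<otimes> h"
  have gh': "g \<in> carrier G" "h \<in> carrier G" "c \<in> factor s" "d \<in> factor r"
    using gh by (auto simp: V_def c_def d_def)
  have cl: "u \<in> carrier G" "c \<in> carrier G" "c \<noteq> \<one>" "d \<in> carrier G" "d \<noteq> \<one>"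
    using gh' x y conj_one_iff[of "inv g" x] conj_one_iff[of "inv h" y] by (auto simp: u_def c_def d_def)
  have conj_factor: "inv (f \<otimes> l) \<otimes> z \<otimes> (f \<otimes> l) \<in> factor t"
    if "inv f \<otimes> z \<otimes> f \<in> factor t" "l \<in> factor t" "f \<in> carrier G" "z \<in> carrier G" for f l z t
  proof -
    have "l \<in> carrier G" using that by (simp add: factor_def)
    then have "inv (f \<otimes> l) \<otimes> z \<otimes> (f \<otimes> l) = inv l \<otimes> (inv f \<otimes> z \<otimes> f) \<otimes> l"
      using that(3,4) by (simp add: inv_mult_group m_assoc)
    then show ?thesis using that factor_mult factor_inv by metis
  qed
  have u_first: "first u \<noteq> s" if ne_u: "u \<noteq> \<one>"
  proof
    assume s: "first u = s"
    obtain l v where lv: "l \<in> carrier G" "v \<in> carrier G" "u = l \<otimes> v" "len l = 1" "len u = Suc (len v)"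
      "first l = first u" using decompose[OF cl(1) ne_u] by metis
    have "(g \<otimes> l, h) \<in> V"
      using conj_factor[of g x s l] gh lv s x by (auto simp: V_def factor_def)
    moreover have "inv (g \<otimes> l) \<otimes> h = v" using lv gh' unfolding u_def by (simp add: inv_mult_group m_assoc)
    ultimately show False using min lv(5) unfolding edge_dist_def u_def by fastforce
  qed
  have u_last: "first (inv u) \<noteq> r" if ne_u: "u \<noteq> \<one>"
  proof
    assume r: "first (inv u) = r"
    have "inv u \<noteq> \<one>" using ne_u inv_eq_1_iff[OF cl(1)] by blast
    then obtain l v where lv: "l \<in> carrier G" "v \<in> carrier G" "inv u = l \<otimes> v" "len l = 1" "len (inv u) = Suc (len v)"
      "first l = first (inv u)" using decompose[of "inv u"] cl by (metis inv_closed)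
    have "(g, h \<otimes> l) \<in> V"
      using conj_factor[of h y r l] gh lv r y by (auto simp: V_def factor_def)
    moreover have "inv g \<otimes> (h \<otimes> l) = inv v"
    proof -
      have "u = inv (l \<otimes> v)" using lv(3) cl(1) by (metis inv_inv)
      then have "inv g \<otimes> h = inv v \<otimes> inv l" using lv(1,2) by (simp add: inv_mult_group u_def)
      then have "(inv g \<otimes> h) \<otimes> l = inv v" using lv by (simp add: m_assoc)
      then show ?thesis using gh' lv by (simp add: m_assoc)
    qed
    ultimately show False using min lv(5) lv(2) cl(1) unfolding edge_dist_def u_def by fastforce
  qed
  define y' where "y' = inv g \<otimes> y \<otimes> g"
  have y'_eq: "y' = u \<otimes> d \<otimes> inv u" using gh' y by (simp add: y'_def u_def d_def inv_mult_group m_assoc)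
  have y': "y' \<in> carrier G" "y' \<noteq> \<one>" using gh' y conj_one_iff[of "inv g" y] by (auto simp: y'_def)
  have y'_first: "first y' \<noteq> s \<and> first (inv y') \<noteq> s"
  proof (cases "u = \<one>")
    case True
    \<comment> \<open>Here one edge touches both fixed vertices. They are its different ends, since
      a common vertex would give equal sets of minimal edges.\<close>
    have "s \<noteq> r"
    proof
      assume "s = r"
      have "g = h" using True gh' by (metis inv_cancel(2) r_one u_def)
      then show False
        using ne min_edges_elliptic[of x g s] min_edges_elliptic[of y h r] \<open>s = r\<close> x y gh by (auto simp: V_def)
    qed
    then show ?thesis using True y'_eq factor_first[OF gh'(4) cl(5)] cl by simp
  next
    case False
    have "inv u \<noteq> \<one>" using False cl inv_eq_1_iff by blast
    then show ?thesis
      using first_conj[of d r "inv u"] gh' cl u_first u_last False y'_eq by simp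
  qed
  \<comment> \<open>For an involution \<open>y'\<close> the two products would coincide.\<close>
  have iy: "inv y' \<noteq> \<one>" "inv y' \<noteq> y'"
  proof -
    show "inv y' \<noteq> \<one>" using y' inv_eq_1_iff by blast
    show "inv y' \<noteq> y'" using no_2_torsion[OF y'(1)] y'(2) r_inv[OF y'(1)] by metis
  qed
  note fc = factor_first[OF gh'(3) cl(3)]
  have a: "len (c \<otimes> y') = len c + len y'" "first (c \<otimes> y') = s" "c \<otimes> y' \<noteq> \<one>"
    and b: "len (c \<otimes> inv y') = len c + len y'" "first (c \<otimes> inv y') = s" "c \<otimes> inv y' \<noteq> \<one>"
    using reduced_mult[of c y'] reduced_mult[of c "inv y'"] fc y' y'_first iy cl by auto
  have ic: "inv c \<noteq> \<one>" using cl inv_eq_1_iff by blast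
  have "first (inv y' \<otimes> inv c) = first (inv y')" "first (y' \<otimes> inv c) = first y'"
    using reduced_mult(3)[of "inv y'" "inv c"] reduced_mult(3)[of y' "inv c"] fc y' y'_first iy cl ic by auto
  then have i: "first (inv (c \<otimes> y')) \<noteq> s" "first (inv (c \<otimes> inv y')) \<noteq> s"
    using y'_first y' cl by (simp_all add: inv_mult_group)
  have "c \<otimes> y' \<noteq> c \<otimes> inv y'" using iy y' cl by simp
  then have "free_pair (c \<otimes> y') (c \<otimes> inv y')"
    using free_pair_same_len[of "c \<otimes> y'" "c \<otimes> inv y'"] a b i y' cl by auto
  moreover have "c \<otimes> y' = inv g \<otimes> (x \<otimes> y) \<otimes> g" "c \<otimes> inv y' = inv g \<otimes> (x \<otimes> inv y) \<otimes> g"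
    using gh' x y by (simp_all add: c_def y'_def inv_mult_group m_assoc)
  ultimately show ?thesis using free_pair_conj[of "x \<otimes> y" "x \<otimes> inv y" g] x y gh' by simp
qed

text \<open>Admitting \<open>\<one>\<close> as a factor covers products of fewer than three
  elements.\<close>

definition short_products :: "'a \<Rightarrow> 'a \<Rightarrow> 'a set" where
  "short_products x y = {u \<otimes> v \<otimes> w | u v w. {u, v, w} \<subseteq> {\<one>, x, y, inv x, inv y}}"

lemma short_productsI:
  "u \<in> {\<one>, x, y, inv x, inv y} \<Longrightarrow> v \<in> {\<one>, x, y, inv x, inv y} \<Longrightarrow> w \<in> {\<one>, x, y, inv x, inv y} \<Longrightarrow>
    u \<otimes> v \<otimes> w \<in> short_products x y"
  unfolding short_products_def by blast

lemma short_products_swap: "short_products x y = short_products y x"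
  unfolding short_products_def by (simp add: insert_commute)

text \<open>The longest products that occur are the conjugates
  \<open>x \<otimes> y \<otimes> inv x\<close>; they are the source of the factor three in the final
  constant. Two elliptic elements need only products of two.\<close>

theorem free_pair_exists:
  assumes x: "x \<in> carrier G" "x \<noteq> \<one>" and y: "y \<in> carrier G" "y \<noteq> \<one>"
    and ne: "min_edges x \<noteq> min_edges y"
  shows "\<exists>a\<in>short_products x y. \<exists>b\<in>short_products x y. free_pair a b"
proof -
  have hyp: "\<exists>a\<in>short_products x y. \<exists>b\<in>short_products x y. free_pair a b"
    if x: "x \<in> carrier G" "x \<noteq> \<one>" and y: "y \<in> carrier G" "axis y \<noteq> {}"
      and ne: "min_edges x \<noteq> min_edges y" for x y
  proof -
    obtain a b where ab: "a \<in> {y, inv y}" "b \<in> {x \<otimes> y \<otimes> inv x, x \<otimes> inv y \<otimes> inv x}" "free_pair a b"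
      using free_pair_hyperbolic[OF y x ne] by blast
    have "a \<in> carrier G" using ab(1) y by blast+
    then have "a = \<one> \<otimes> \<one> \<otimes> a" by simp
    moreover have "\<one> \<otimes> \<one> \<otimes> a \<in> short_products x y"
      by (rule short_productsI) (use ab(1) in blast)+
    moreover have "b \<in> short_products x y"
      using ab(2) short_productsI[of x x y y "inv x"] short_productsI[of x x y "inv y" "inv x"] by blast
    ultimately show ?thesis using ab(3) by metis
  qed
  consider "axis y \<noteq> {}" | "axis x \<noteq> {}" | "axis x = {}" "axis y = {}" by blast
  then show ?thesis
  proof cases
    case 1
    then show ?thesis using hyp[OF x y(1) _ ne] by blast
  next
    case 2
    then show ?thesis using hyp[OF y x(1) _ ne[symmetric]] by (simp add: short_products_swap)
  next
    case 3
    have "free_pair (\<one> \<otimes> x \<otimes> y) (\<one> \<otimes> x \<otimes> inv y)"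
      using free_pair_elliptic[OF x 3(1) y 3(2) ne] x by simp
    moreover have "\<one> \<otimes> x \<otimes> y \<in> short_products x y" "\<one> \<otimes> x \<otimes> inv y \<in> short_products x y"
      by (rule short_productsI; blast)+
    ultimately show ?thesis by blast
  qed
qed

text \<open>For elliptic \<open>x\<close>, an edge that shares with \<open>g\<close> the end which
  is not fixed will do. For hyperbolic \<open>x\<close>, write a cyclically reduced conjugate as
  \<open>l \<otimes> z\<close>; conjugation by \<open>l\<close> turns it into
  \<open>(l \<otimes> l) \<otimes> (z \<otimes> inv l)\<close>, which starts and ends in the same
  factor because \<open>l \<otimes> l\<close> is still a nontrivial letter.\<close>

lemma min_edges_not_all:
  assumes x: "x \<in> carrier G" "x \<noteq> \<one>"
  shows "\<exists>e\<in>carrier G. e \<notin> min_edges x"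
proof (cases "axis x = {}")
  case True
  then obtain g s where gs: "g \<in> carrier G" "inv g \<otimes> x \<otimes> g \<in> factor s"
    using elliptic_or_hyperbolic x by blast
  obtain l a where "l \<in> carrier G" "nf l = [a]" "side a = (\<not> s)" using letter_exists by blast
  then have "l \<in> carrier G" "inv g \<otimes> (g \<otimes> l) \<notin> factor s"
    using gs nf_one by (auto simp: factor_def first_def)
  then show ?thesis using min_edges_elliptic[OF x gs] gs by blast
next
  case False
  then obtain e where e: "e \<in> axis x" "e \<in> carrier G" by (auto simp: axis_def)
  define y where "y = inv e \<otimes> x \<otimes> e"
  have y: "y \<in> carrier G" "y \<noteq> \<one>" "first y \<noteq> first (inv y)"
    using axis_iff[of x e] e x conj_one_iff[of "inv e" x] by (auto simp: y_def)
  obtain l z where lz: "l \<in> carrier G" "z \<in> carrier G" "y = l \<otimes> z" "len l = 1"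
    "first l = first y" "z \<noteq> \<one> \<Longrightarrow> first z \<noteq> first y" "z \<noteq> \<one> \<Longrightarrow> first (inv z) = first (inv y)"
    using decompose[OF y(1,2)] by metis
  have l: "l \<in> factor (first y)" using lz by (simp add: factor_def)
  have l1: "l \<noteq> \<one>" using lz by auto
  have z: "z \<noteq> \<one>"
  proof
    assume "z = \<one>"
    then have "y = l" using lz(1,3) by simp
    then show False using y(3) factor_first[OF l l1] by metis
  qed
  have ll: "l \<otimes> l \<in> factor (first y)" "l \<otimes> l \<noteq> \<one>" using factor_mult[OF l l] no_2_torsion[OF lz(1)] l1 by blast+
  have il: "inv l \<in> factor (first y)" "inv l \<noteq> \<one>" using factor_inv[OF l] l1 lz inv_eq_1_iff by blast+
  let ?w = "l \<otimes> y \<otimes> inv l"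
  have w: "?w = (l \<otimes> l) \<otimes> (z \<otimes> inv l)" using lz by (simp add: m_assoc)
  have zl: "z \<otimes> inv l \<noteq> \<one>" "first (z \<otimes> inv l) = first z" "len (z \<otimes> inv l) = len z + len l"
    using reduced_mult[of z "inv l"] lz z il factor_first[OF il] y by auto
  have w1: "first ?w = first y" "len ?w > 1"
    using reduced_mult[of "l \<otimes> l" "z \<otimes> inv l"] factor_first[OF ll] ll(2) zl lz z w by auto
  have iw: "inv ?w = l \<otimes> (inv z \<otimes> inv (l \<otimes> l))" using lz by (simp add: inv_mult_group m_assoc)
  have ill: "inv (l \<otimes> l) \<in> factor (first y)" "inv (l \<otimes> l) \<noteq> \<one>"
    using factor_inv[OF ll(1)] ll lz inv_eq_1_iff m_closed by blast+
  have iz: "inv z \<noteq> \<one>" using z lz inv_eq_1_iff by blast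
  have "inv z \<otimes> inv (l \<otimes> l) \<noteq> \<one>" "first (inv z \<otimes> inv (l \<otimes> l)) = first (inv y)"
    using reduced_mult[of "inv z" "inv (l \<otimes> l)"] factor_first[OF ill] ill(2) lz z iz by auto
  then have "first (inv ?w) = first y"
    using reduced_mult(3)[of l "inv z \<otimes> inv (l \<otimes> l)"] factor_first[OF l l1] l1 y lz iw by auto
  moreover have "inv (e \<otimes> inv l) \<otimes> x \<otimes> (e \<otimes> inv l) = l \<otimes> (inv e \<otimes> x \<otimes> e) \<otimes> inv l"
    using e(2) x(1) lz(1) by (simp add: inv_mult_group m_assoc)
  then have "inv (e \<otimes> inv l) \<otimes> x \<otimes> (e \<otimes> inv l) = ?w" by (simp only: y_def)
  ultimately have "e \<otimes> inv l \<notin> min_edges x" using w1 by (simp add: min_edges_def)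
  then show ?thesis using e lz by blast
qed

text \<open>Left translation is transitive on edges, so an invariant nonempty set would contain
  every edge.\<close>

theorem min_edges_not_invariant:
  assumes x: "x \<in> carrier G" "x \<noteq> \<one>"
  shows "\<exists>g\<in>carrier G. min_edges (g \<otimes> x \<otimes> inv g) \<noteq> min_edges x"
proof -
  obtain e f where ef: "e \<in> carrier G" "e \<notin> min_edges x" "f \<in> min_edges x"
    using min_edges_not_all[OF x] min_edges_nonempty[OF x(1)] by blast
  then have f: "f \<in> carrier G" by (simp add: min_edges_def)
  then have "(e \<otimes> inv f) \<otimes> f = e" using ef by (simp add: m_assoc)
  then have "e \<in> min_edges ((e \<otimes> inv f) \<otimes> x \<otimes> inv (e \<otimes> inv f))"
    using min_edges_conj[of x "e \<otimes> inv f"] x ef f by (metis imageI inv_closed m_closed)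
  then show ?thesis using ef f by (metis inv_closed m_closed)
qed

end

section \<open>Covering spaces\<close>

text \<open>
  The library proves the lifting theorems for coverings of subsets of normed spaces only; manifolds
  are subsets of arbitrary Hausdorff spaces here.
\<close>

lemma covering_space_evenly_covered:
  assumes "covering_space P p X" "x \<in> X"
  obtains T v where "x \<in> T" "openin (top_of_set X) T" "\<Union>v = P \<inter> p -` T"
    "\<And>u. u \<in> v \<Longrightarrow> openin (top_of_set P) u" "pairwise disjnt v"
    "\<And>u. u \<in> v \<Longrightarrow> \<exists>q. homeomorphism u T p q"
  using assms unfolding covering_space_def by metis

lemma covering_space_sheet:
  assumes "covering_space P p X" "z \<in> P"
  obtains T u q where "p z \<in> T" "openin (top_of_set X) T" "z \<in> u" "openin (top_of_set P) u"
    "homeomorphism u T p q"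
proof -
  have "p z \<in> X" using assms by (auto simp: covering_space_def)
  then obtain T v where "p z \<in> T" "openin (top_of_set X) T" "\<Union>v = P \<inter> p -` T"
    "\<And>u. u \<in> v \<Longrightarrow> openin (top_of_set P) u" "\<And>u. u \<in> v \<Longrightarrow> \<exists>q. homeomorphism u T p q"
    using covering_space_evenly_covered[OF assms(1)] by metis
  moreover from this obtain u where "u \<in> v" "z \<in> u" using assms(2) by blast
  ultimately show ?thesis using that by meson
qed

text \<open>The truth value of \<open>g1 s = g2 s\<close> is locally constant: nearby, both lifts
  stay in their sheets, which are either equal, and then \<open>p\<close> is injective there, or
  disjoint.\<close>

lemma covering_lift_unique:
  assumes cov: "covering_space P p X" and T: "connected T" "a \<in> T" "t \<in> T"
    and g: "continuous_on T g1" "g1 ` T \<subseteq> P" "continuous_on T g2" "g2 ` T \<subseteq> P"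
    and eq: "\<And>t. t \<in> T \<Longrightarrow> p (g1 t) = p (g2 t)" "g1 a = g2 a"
  shows "g1 t = g2 t"
proof -
  have "(g1 a = g2 a) = (g1 t = g2 t)"
  proof (rule connected_equivalence_relation[OF T, of "\<lambda>s t. (g1 s = g2 s) = (g1 t = g2 t)"])
    fix s assume s: "s \<in> T"
    then have "p (g1 s) \<in> X" using g cov by (auto simp: covering_space_def)
    then obtain W v where W: "p (g1 s) \<in> W" "\<Union>v = P \<inter> p -` W"
      and v: "\<And>u. u \<in> v \<Longrightarrow> openin (top_of_set P) u" "pairwise disjnt v"
        "\<And>u. u \<in> v \<Longrightarrow> \<exists>q. homeomorphism u W p q"
      using covering_space_evenly_covered[OF cov] by metis
    have "g1 s \<in> \<Union>v" "g2 s \<in> \<Union>v" using W eq(1)[OF s] s g by auto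
    then obtain u1 u2 where u: "u1 \<in> v" "g1 s \<in> u1" "u2 \<in> v" "g2 s \<in> u2" by blast
    let ?T = "T \<inter> g1 -` u1 \<inter> (T \<inter> g2 -` u2)"
    have o: "openin (top_of_set T) ?T"
      using continuous_openin_preimage[OF g(1) _ v(1)[OF u(1)]]
        continuous_openin_preimage[OF g(3) _ v(1)[OF u(3)]] g by (auto intro: openin_Int)
    have "(g1 s = g2 s) = (g1 t = g2 t)" if t: "t \<in> ?T" for t
    proof (cases "u1 = u2")
      case True
      have "inj_on p u1" using v(3)[OF u(1)] by (meson homeomorphism_def inj_on_inverseI)
      then show ?thesis using True t u eq(1)[OF s] eq(1)[of t] by (auto dest: inj_onD)
    next
      case False
      then have "u1 \<inter> u2 = {}" using v(2) u by (auto simp: pairwise_def disjnt_def)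
      then have "g1 s \<noteq> g2 s" "g1 t \<noteq> g2 t" using u t by auto
      then show ?thesis by simp
    qed
    then show "\<exists>U. openin (top_of_set T) U \<and> s \<in> U \<and> (\<forall>t\<in>U. (g1 s = g2 s) = (g1 t = g2 t))"
      using o s u by (intro exI[of _ ?T]) auto
  qed auto
  then show ?thesis using eq(2) by simp
qed

lemma preimage_interval:
  fixes g :: "real \<Rightarrow> 'a::topological_space"
  assumes "continuous_on {0..1} g" "g ` {0..1} \<subseteq> X" "openin (top_of_set X) T" "x \<in> {0..1}" "g x \<in> T"
  obtains d where "d > 0" "\<And>t. t \<in> {0..1} \<Longrightarrow> \<bar>t - x\<bar> < d \<Longrightarrow> g t \<in> T"
proof -
  have "openin (top_of_set {0..1}) ({0..1} \<inter> g -` T)"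
    using continuous_openin_preimage[OF assms(1) _ assms(3)] assms(2) by auto
  moreover have "x \<in> {0..1} \<inter> g -` T" using assms(4,5) by simp
  ultimately obtain d where "d > 0" "\<forall>t\<in>{0..1}. dist t x < d \<longrightarrow> t \<in> {0..1} \<inter> g -` T"
    unfolding openin_euclidean_subtopology_iff by blast
  then show ?thesis using that[of d] by (simp add: dist_real_def)
qed

text \<open>Liftability from every starting point over \<open>g a\<close> is additive in the
  interval, and it holds on short intervals that \<open>g\<close> maps into an evenly covered set;
  bisection does the rest.\<close>

lemma covering_lift_path:
  fixes g :: "real \<Rightarrow> 'a::topological_space"
  assumes cov: "covering_space P p X" and g: "path g" "path_image g \<subseteq> X"
    and y: "y \<in> P" "p y = pathstart g"
  obtains h where "path h" "path_image h \<subseteq> P" "pathstart h = y" "\<And>t. t \<in> {0..1} \<Longrightarrow> p (h t) = g t"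
proof -
  define R where "R a b \<longleftrightarrow> (0 \<le> a \<and> b \<le> 1 \<longrightarrow> (\<forall>y\<in>P. p y = g a \<longrightarrow>
    (\<exists>h. continuous_on {a..b} h \<and> h ` {a..b} \<subseteq> P \<and> h a = y \<and> (\<forall>t\<in>{a..b}. p (h t) = g t))))" for a b
  have "R 0 1"
  proof (rule Bolzano)
    fix a b c :: real assume ab: "R a b" and bc: "R b c" and le: "a \<le> b" "b \<le> c"
    show "R a c" unfolding R_def
    proof (intro impI ballI)
      fix y assume r: "0 \<le> a \<and> c \<le> 1" "y \<in> P" "p y = g a"
      obtain h1 where h1: "continuous_on {a..b} h1" "h1 ` {a..b} \<subseteq> P" "h1 a = y" "\<forall>t\<in>{a..b}. p (h1 t) = g t"
        using ab r le unfolding R_def by auto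
      have "h1 b \<in> P" "p (h1 b) = g b" using h1 le by auto
      then obtain h2 where h2: "continuous_on {b..c} h2" "h2 ` {b..c} \<subseteq> P" "h2 b = h1 b" "\<forall>t\<in>{b..c}. p (h2 t) = g t"
        using bc r le unfolding R_def by fastforce
      let ?h = "\<lambda>t. if t \<le> b then h1 t else h2 t"
      have "continuous_on ({a..b} \<union> {b..c}) ?h"
        by (rule continuous_on_cases) (use h1 h2 in auto)
      moreover have "{a..b} \<union> {b..c} = {a..c}" using le by auto
      moreover have "?h ` {a..c} \<subseteq> P" "?h a = y" "\<forall>t\<in>{a..c}. p (?h t) = g t"
        using h1 h2 le by auto
      ultimately show "\<exists>h. continuous_on {a..c} h \<and> h ` {a..c} \<subseteq> P \<and> h a = y \<and> (\<forall>t\<in>{a..c}. p (h t) = g t)"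
        by (intro exI[of _ ?h]) simp
    qed
  next
    fix x :: real assume x: "0 \<le> x" "x \<le> 1"
    then have gx: "g x \<in> X" using g by (auto simp: path_image_def)
    obtain T v where T: "g x \<in> T" "openin (top_of_set X) T" "\<Union>v = P \<inter> p -` T"
      and v: "\<And>u. u \<in> v \<Longrightarrow> openin (top_of_set P) u" "\<And>u. u \<in> v \<Longrightarrow> \<exists>q. homeomorphism u T p q"
      using covering_space_evenly_covered[OF cov gx] by metis
    obtain d where d: "d > 0" "\<And>t. t \<in> {0..1} \<Longrightarrow> \<bar>t - x\<bar> < d \<Longrightarrow> g t \<in> T"
      using preimage_interval[of g X T x] g T x by (auto simp: path_def path_image_def)
    have "R a b" if ab: "a \<le> x" "x \<le> b" "b - a < d" for a b
      unfolding R_def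
    proof (intro impI ballI)
      fix y assume r: "0 \<le> a \<and> b \<le> 1" "y \<in> P" "p y = g a"
      have gT: "g t \<in> T" if "t \<in> {a..b}" for t using d(2)[of t] that ab r by auto
      then have "y \<in> \<Union>v" using r ab T by auto
      then obtain u q where u: "u \<in> v" "y \<in> u" "homeomorphism u T p q" using v by blast
      have "continuous_on {a..b} (q \<circ> g)"
        using u(3) g gT r ab by (intro continuous_on_compose)
          (auto simp: path_def homeomorphism_def intro: continuous_on_subset)
      moreover have "(q \<circ> g) ` {a..b} \<subseteq> P"
        using u(1,3) gT T(3) by (fastforce simp: homeomorphism_def)
      moreover have "(q \<circ> g) a = y" using u r by (metis comp_apply homeomorphism_apply1)
      moreover have "\<forall>t\<in>{a..b}. p ((q \<circ> g) t) = g t" using u gT by (auto simp: homeomorphism_def)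
      ultimately show "\<exists>h. continuous_on {a..b} h \<and> h ` {a..b} \<subseteq> P \<and> h a = y \<and> (\<forall>t\<in>{a..b}. p (h t) = g t)"
        by blast
    qed
    then show "\<exists>d>0. \<forall>a b. a \<le> x \<and> x \<le> b \<and> b - a < d \<longrightarrow> R a b" using d by blast
  qed simp
  then show ?thesis using that y unfolding R_def path_def path_image_def pathstart_def by auto
qed

text \<open>The slices are lifted one by one, with no continuity in \<open>s\<close> except at
  \<open>t = 0\<close>. It is propagated along \<open>t\<close>: as long as it holds at
  \<open>a\<close>, nearby slices enter the same sheet, where they are given by the continuous local
  inverse \<open>q\<close>.\<close>

lemma covering_lift_family:
  fixes H :: "real \<times> real \<Rightarrow> 'a::topological_space"
  assumes cov: "covering_space P p X"
    and H: "continuous_on ({0..1} \<times> {0..1}) H" "H ` ({0..1} \<times> {0..1}) \<subseteq> X"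
    and k: "\<And>s. s \<in> {0..1} \<Longrightarrow> continuous_on {0..1} (k s)" "\<And>s. s \<in> {0..1} \<Longrightarrow> k s ` {0..1} \<subseteq> P"
      "\<And>s t. s \<in> {0..1} \<Longrightarrow> t \<in> {0..1} \<Longrightarrow> p (k s t) = H (s, t)"
    and k0: "continuous_on {0..1} (\<lambda>s. k s 0)"
  shows "continuous_on {0..1} (\<lambda>s. k s 1)"
  unfolding continuous_on_eq_continuous_within
proof
  fix s0 :: real assume s0: "s0 \<in> {0..1}"
  define C where "C t \<longleftrightarrow> continuous (at s0 within {0..1}) (\<lambda>s. k s t)" for t
  define R where "R a b \<longleftrightarrow> (0 \<le> a \<and> b \<le> 1 \<longrightarrow> C a \<longrightarrow> C b)" for a b
  have "R 0 1"
  proof (rule Bolzano)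
    fix x :: real assume x: "0 \<le> x" "x \<le> 1"
    then have "H (s0, x) \<in> X" using H s0 by auto
    then obtain T v where T: "H (s0, x) \<in> T" "openin (top_of_set X) T" "\<Union>v = P \<inter> p -` T"
      and v: "\<And>u. u \<in> v \<Longrightarrow> openin (top_of_set P) u" "\<And>u. u \<in> v \<Longrightarrow> \<exists>q. homeomorphism u T p q"
      using covering_space_evenly_covered[OF cov] by metis
    have "openin (top_of_set ({0..1} \<times> {0..1})) (({0..1} \<times> {0..1}) \<inter> H -` T)"
      by (rule continuous_openin_preimage[OF H(1) _ T(2)]) (use H(2) in blast)
    moreover have "(s0, x) \<in> ({0..1} \<times> {0..1}) \<inter> H -` T" using T(1) s0 x by simp
    ultimately obtain e where e: "e > 0"
      "\<forall>z\<in>{0..1} \<times> {0..1}. dist z (s0, x) < e \<longrightarrow> z \<in> ({0..1} \<times> {0..1}) \<inter> H -` T"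
      unfolding openin_euclidean_subtopology_iff by blast
    have HT: "H (s, t) \<in> T" if "s \<in> {0..1}" "t \<in> {0..1}" "\<bar>s - s0\<bar> < e / 2" "\<bar>t - x\<bar> < e / 2" for s t
    proof -
      have "dist (s, t) (s0, x) \<le> \<bar>s - s0\<bar> + \<bar>t - x\<bar>"
        by (simp add: dist_Pair_Pair dist_real_def sqrt_sum_squares_le_sum_abs)
      then have "dist (s, t) (s0, x) < e" using that by linarith
      then show ?thesis using e(2) that(1,2) by blast
    qed
    have "R a b" if ab: "a \<le> x" "x \<le> b" "b - a < e / 2" for a b
      unfolding R_def
    proof (intro impI)
      assume r: "0 \<le> a \<and> b \<le> 1" and Ca: "C a"
      have HsT: "H (s, t) \<in> T" if "t \<in> {a..b}" "s \<in> {0..1}" "\<bar>s - s0\<bar> < e / 2" for s t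
      proof -
        have "\<bar>t - x\<bar> < e / 2" using that(1) ab by (auto simp: abs_if)
        then show ?thesis using HT[of s t] that r by auto
      qed
      have aT: "H (s0, a) \<in> T" "H (s0, b) \<in> T" using HsT s0 ab e(1) by auto
      then have "k s0 a \<in> \<Union>v" using k(2)[OF s0] k(3)[OF s0, of a] T r ab by auto
      then obtain u q where u: "u \<in> v" "k s0 a \<in> u" "homeomorphism u T p q" using v by blast
      obtain U where U: "open U" "u = P \<inter> U" using v(1)[OF u(1)] by (auto simp: openin_open)
      have uT: "u \<subseteq> P" "q ` T = u" "continuous_on T q" "\<And>y. y \<in> T \<Longrightarrow> p (q y) = y" "\<And>z. z \<in> u \<Longrightarrow> q (p z) = z"
        using u U by (auto simp: homeomorphism_def)
      \<comment> \<open>Uniqueness of lifts over \<open>{a..b}\<close> identifies the slice with the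
        lift through the sheet \<open>u\<close>, provided that it starts there.\<close>
      have slice: "q (H (s, b)) = k s b" if s: "s \<in> {0..1}" "\<bar>s - s0\<bar> < e / 2" and ku: "k s a \<in> u" for s
      proof (rule covering_lift_unique[OF cov, of "{a..b}" a b "\<lambda>t. q (H (s, t))" "k s"])
        show "continuous_on {a..b} (k s)" using k(1)[OF s(1)] r by (auto intro: continuous_on_subset)
        have "continuous_on {a..b} (\<lambda>t. H (s, t))"
          by (rule continuous_on_compose2[OF H(1)]) (use s r in \<open>auto intro!: continuous_intros\<close>)
        then show "continuous_on {a..b} (\<lambda>t. q (H (s, t)))"
          by (rule continuous_on_compose2[OF uT(3)]) (use HsT s in blast)
        show "(\<lambda>t. q (H (s, t))) ` {a..b} \<subseteq> P" using uT(1,2) HsT s by blast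
        show "k s ` {a..b} \<subseteq> P" using k(2)[OF s(1)] r by auto
        show "p (q (H (s, t))) = p (k s t)" if "t \<in> {a..b}" for t
          using uT(4) HsT[OF that s] k(3)[OF s(1), of t] that r by auto
        show "q (H (s, a)) = k s a" using uT(5)[OF ku] k(3)[OF s(1), of a] ab r by auto
      qed (use ab in auto)
      have "((\<lambda>s. k s a) \<longlongrightarrow> k s0 a) (at s0 within {0..1})" using Ca by (simp add: C_def continuous_within)
      then have "\<forall>\<^sub>F s in at s0 within {0..1}. k s a \<in> U"
        using topological_tendstoD[OF _ U(1)] u(2) U(2) by auto
      moreover have "\<forall>\<^sub>F s in at s0 within {0..1}. \<bar>s - s0\<bar> < e / 2"
        using e(1) by (auto simp: eventually_at dist_real_def intro!: exI[of _ "e/2"])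
      moreover have "\<forall>\<^sub>F s in at s0 within {0..1}. s \<in> {0..1}"
        by (auto simp: eventually_at_filter)
      ultimately have ev: "\<forall>\<^sub>F s in at s0 within {0..1}. q (H (s, b)) = k s b"
      proof eventually_elim
        case (elim s)
        have "k s a \<in> P" using k(2)[OF elim(3)] ab r by auto
        then show ?case using slice elim U(2) by simp
      qed
      have s0b: "q (H (s0, b)) = k s0 b" using slice[OF s0] u(2) e(1) by simp
      let ?S = "{s \<in> {0..1}. \<bar>s - s0\<bar> < e / 2}"
      have "continuous_on ?S (\<lambda>s. H (s, b))"
        by (rule continuous_on_compose2[OF H(1)]) (use r ab x in \<open>auto intro!: continuous_intros\<close>)
      then have "continuous_on ?S (\<lambda>s. q (H (s, b)))"
        by (rule continuous_on_compose2[OF uT(3)]) (use HsT[of b] ab in auto)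
      then have "continuous (at s0 within ?S) (\<lambda>s. q (H (s, b)))"
        using s0 e(1) by (simp add: continuous_on_eq_continuous_within)
      moreover have "at s0 within ?S = at s0 within {0..1}"
        using e(1) by (intro at_within_nhd[of s0 "{s0 - e/2 <..< s0 + e/2}"]) (auto simp: abs_if)
      ultimately have "((\<lambda>s. q (H (s, b))) \<longlongrightarrow> q (H (s0, b))) (at s0 within {0..1})"
        by (simp add: continuous_within)
      then show "C b" unfolding C_def continuous_within
        using Lim_transform_eventually[OF _ ev] s0b by simp
    qed
    then show "\<exists>d>0. \<forall>a b. a \<le> x \<and> x \<le> b \<and> b - a < d \<longrightarrow> R a b" using e(1) by (intro exI[of _ "e/2"]) auto
  qed (auto simp: R_def)
  then show "continuous (at s0 within {0..1}) (\<lambda>s. k s 1)"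
    using k0 s0 by (simp add: R_def C_def continuous_on_eq_continuous_within)
qed

text \<open>The lifts of all intermediate paths start at one point, and their end points form a
  continuous lift of a constant path, hence do not move.\<close>

lemma covering_monodromy:
  fixes h1 h2 :: "real \<Rightarrow> 'b::topological_space"
  assumes cov: "covering_space P p X" and hom: "homotopic_paths X g1 g2"
    and h1: "path h1" "path_image h1 \<subseteq> P" "\<And>t. t \<in> {0..1} \<Longrightarrow> p (h1 t) = g1 t"
    and h2: "path h2" "path_image h2 \<subseteq> P" "\<And>t. t \<in> {0..1} \<Longrightarrow> p (h2 t) = g2 t"
    and eq: "pathstart h1 = pathstart h2"
  shows "pathfinish h1 = pathfinish h2"
proof -
  obtain H where H0: "continuous_on ({0..1::real} \<times> {0..1::real}) H" "H \<in> {0..1} \<times> {0..1} \<rightarrow> X"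
    "\<forall>t\<in>{0..1}. H (0, t) = g1 t" "\<forall>t\<in>{0..1}. H (1, t) = g2 t"
    "\<forall>s\<in>{0..1}. pathstart (H \<circ> Pair s) = pathstart g1 \<and> pathfinish (H \<circ> Pair s) = pathfinish g1"
    using hom unfolding homotopic_paths by blast
  then have H: "continuous_on ({0..1} \<times> {0..1}) H" "H ` ({0..1} \<times> {0..1}) \<subseteq> X"
    "\<And>t. t \<in> {0..1} \<Longrightarrow> H (0, t) = g1 t" "\<And>t. t \<in> {0..1} \<Longrightarrow> H (1, t) = g2 t"
    "\<And>s. s \<in> {0..1} \<Longrightarrow> H (s, 0) = g1 0" "\<And>s. s \<in> {0..1} \<Longrightarrow> H (s, 1) = g1 1"
    by (auto simp: pathstart_def pathfinish_def)
  let ?y = "pathstart h1"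
  have y: "?y \<in> P" "p ?y = g1 0" using h1 by (auto simp: pathstart_def path_image_def)
  have "\<forall>s\<in>{0..1}. \<exists>k. path k \<and> path_image k \<subseteq> P \<and> pathstart k = ?y \<and> (\<forall>t\<in>{0..1}. p (k t) = H (s, t))"
  proof
    fix s :: real assume s: "s \<in> {0..1}"
    have "continuous_on {0..1} (\<lambda>t. H (s, t))"
      by (rule continuous_on_compose2[OF H(1)]) (use s in \<open>auto intro!: continuous_intros\<close>)
    then have "path (\<lambda>t. H (s, t))" "path_image (\<lambda>t. H (s, t)) \<subseteq> X" "p ?y = pathstart (\<lambda>t. H (s, t))"
      using H(2) H(5)[OF s] s y by (auto simp: path_def path_image_def pathstart_def)
    then show "\<exists>k. path k \<and> path_image k \<subseteq> P \<and> pathstart k = ?y \<and> (\<forall>t\<in>{0..1}. p (k t) = H (s, t))"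
      using covering_lift_path[OF cov _ _ y(1), of "\<lambda>t. H (s, t)"] by metis
  qed
  from bchoice[OF this] obtain k where k0: "\<forall>s\<in>{0..1}. path (k s) \<and> path_image (k s) \<subseteq> P \<and>
    pathstart (k s) = ?y \<and> (\<forall>t\<in>{0..1}. p (k s t) = H (s, t))" by blast
  then have k: "\<And>s. s \<in> {0..1} \<Longrightarrow> path (k s)" "\<And>s. s \<in> {0..1} \<Longrightarrow> path_image (k s) \<subseteq> P"
    "\<And>s. s \<in> {0..1} \<Longrightarrow> pathstart (k s) = ?y" "\<And>s t. s \<in> {0..1} \<Longrightarrow> t \<in> {0..1} \<Longrightarrow> p (k s t) = H (s, t)"
    by blast+
  have kP: "k s t \<in> P" if "s \<in> {0..1}" "t \<in> {0..1}" for s t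
    using k(2)[OF that(1)] that(2) by (auto simp: path_image_def)
  have "continuous_on {0..1} (\<lambda>s. k s 0)"
    by (rule continuous_on_eq[OF continuous_on_const[of _ ?y]]) (use k(3) in \<open>simp add: pathstart_def\<close>)
  then have c: "continuous_on {0..1} (\<lambda>s. k s 1)"
    by (intro covering_lift_family[OF cov H(1,2), of k]) (use k(1,4) kP in \<open>auto simp: path_def\<close>)
  have "k 0 1 = k 1 1"
    by (rule covering_lift_unique[OF cov, of "{0..1}" 0 1 "\<lambda>s. k 0 1" "\<lambda>s. k s 1"])
      (use c kP k(4) H(6) in auto)
  moreover have "k 0 1 = h1 1"
    by (rule covering_lift_unique[OF cov, of "{0..1}" 0 1 "k 0" h1])
      (use k[of 0] h1 H(3) in \<open>auto simp: path_def path_image_def pathstart_def\<close>)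
  moreover have "k 1 1 = h2 1"
    by (rule covering_lift_unique[OF cov, of "{0..1}" 0 1 "k 1" h2])
      (use k[of 1] h2 H(4) eq in \<open>auto simp: path_def path_image_def pathstart_def\<close>)
  ultimately show ?thesis by (simp add: pathfinish_def)
qed

section \<open>Paths in simply connected spaces\<close>

lemma joinpaths_cong:
  "\<forall>t\<in>{0..1}. f t = f' t \<Longrightarrow> \<forall>t\<in>{0..1}. g t = g' t \<Longrightarrow> \<forall>t\<in>{0..1}. (f +++ g) t = (f' +++ g') t"
  by (auto simp: joinpaths_def)

lemma constant_path:
  "path (\<lambda>_. y)" "path_image (\<lambda>_. y) = {y}" "pathstart (\<lambda>_. y) = y" "pathfinish (\<lambda>_. y) = y"
  by (auto simp: path_def path_image_def pathstart_def pathfinish_def)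

text \<open>
  A free null-homotopy of the loop formed by two paths is pushed forward from the square, where
  all paths with the same end points are homotopic.
\<close>

lemma simply_connected_homotopic_paths:
  fixes q q' :: "real \<Rightarrow> 'b::topological_space"
  assumes P: "simply_connected P" and q: "path q" "path_image q \<subseteq> P"
    and q': "path q'" "path_image q' \<subseteq> P"
    and ends: "pathstart q' = pathstart q" "pathfinish q' = pathfinish q"
  shows "homotopic_paths P q q'"
proof -
  let ?y = "pathstart q" and ?Q = "{0..1::real} \<times> {0..1::real}"
  let ?l = "q +++ reversepath q'"
  have y: "?y \<in> P" using q by (metis pathstart_in_path_image subsetD)
  have "path ?l" "path_image ?l \<subseteq> P" "pathfinish ?l = pathstart ?l"
    using q q' ends by (auto simp: path_image_join)
  moreover have "path (\<lambda>_. ?y)" "path_image (\<lambda>_. ?y) \<subseteq> P" "pathfinish (\<lambda>_. ?y) = pathstart (\<lambda>_. ?y)"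
    using y by (simp_all add: constant_path)
  ultimately have "homotopic_loops P ?l (\<lambda>_. ?y)"
    using P unfolding simply_connected_def by blast
  then obtain h where h0: "continuous_on ?Q h" "h \<in> ?Q \<rightarrow> P"
    "\<forall>t\<in>{0..1}. h (0, t) = ?l t" "\<forall>t\<in>{0..1}. h (1, t) = ?y"
    "\<forall>s\<in>{0..1}. pathfinish (h \<circ> Pair s) = pathstart (h \<circ> Pair s)"
    unfolding homotopic_loops by blast
  then have h: "continuous_on ?Q h" "h ` ?Q \<subseteq> P"
    "\<And>t. t \<in> {0..1} \<Longrightarrow> h (0, t) = ?l t" "\<And>t. t \<in> {0..1} \<Longrightarrow> h (1, t) = ?y"
    "\<And>s. s \<in> {0..1} \<Longrightarrow> h (s, 1) = h (s, 0)"
    by (auto simp: pathstart_def pathfinish_def)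
  \<comment> \<open>The segment \<open>?A\<close> carries \<open>q\<close>, while \<open>?B\<close>
    goes around the remaining part of the boundary of the square.\<close>
  let ?A = "linepath (0::real, 0::real) (0, 1/2)"
  let ?B = "linepath (0::real, 0::real) (1, 0) +++ linepath (1, 0) (1, 1) +++
    linepath (1, 1) (0, 1) +++ linepath (0, 1) (0, 1/2)"
  have convex: "convex ?Q" by (intro convex_Times convex_real_interval)
  have seg: "closed_segment a b \<subseteq> ?Q" if "a \<in> ?Q" "b \<in> ?Q" for a b
    using convex that by (simp add: closed_segment_subset)
  have hP: "h (s, t) \<in> P" if "s \<in> {0..1}" "t \<in> {0..1}" for s t
    using h(2) that by blast
  have q'P: "q' t \<in> P" if "t \<in> {0..1}" for t
    using q'(2) that by (auto simp: path_image_def)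
  have "path ?A" "path ?B" "pathstart ?B = pathstart ?A" "pathfinish ?B = pathfinish ?A" by simp_all
  moreover have "path_image ?A \<subseteq> ?Q" unfolding path_image_linepath by (rule seg) auto
  moreover have "path_image ?B \<subseteq> ?Q"
    by (intro subset_path_image_join; unfold path_image_linepath; rule seg) auto
  ultimately have "homotopic_paths ?Q ?A ?B"
    using convex_imp_simply_connected[OF convex] unfolding simply_connected_eq_homotopic_paths by blast
  then have 1: "homotopic_paths P (h \<circ> ?A) (h \<circ> ?B)"
    using homotopic_paths_continuous_image[OF _ h(1)] h(2) by blast
  define a where "a s = h (s, 0)" for s
  \<comment> \<open>During the free homotopy the base point runs along a loop \<open>a\<close> that
    need not be constant. The map \<open>m\<close> unrolls \<open>a\<close> on the negative axis and
    \<open>q'\<close> on the positive one; the image of \<open>?B\<close> becomes \<open>?C\<close>,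
    which traverses \<open>a\<close>, rests, retraces \<open>a\<close> and then follows
    \<open>q'\<close>.\<close>
  define m where "m x = (if x \<le> 0 then a (- x) else q' x)" for x :: real
  have a0: "a 0 = ?y" "a 1 = ?y" using h(3)[of 0] h(4)[of 0] by (auto simp: a_def joinpaths_def pathstart_def)
  have ac: "continuous_on {0..1} a" unfolding a_def
    by (rule continuous_on_compose2[OF h(1)]) (auto intro!: continuous_intros)
  have "continuous_on ({-1..0} \<union> {0..1}) m" unfolding m_def
  proof (rule continuous_on_cases)
    show "continuous_on {-1..0} (\<lambda>x. a (- x))"
      by (rule continuous_on_compose2[OF ac]) (auto intro!: continuous_intros)
    show "continuous_on {0..1} q'" using q' by (simp add: path_def)
  qed (use a0 ends in \<open>auto simp: pathstart_def\<close>)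
  moreover have "{-1..0} \<union> {0..1} = {-1..1::real}" by auto
  ultimately have mc: "continuous_on {-1..1} m" by simp
  have mP: "m \<in> {-1..1} \<rightarrow> P" using hP q'P by (auto simp: m_def a_def)
  let ?C = "linepath (0::real) (-1) +++ linepath (-1) (-1) +++ linepath (-1) 0 +++ linepath 0 1"
  have seg': "closed_segment a b \<subseteq> {-1..1::real}" if "a \<in> {-1..1}" "b \<in> {-1..1}" for a b
    using that by (simp add: closed_segment_subset)
  have "path ?C" "path (linepath 0 (1::real))" "pathstart (linepath 0 1) = pathstart ?C"
    "pathfinish (linepath 0 1) = pathfinish ?C" by simp_all
  moreover have "path_image (linepath 0 1) \<subseteq> {-1..1::real}" unfolding path_image_linepath by (rule seg') auto
  moreover have "path_image ?C \<subseteq> {-1..1}"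
    by (intro subset_path_image_join; unfold path_image_linepath; rule seg') auto
  ultimately have "homotopic_paths {-1..1} ?C (linepath 0 1)"
    using convex_imp_simply_connected[OF convex_real_interval(5)[of "-1" 1]]
    unfolding simply_connected_eq_homotopic_paths by blast
  then have 2: "homotopic_paths P (m \<circ> ?C) (m \<circ> linepath 0 1)"
    using homotopic_paths_continuous_image[OF _ mc mP] by blast
  have eqA: "(h \<circ> ?A) t = q t" if "t \<in> {0..1}" for t
    using h(3)[of "t / 2"] that by (auto simp: linepath_def joinpaths_def)
  have eqm: "(m \<circ> linepath 0 1) t = q' t" if "t \<in> {0..1}" for t
    using that a0 ends by (auto simp: linepath_def m_def pathstart_def)
  have e1: "(h \<circ> linepath (0, 0) (1, 0)) t = (m \<circ> linepath 0 (-1)) t" if "t \<in> {0..1}" for t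
    using that by (auto simp: linepath_def m_def a_def)
  have e2: "(h \<circ> linepath (1, 0) (1, 1)) t = (m \<circ> linepath (-1) (-1)) t" if "t \<in> {0..1}" for t
    using that h(4)[of t] a0 by (auto simp: linepath_def m_def algebra_simps)
  have e3: "(h \<circ> linepath (1, 1) (0, 1)) t = (m \<circ> linepath (-1) 0) t" if "t \<in> {0..1}" for t
    using that h(5)[of "1 - t"] by (auto simp: linepath_def m_def a_def algebra_simps)
  have e4: "(h \<circ> linepath (0, 1) (0, 1/2)) t = (m \<circ> linepath 0 1) t" if t: "t \<in> {0..1}" for t
  proof -
    have "(h \<circ> linepath (0, 1) (0, 1/2)) t = ?l (1 - t / 2)"
      using h(3)[of "1 - t / 2"] t by (simp add: linepath_def algebra_simps)
    also have "\<dots> = q' t"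
    proof (cases "t = 1")
      case True
      then show ?thesis using ends by (simp add: joinpaths_def pathfinish_def)
    next
      case False
      then show ?thesis using t by (auto simp: joinpaths_def reversepath_def algebra_simps)
    qed
    finally show ?thesis using eqm[OF t] by simp
  qed
  have eqB: "\<forall>t\<in>{0..1}. (h \<circ> ?B) t = (m \<circ> ?C) t"
    unfolding path_compose_join
    by (intro joinpaths_cong; rule ballI; rule e1 e2 e3 e4; assumption)
  have "homotopic_paths P q (h \<circ> ?A)"
    using homotopic_paths_eq[of q P "h \<circ> ?A"] q eqA by simp
  moreover have "homotopic_paths P (h \<circ> ?B) (m \<circ> ?C)"
    using homotopic_paths_eq[of "h \<circ> ?B" P "m \<circ> ?C"] homotopic_paths_imp_path[OF 1]
      homotopic_paths_imp_subset[OF 1] eqB by simp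
  moreover have "homotopic_paths P (m \<circ> linepath 0 1) q'"
    using homotopic_paths_eq[of "m \<circ> linepath 0 1" P q'] homotopic_paths_imp_path[OF 2]
      homotopic_paths_imp_subset[OF 2] eqm by simp
  ultimately show ?thesis using 1 2 by (meson homotopic_paths_trans)
qed

lemma simply_connected_path:
  assumes P: "simply_connected P" and y: "y \<in> P" "z \<in> P"
  obtains q where "path q" "path_image q \<subseteq> P" "pathstart q = y" "pathfinish q = z"
proof -
  have "homotopic_loops P (\<lambda>_. y) (\<lambda>_. z)"
    using P y unfolding simply_connected_def by (simp add: constant_path)
  then obtain h where h0: "continuous_on ({0..1::real} \<times> {0..1::real}) h" "h \<in> {0..1} \<times> {0..1} \<rightarrow> P"
    "\<forall>t\<in>{0..1}. h (0, t) = y" "\<forall>t\<in>{0..1}. h (1, t) = z"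
    unfolding homotopic_loops by blast
  then have h: "continuous_on ({0..1} \<times> {0..1}) h" "h ` ({0..1} \<times> {0..1}) \<subseteq> P"
    "h (0, 0) = y" "h (1, 0) = z"
    by auto
  have "continuous_on {0..1} (\<lambda>s::real. h (s, 0))"
    by (rule continuous_on_compose2[OF h(1)]) (auto intro!: continuous_intros)
  moreover have "(\<lambda>s. h (s, 0)) ` {0..1} \<subseteq> P" using h(2) by auto
  ultimately show ?thesis using that[of "\<lambda>s. h (s, 0)"] h(3,4)
    by (simp add: path_def path_image_def pathstart_def pathfinish_def)
qed

lemma simply_connected_connected:
  assumes "simply_connected P"
  shows "connected P"
proof -
  have "path_connected P"
    unfolding path_connected_def using simply_connected_path[OF assms] by metis
  then show ?thesis by (rule path_connected_imp_connected)
qed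

section \<open>Deck transformations as lifts of the covering map\<close>

locale universal_covering =
  fixes P :: "'b::t2_space set" and p :: "'b \<Rightarrow> 'a::topological_space" and X :: "'a set"
  assumes covering: "covering_space P p X" and simply_connected: "simply_connected P"
    and locally_path_connected: "locally path_connected P"
begin

abbreviation deck :: "('b \<Rightarrow> 'b) set" where "deck \<equiv> deck_transformations P p"

lemma p_in [simp]: "z \<in> P \<Longrightarrow> p z \<in> X" using covering_space_imp_surjective[OF covering] by blast

lemma p_continuous: "continuous_on P p" using covering_space_imp_continuous[OF covering] .

lemma deckD:
  assumes "f \<in> deck"
  shows "continuous_on P f" "\<And>z. z \<in> P \<Longrightarrow> f z \<in> P" "\<And>z. z \<in> P \<Longrightarrow> p (f z) = p z" "f ` P = P" "inj_on f P"
proof -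
  obtain g where g: "homeomorphism P P f g" and p: "\<forall>x\<in>P. p (f x) = p x"
    using assms unfolding deck_transformations_def by blast
  show "continuous_on P f" "f ` P = P" using g by (simp_all add: homeomorphism_def)
  then show "f z \<in> P" if "z \<in> P" for z using that by blast
  show "p (f z) = p z" if "z \<in> P" for z using p that by blast
  show "inj_on f P" by (rule inj_on_inverseI[of _ g]) (use g in \<open>simp add: homeomorphism_def\<close>)
qed

lemma path_push:
  assumes "path q" "path_image q \<subseteq> P"
  shows "path (p \<circ> q)" "path_image (p \<circ> q) \<subseteq> X"
  using assms p_continuous path_continuous_image[of q p]
  by (auto simp: path_image_def intro: continuous_on_subset)

text \<open>The image of \<open>z\<close> is the end of the lift, starting at \<open>y2\<close>, of
  the projection of a path from \<open>y1\<close> to \<open>z\<close>. Simple connectivity and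
  monodromy make it independent of the path, and local path connectedness gives continuity.\<close>

lemma lift_exists:
  assumes y: "y1 \<in> P" "y2 \<in> P" "p y1 = p y2"
  shows "\<exists>f. continuous_on P f \<and> f ` P \<subseteq> P \<and> f y1 = y2 \<and> (\<forall>z\<in>P. p (f z) = p z)"
proof -
  define Rel where "Rel z w \<longleftrightarrow> (\<exists>q k. path q \<and> path_image q \<subseteq> P \<and> pathstart q = y1 \<and> pathfinish q = z \<and>
    path k \<and> path_image k \<subseteq> P \<and> pathstart k = y2 \<and> pathfinish k = w \<and> (\<forall>t\<in>{0..1}. p (k t) = p (q t)))" for z w
  have ex: "\<exists>w. Rel z w" if z: "z \<in> P" for z
  proof -
    obtain q where q: "path q" "path_image q \<subseteq> P" "pathstart q = y1" "pathfinish q = z"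
      using simply_connected_path[OF simply_connected y(1) z] .
    have "p y2 = pathstart (p \<circ> q)" using q y by (simp add: pathstart_def)
    then obtain k where "path k" "path_image k \<subseteq> P" "pathstart k = y2" "\<And>t. t \<in> {0..1} \<Longrightarrow> p (k t) = (p \<circ> q) t"
      using covering_lift_path[OF covering path_push[OF q(1,2)] y(2)] by metis
    then have "Rel z (pathfinish k)" unfolding Rel_def using q by (intro exI[of _ q] exI[of _ k]) simp
    then show ?thesis by blast
  qed
  have unique: "w = w'" if r: "Rel z w" "Rel z w'" for z w w'
  proof -
    obtain q k where qk: "path q" "path_image q \<subseteq> P" "pathstart q = y1" "pathfinish q = z" "path k"
      "path_image k \<subseteq> P" "pathstart k = y2" "pathfinish k = w" "\<And>t. t \<in> {0..1} \<Longrightarrow> p (k t) = (p \<circ> q) t"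
      using r unfolding Rel_def by auto
    obtain q' k' where qk': "path q'" "path_image q' \<subseteq> P" "pathstart q' = y1" "pathfinish q' = z" "path k'"
      "path_image k' \<subseteq> P" "pathstart k' = y2" "pathfinish k' = w'" "\<And>t. t \<in> {0..1} \<Longrightarrow> p (k' t) = (p \<circ> q') t"
      using r unfolding Rel_def by auto
    have "homotopic_paths P q q'"
      using simply_connected_homotopic_paths[OF simply_connected] qk qk' by simp
    then have hom: "homotopic_paths X (p \<circ> q) (p \<circ> q')"
      using homotopic_paths_continuous_image p_continuous by fastforce
    have "pathfinish k = pathfinish k'"
      by (rule covering_monodromy[OF covering hom qk(5,6,9) qk'(5,6,9)]) (simp_all add: qk(7) qk'(7))
    then show ?thesis using qk(8) qk'(8) by simp
  qed
  define f where "f z = (SOME w. Rel z w)" for z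
  have f: "Rel z (f z)" if "z \<in> P" for z unfolding f_def using ex[OF that] by (rule someI_ex)
  have fP: "f z \<in> P \<and> p (f z) = p z" if zP: "z \<in> P" for z
  proof -
    obtain q k where qk: "path_image k \<subseteq> P" "pathfinish k = f z" "pathfinish q = z"
      "\<forall>t\<in>{0..1}. p (k t) = p (q t)"
      using f[OF zP] unfolding Rel_def by auto
    have "k 1 \<in> P" using qk(1) by (auto simp: path_image_def)
    moreover have "p (k 1) = p (q 1)" using qk(4) by simp
    ultimately show ?thesis using qk(2,3) by (simp add: pathfinish_def)
  qed
  have "Rel y1 y2" unfolding Rel_def
    by (rule exI[of _ "\<lambda>_. y1"], rule exI[of _ "\<lambda>_. y2"])
      (use y in \<open>auto simp: path_def path_image_def pathstart_def pathfinish_def\<close>)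
  then have fy: "f y1 = y2" using unique f y by blast
  have "continuous (at z within P) f" if z: "z \<in> P" for z
  proof -
    obtain T v where T: "p z \<in> T" "openin (top_of_set X) T" "\<Union>v = P \<inter> p -` T"
      and v: "\<And>u. u \<in> v \<Longrightarrow> openin (top_of_set P) u" "\<And>u. u \<in> v \<Longrightarrow> \<exists>q. homeomorphism u T p q"
      using covering_space_evenly_covered[OF covering p_in[OF z]] by metis
    have "z \<in> \<Union>v" "f z \<in> \<Union>v" using T z fP[OF z] by auto
    then obtain u u' r where u: "u \<in> v" "z \<in> u" "u' \<in> v" "f z \<in> u'" "homeomorphism u' T p r"
      using v by blast
    obtain U V where UV: "openin (top_of_set P) U" "path_connected V" "z \<in> U" "U \<subseteq> V" "V \<subseteq> u"
      using locally_path_connected v(1)[OF u(1)] u(2) unfolding locally_def by meson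
    have uT: "u \<subseteq> P" "p ` u \<subseteq> T" "u' \<subseteq> P" "r ` T \<subseteq> u'" "continuous_on T r" "\<And>x. x \<in> T \<Longrightarrow> p (r x) = x"
      "r (p (f z)) = f z"
      using u T by (auto simp: homeomorphism_def)
    \<comment> \<open>A path \<open>s\<close> from \<open>z\<close> to \<open>x\<close> inside the
      sheet \<open>u\<close> is transferred to the sheet of \<open>f z\<close> by \<open>r\<close>;
      appended to the paths for \<open>z\<close>, it computes \<open>f x\<close>.\<close>
    have eq: "r (p x) = f x" if x: "x \<in> U" for x
    proof -
      obtain s where s: "path s" "path_image s \<subseteq> V" "pathstart s = z" "pathfinish s = x"
        using UV x unfolding path_connected_def by (meson subsetD)
      obtain q k where qk: "path q" "path_image q \<subseteq> P" "pathstart q = y1" "pathfinish q = z" "path k"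
        "path_image k \<subseteq> P" "pathstart k = y2" "pathfinish k = f z" "\<And>t. t \<in> {0..1} \<Longrightarrow> p (k t) = p (q t)"
        using f[OF z] unfolding Rel_def by auto
      let ?k = "r \<circ> (p \<circ> s)"
      have st: "s t \<in> u" "s t \<in> P" "p (s t) \<in> T" if "t \<in> {0..1}" for t
      proof -
        have "s t \<in> path_image s" using that by (simp add: path_image_def)
        then show "s t \<in> u" using s(2) UV by blast
        then show "s t \<in> P" "p (s t) \<in> T" using uT(1,2) by blast+
      qed
      have sP: "path_image s \<subseteq> P" "path_image (p \<circ> s) \<subseteq> T" using st by (auto simp: path_image_def)
      have k: "path ?k" "pathstart ?k = f z" "pathfinish ?k = r (p x)"
        using path_continuous_image[OF path_push(1)[OF s(1) sP(1)], of r] continuous_on_subset[OF uT(5) sP(2)]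
          s(3,4) uT(7) fP[OF z] by (auto simp: pathstart_def pathfinish_def)
      have "r (p (s t)) \<in> P" if "t \<in> {0..1}" for t using st(3)[OF that] uT(3,4) by blast
      then have kP: "path_image ?k \<subseteq> P" by (auto simp: path_image_def)
      have "p ((k +++ ?k) t) = p ((q +++ s) t)" if "t \<in> {0..1}" for t
      proof -
        have "p (r (p (s t'))) = p (s t')" if "t' \<in> {0..1}" for t'
          using st(3)[OF that] uT(6) by blast
        then show ?thesis using that qk(9) by (auto simp: joinpaths_def)
      qed
      moreover have "path (k +++ ?k)" "path_image (k +++ ?k) \<subseteq> P" "path (q +++ s)" "path_image (q +++ s) \<subseteq> P"
        using qk k kP s sP by (auto intro!: path_join_imp simp: path_image_join)
      ultimately have "Rel x (r (p x))" unfolding Rel_def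
        by (intro exI[of _ "q +++ s"] exI[of _ "k +++ ?k"]) (use qk s k in auto)
      moreover have "Rel x (f x)" using f UV uT x by auto
      ultimately show ?thesis using unique by blast
    qed
    have "continuous (at z within U) (\<lambda>x. r (p x))"
    proof -
      have "continuous_on U p" using p_continuous UV uT by (meson continuous_on_subset subset_trans)
      then have "continuous_on U (\<lambda>x. r (p x))"
        by (rule continuous_on_compose2[OF uT(5)]) (use uT(2) UV in blast)
      then show ?thesis using UV by (simp add: continuous_on_eq_continuous_within)
    qed
    moreover have "at z within U = at z within P"
    proof -
      obtain O' where "open O'" "U = P \<inter> O'" using UV by (auto simp: openin_open)
      then show ?thesis using UV(3) by (intro at_within_nhd[of z O']) auto
    qed
    ultimately have "continuous (at z within P) (\<lambda>x. r (p x))" by (simp add: continuous_within)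
    then show ?thesis using continuous_transform_within_openin[OF _ UV(1,3)] eq by blast
  qed
  then have "continuous_on P f" by (simp add: continuous_on_eq_continuous_within)
  then show ?thesis using fP fy by blast
qed

lemma deck_unique:
  assumes "continuous_on P f" "f ` P \<subseteq> P" "\<And>z. z \<in> P \<Longrightarrow> p (f z) = p z"
    and "continuous_on P g" "g ` P \<subseteq> P" "\<And>z. z \<in> P \<Longrightarrow> p (g z) = p z"
    and "y \<in> P" "f y = g y" "z \<in> P"
  shows "f z = g z"
  using covering_lift_unique[OF covering simply_connected_connected[OF simply_connected], of y z f g] assms
  by auto

lemma deck_eq:
  assumes "f \<in> deck" "g \<in> deck" "y \<in> P" "f y = g y" "z \<in> P"
  shows "f z = g z"
  using deck_unique[of f g y z] assms deckD(1,3,4)[OF assms(1)] deckD(1,3,4)[OF assms(2)] by simp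

lemma id_deck: "id \<in> deck" "(\<lambda>z. z) \<in> deck"
  by (auto simp: deck_transformations_def homeomorphism_def intro!: exI[of _ "\<lambda>z. z"])

lemma comp_deck:
  assumes "f \<in> deck" "g \<in> deck"
  shows "f \<circ> g \<in> deck"
proof -
  obtain f' g' where h: "homeomorphism P P f f'" "homeomorphism P P g g'"
    using assms unfolding deck_transformations_def by blast
  have "homeomorphism P P (f \<circ> g) (g' \<circ> f')" by (rule homeomorphism_compose[OF h(2,1)])
  moreover have "p ((f \<circ> g) x) = p x" if "x \<in> P" for x
    using deckD(3)[OF assms(1) deckD(2)[OF assms(2) that]] deckD(3)[OF assms(2) that] by simp
  ultimately show ?thesis unfolding deck_transformations_def by blast
qed

text \<open>Lifts taking \<open>y1\<close> to \<open>y2\<close> and back are inverse to each other,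
  because their composites agree with the identity at one point.\<close>

lemma deck_exists:
  assumes y: "y1 \<in> P" "y2 \<in> P" "p y1 = p y2"
  obtains f where "f \<in> deck" "f y1 = y2"
proof -
  obtain f where f: "continuous_on P f" "f ` P \<subseteq> P" "f y1 = y2" "\<And>z. z \<in> P \<Longrightarrow> p (f z) = p z"
    using lift_exists[OF y] by auto
  obtain g where g: "continuous_on P g" "g ` P \<subseteq> P" "g y2 = y1" "\<And>z. z \<in> P \<Longrightarrow> p (g z) = p z"
    using lift_exists[OF y(2,1)] y(3) by auto
  have comp: "continuous_on P (a \<circ> b)" "(a \<circ> b) ` P \<subseteq> P" "\<And>z. z \<in> P \<Longrightarrow> p ((a \<circ> b) z) = p z"
    if "continuous_on P a" "a ` P \<subseteq> P" "\<And>z. z \<in> P \<Longrightarrow> p (a z) = p z"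
      "continuous_on P b" "b ` P \<subseteq> P" "\<And>z. z \<in> P \<Longrightarrow> p (b z) = p z" for a b
  proof -
    show "continuous_on P (a \<circ> b)"
      by (rule continuous_on_compose[OF that(4) continuous_on_subset[OF that(1,5)]])
  qed (use that in \<open>auto simp: image_subset_iff\<close>)
  have "(g \<circ> f) z = z" if "z \<in> P" for z
    using deck_unique[of "g \<circ> f" id y1 z] comp[OF g(1,2,4) f(1,2,4)] f g y that by auto
  moreover have "(f \<circ> g) z = z" if "z \<in> P" for z
    using deck_unique[of "f \<circ> g" id y2 z] comp[OF f(1,2,4) g(1,2,4)] f g y that by auto
  ultimately have "homeomorphism P P f g"
    using f g by (intro homeomorphismI) auto
  then have "f \<in> deck" using f(4) unfolding deck_transformations_def by blast
  then show ?thesis using that f(3) by blast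
qed

end

lemma homotopy_class_self: "path a \<Longrightarrow> path_image a \<subseteq> S \<Longrightarrow> a \<in> homotopy_class S a"
  by (simp add: homotopy_class_def)

lemma homotopy_class_eq_iff:
  assumes "path a" "path_image a \<subseteq> S"
  shows "homotopy_class S a = homotopy_class S b \<longleftrightarrow> homotopic_paths S a b"
proof
  assume "homotopy_class S a = homotopy_class S b"
  moreover have "a \<in> homotopy_class S a" by (rule homotopy_class_self[OF assms])
  ultimately show "homotopic_paths S a b" by (simp add: homotopy_class_def homotopic_paths_sym)
qed (auto simp: homotopy_class_def intro: homotopic_paths_trans homotopic_paths_sym)

section \<open>Deck transformations and the fundamental group\<close>

locale pointed_universal_covering = universal_covering P p X
  for P :: "'b::t2_space set" and p :: "'b \<Rightarrow> 'a::topological_space" and X :: "'a set" +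
  fixes y0 :: 'b
  assumes y0: "y0 \<in> P"
begin

abbreviation "\<pi> \<equiv> fundamental_group X (p y0)"

text \<open>Any path from \<open>y0\<close> to \<open>f y0\<close> projects to a representative. The
  class depends on \<open>f y0\<close> only, so it ignores the values of \<open>f\<close> outside
  \<open>P\<close>.\<close>

definition deck_class :: "('b \<Rightarrow> 'b) \<Rightarrow> (real \<Rightarrow> 'a) set" where
  "deck_class f = homotopy_class X (p \<circ> (SOME q. path q \<and> path_image q \<subseteq> P \<and> pathstart q = y0 \<and> pathfinish q = f y0))"

lemma deck_class_cong: "f y0 = g y0 \<Longrightarrow> deck_class f = deck_class g"
  by (simp add: deck_class_def)

lemma deck_class_eq:
  assumes f: "f \<in> deck" and q: "path q" "path_image q \<subseteq> P" "pathstart q = y0" "pathfinish q = f y0"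
  shows "deck_class f = homotopy_class X (p \<circ> q)"
proof -
  let ?q = "SOME q. path q \<and> path_image q \<subseteq> P \<and> pathstart q = y0 \<and> pathfinish q = f y0"
  have *: "path ?q \<and> path_image ?q \<subseteq> P \<and> pathstart ?q = y0 \<and> pathfinish ?q = f y0"
    by (rule someI[of _ q]) (use q in simp)
  then have "homotopic_paths P ?q q"
    using simply_connected_homotopic_paths[OF simply_connected, of ?q q] q by simp
  then have "homotopic_paths X (p \<circ> ?q) (p \<circ> q)"
    using homotopic_paths_continuous_image p_continuous by fastforce
  then show ?thesis
    unfolding deck_class_def using homotopy_class_eq_iff path_push * by blast
qed

lemma deck_path:
  assumes "f \<in> deck"
  obtains q where "path q" "path_image q \<subseteq> P" "pathstart q = y0" "pathfinish q = f y0"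
    "deck_class f = homotopy_class X (p \<circ> q)"
  using simply_connected_path[OF simply_connected y0 deckD(2)[OF assms y0]] deck_class_eq[OF assms] by metis

lemma deck_class_closed:
  assumes "f \<in> deck"
  shows "deck_class f \<in> carrier \<pi>"
proof -
  obtain q where q: "path q" "path_image q \<subseteq> P" "pathstart q = y0" "pathfinish q = f y0"
    "deck_class f = homotopy_class X (p \<circ> q)" using deck_path[OF assms] .
  moreover have "pathstart (p \<circ> q) = p y0" "pathfinish (p \<circ> q) = p y0"
    using q deckD(3)[OF assms y0] by (simp_all add: pathstart_compose pathfinish_compose)
  ultimately show ?thesis using path_push[OF q(1,2)] by (simp add: fundamental_group_def)
qed

text \<open>A path for \<open>f\<close> followed by the image under \<open>f\<close> of a path for
  \<open>g\<close> leads from \<open>y0\<close> to \<open>f (g y0)\<close>. Its second half has the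
  same projection as the path for \<open>g\<close>, so the order of the factors is
  preserved.\<close>

lemma deck_class_comp:
  assumes f: "f \<in> deck" and g: "g \<in> deck"
  shows "deck_class (f \<circ> g) = deck_class f \<otimes>\<^bsub>\<pi>\<^esub> deck_class g"
proof -
  obtain a where a: "path a" "path_image a \<subseteq> P" "pathstart a = y0" "pathfinish a = f y0"
    "deck_class f = homotopy_class X (p \<circ> a)" using deck_path[OF f] .
  obtain b where b: "path b" "path_image b \<subseteq> P" "pathstart b = y0" "pathfinish b = g y0"
    "deck_class g = homotopy_class X (p \<circ> b)" using deck_path[OF g] .
  let ?b = "f \<circ> b"
  have fb: "path ?b" "path_image ?b \<subseteq> P" "pathstart ?b = f y0" "pathfinish ?b = f (g y0)"
  proof -
    show "path ?b" by (rule path_continuous_image[OF b(1) continuous_on_subset[OF deckD(1)[OF f] b(2)]])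
    show "path_image ?b \<subseteq> P" unfolding path_image_compose using b(2) deckD(2)[OF f] by blast
    show "pathstart ?b = f y0" "pathfinish ?b = f (g y0)"
      by (simp_all add: pathstart_compose pathfinish_compose b(3,4))
  qed
  have ab: "path (a +++ ?b)" "path_image (a +++ ?b) \<subseteq> P" "pathstart (a +++ ?b) = y0" "pathfinish (a +++ ?b) = (f \<circ> g) y0"
    using a fb by (auto simp: path_image_join)
  have ends: "pathfinish (p \<circ> a) = pathstart (p \<circ> b)"
    using a b deckD(3)[OF f y0] by (simp add: pathstart_compose pathfinish_compose)
  have "deck_class (f \<circ> g) = homotopy_class X (p \<circ> (a +++ ?b))"
    using deck_class_eq[OF comp_deck[OF f g] ab] .
  also have "\<dots> = homotopy_class X ((p \<circ> a) +++ (p \<circ> b))"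
  proof -
    have "homotopic_paths X (p \<circ> (a +++ ?b)) ((p \<circ> a) +++ (p \<circ> b))"
    proof (rule homotopic_paths_eq[OF path_push[OF ab(1,2)]])
      fix t :: real assume t: "t \<in> {0..1}"
      have "p (f (b s)) = p (b s)" if "s \<in> {0..1}" for s
      proof -
        have "b s \<in> path_image b" using that by (simp add: path_image_def)
        then show ?thesis using deckD(3)[OF f] b(2) by blast
      qed
      then show "(p \<circ> (a +++ ?b)) t = ((p \<circ> a) +++ (p \<circ> b)) t"
        using t by (auto simp: joinpaths_def)
    qed
    then show ?thesis using homotopy_class_eq_iff[OF path_push[OF ab(1,2)]] by blast
  qed
  also have "\<dots> = deck_class f \<otimes>\<^bsub>\<pi>\<^esub> deck_class g"
  proof -
    have pa: "path (p \<circ> a)" "path_image (p \<circ> a) \<subseteq> X" "path (p \<circ> b)" "path_image (p \<circ> b) \<subseteq> X"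
      using path_push a b by auto
    let ?C = "homotopy_class X ((p \<circ> a) +++ (p \<circ> b))"
    have eq: "homotopy_class X (a' +++ b') = ?C" if "a' \<in> deck_class f" "b' \<in> deck_class g" for a' b'
    proof -
      have "homotopic_paths X (p \<circ> a) a'" "homotopic_paths X (p \<circ> b) b'"
        using that unfolding a(5) b(5) homotopy_class_def by blast+
      then have h: "homotopic_paths X ((p \<circ> a) +++ (p \<circ> b)) (a' +++ b')"
        using homotopic_paths_join ends by blast
      have "path ((p \<circ> a) +++ (p \<circ> b))" "path_image ((p \<circ> a) +++ (p \<circ> b)) \<subseteq> X"
        using homotopic_paths_imp_path[OF h] homotopic_paths_imp_subset[OF h] by blast+
      then show ?thesis using homotopy_class_eq_iff h by blast
    qed
    have "p \<circ> a \<in> deck_class f" by (subst a(5)) (rule homotopy_class_self[OF pa(1,2)])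
    moreover have "p \<circ> b \<in> deck_class g" by (subst b(5)) (rule homotopy_class_self[OF pa(3,4)])
    ultimately have ne: "deck_class f \<noteq> {}" "deck_class g \<noteq> {}" by blast+
    have "(\<Union>b'\<in>deck_class g. homotopy_class X (a' +++ b')) = ?C" if "a' \<in> deck_class f" for a'
      by (rule SUP_eq_const[OF ne(2)]) (rule eq[OF that])
    then have "(\<Union>a'\<in>deck_class f. \<Union>b'\<in>deck_class g. homotopy_class X (a' +++ b')) = ?C"
      by (rule SUP_eq_const[OF ne(1)])
    then show ?thesis unfolding fundamental_group_def by simp
  qed
  finally show ?thesis .
qed

lemma deck_class_inj:
  assumes f: "f \<in> deck" and g: "g \<in> deck" and eq: "deck_class f = deck_class g" and z: "z \<in> P"
  shows "f z = g z"
proof -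
  obtain a where a: "path a" "path_image a \<subseteq> P" "pathstart a = y0" "pathfinish a = f y0"
    "deck_class f = homotopy_class X (p \<circ> a)" using deck_path[OF f] .
  obtain b where b: "path b" "path_image b \<subseteq> P" "pathstart b = y0" "pathfinish b = g y0"
    "deck_class g = homotopy_class X (p \<circ> b)" using deck_path[OF g] .
  have "homotopic_paths X (p \<circ> a) (p \<circ> b)"
  proof -
    have "homotopy_class X (p \<circ> a) = homotopy_class X (p \<circ> b)" using a(5) b(5) eq by metis
    then show ?thesis using homotopy_class_eq_iff[OF path_push[OF a(1,2)]] by blast
  qed
  then have "pathfinish a = pathfinish b"
    by (rule covering_monodromy[OF covering _ a(1,2) _ b(1,2)]) (simp_all add: a(3) b(3))
  then have "f y0 = g y0" using a(4) b(4) by simp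
  then show ?thesis using deck_eq f g y0 z by blast
qed

lemma deck_class_surj:
  assumes "c \<in> carrier \<pi>"
  obtains f where "f \<in> deck" "deck_class f = c"
proof -
  obtain g where g: "path g" "path_image g \<subseteq> X" "pathstart g = p y0" "pathfinish g = p y0" "c = homotopy_class X g"
    using assms by (auto simp: fundamental_group_def)
  obtain q where q: "path q" "path_image q \<subseteq> P" "pathstart q = y0" "\<And>t. t \<in> {0..1} \<Longrightarrow> p (q t) = g t"
    using covering_lift_path[OF covering g(1,2) y0] g(3) by metis
  have "pathfinish q \<in> P" "p y0 = p (pathfinish q)"
    using q g(4) by (auto simp: pathfinish_def path_image_def)
  then obtain f where f: "f \<in> deck" "f y0 = pathfinish q" using deck_exists[OF y0] by metis
  have "homotopic_paths X (p \<circ> q) g"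
    using homotopic_paths_eq[OF path_push[OF q(1,2)], of g] q(4) by simp
  then have "deck_class f = c"
    using deck_class_eq[OF f(1) q(1-3)] f(2) homotopy_class_eq_iff[OF path_push[OF q(1,2)]] g(5) by simp
  then show ?thesis using that f by blast
qed

lemma deck_class_id: "deck_class id = \<one>\<^bsub>\<pi>\<^esub>"
proof -
  have "deck_class id = homotopy_class X (p \<circ> (\<lambda>_. y0))"
    by (rule deck_class_eq[OF id_deck(1)]) (use y0 in \<open>auto simp: path_def path_image_def pathstart_def pathfinish_def\<close>)
  then show ?thesis by (simp add: fundamental_group_def comp_def)
qed

end

section \<open>Local isometries of class $C^1$\<close>

text \<open>With a left inverse \<open>L\<close> of \<open>A\<close>, the expansions of
  \<open>\<sigma>\<close> and \<open>g\<close> express the increment of \<open>\<tau>\<close> as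
  \<open>L (B (y - y0))\<close> up to errors. One error is relative to the increment itself;
  absorbing it as at most one half yields a Lipschitz bound, which is then inserted again.\<close>

lemma has_derivative_left_factor:
  fixes \<tau> :: "'a::real_normed_vector \<Rightarrow> 'b::euclidean_space" and \<sigma> :: "'b \<Rightarrow> 'c::euclidean_space"
  assumes \<sigma>: "(\<sigma> has_derivative A) (at (\<tau> y0))" and inj: "inj A"
    and g: "(g has_derivative B) (at y0)"
    and cont: "isCont \<tau> y0" and eq: "\<forall>\<^sub>F y in nhds y0. \<sigma> (\<tau> y) = g y"
  obtains D where "(\<tau> has_derivative D) (at y0)" "\<And>v. A (D v) = B v"
proof -
  have linA: "linear A" using \<sigma> has_derivative_linear by blast
  obtain L where L: "linear L" "L \<circ> A = id" using linear_injective_left_inverse[OF linA inj] by blast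
  have bL: "bounded_linear L" using L linear_conv_bounded_linear by blast
  have bB: "bounded_linear B" using g has_derivative_bounded_linear by blast
  obtain C where C: "C > 0" "\<And>x. norm (L x) \<le> norm x * C"
    using bounded_linear.pos_bounded[OF bL] by blast
  obtain K where K: "K > 0" "\<And>x. norm (B x) \<le> norm x * K"
    using bounded_linear.pos_bounded[OF bB] by blast
  have LA: "L (A x) = x" for x using L(2) by (metis comp_apply id_apply)
  let ?D = "L \<circ> B"
  have g0: "\<sigma> (\<tau> y0) = g y0" using eq eventually_nhds_x_imp_x by blast
  have key: "\<exists>d>0. \<forall>y. norm (y - y0) < d \<longrightarrow> norm (\<tau> y - \<tau> y0 - ?D (y - y0)) \<le> e * norm (y - y0)"
    if e: "e > 0" for e
  proof -
    \<comment> \<open>The entries \<open>1 / (2 * C)\<close> and \<open>1\<close> of the two minima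
      serve the absorption and the Lipschitz constant \<open>2 * C * (K + 1)\<close>; the other
      entries make each error at most \<open>e / 2\<close> times the norm of
      \<open>y - y0\<close>.\<close>
    define e1 where "e1 = min (1 / (2 * C)) (e / (4 * C * C * (K + 1)))"
    define e2 where "e2 = min 1 (e / (2 * C))"
    have pos: "e1 > 0" "e2 > 0" using e C K by (auto simp: e1_def e2_def)
    obtain d1 where d1: "d1 > 0" "\<And>z. norm (z - \<tau> y0) < d1 \<Longrightarrow>
        norm (\<sigma> z - \<sigma> (\<tau> y0) - A (z - \<tau> y0)) \<le> e1 * norm (z - \<tau> y0)"
      using \<sigma> pos unfolding has_derivative_at_alt by blast
    obtain d2 where d2: "d2 > 0" "\<And>y. norm (y - y0) < d2 \<Longrightarrow>
        norm (g y - g y0 - B (y - y0)) \<le> e2 * norm (y - y0)"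
      using g pos unfolding has_derivative_at_alt by blast
    obtain d3 where d3: "d3 > 0" "\<And>y. dist y y0 < d3 \<Longrightarrow> dist (\<tau> y) (\<tau> y0) < d1"
      using cont d1(1) unfolding continuous_at_eps_delta by blast
    obtain d4 where d4: "d4 > 0" "\<And>y. dist y y0 < d4 \<Longrightarrow> \<sigma> (\<tau> y) = g y"
      using eq unfolding eventually_nhds_metric by blast
    show ?thesis
    proof (intro exI[of _ "min d2 (min d3 d4)"] conjI allI impI)
      fix y assume y: "norm (y - y0) < min d2 (min d3 d4)"
      define u where "u = \<tau> y - \<tau> y0"
      define r where "r = \<sigma> (\<tau> y) - \<sigma> (\<tau> y0) - A u"
      define s where "s = g y - g y0 - B (y - y0)"
      have r: "norm r \<le> e1 * norm u" using d1(2)[of "\<tau> y"] d3(2)[of y] y by (simp add: r_def u_def dist_norm)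
      have s: "norm s \<le> e2 * norm (y - y0)" using d2(2)[of y] y by (simp add: s_def)
      have gy: "A u = B (y - y0) + s - r" using d4(2)[of y] y g0 by (simp add: r_def s_def dist_norm)
      then have u: "u = L (B (y - y0)) + L s - L r"
        using LA[of u] linear_add[OF L(1)] linear_diff[OF L(1)] by metis
      have LC: "norm (L x) \<le> C * b" if "norm x \<le> b" for x b
        using order_trans[OF C(2)[of x] mult_right_mono[OF that, of C]] C(1) by (simp add: mult.commute)
      have Lr: "norm (L r) \<le> C * e1 * norm u" using LC[OF r] by (simp add: mult.assoc)
      have Ls: "norm (L s) \<le> C * e2 * norm (y - y0)" using LC[OF s] by (simp add: mult.assoc)
      have "norm (B (y - y0)) \<le> K * norm (y - y0)" using K(2)[of "y - y0"] by (simp add: mult.commute)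
      then have LB: "norm (L (B (y - y0))) \<le> C * K * norm (y - y0)" using LC by (simp add: mult.assoc)
      have "C * e1 \<le> 1 / 2" using C(1) by (simp add: e1_def field_simps min_def)
      then have Lr': "norm (L r) \<le> norm u / 2"
        using Lr mult_right_mono[of "C * e1" "1/2" "norm u"] by simp
      have "C * e2 \<le> C" using C(1) by (simp add: e2_def)
      then have Ls': "norm (L s) \<le> C * norm (y - y0)"
        using Ls mult_right_mono[of "C * e2" C "norm (y - y0)"] by simp
      have "norm u \<le> norm (L (B (y - y0))) + norm (L s) + norm (L r)"
        using u norm_triangle_ineq4[of "L (B (y - y0)) + L s" "L r"]
          norm_triangle_ineq[of "L (B (y - y0))" "L s"] by simp
      then have nu: "norm u \<le> 2 * C * (K + 1) * norm (y - y0)"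
        using Lr' Ls' LB by (simp add: algebra_simps)
      have "u - L (B (y - y0)) = L s - L r" by (subst u) simp
      then have "norm (u - L (B (y - y0))) \<le> norm (L s) + norm (L r)"
        using norm_triangle_ineq4[of "L s" "L r"] by simp
      also have "norm (L r) \<le> C * e1 * (2 * C * (K + 1) * norm (y - y0))"
        by (rule order_trans[OF Lr mult_left_mono[OF nu]]) (use pos C(1) in simp)
      also have "C * e1 * (2 * C * (K + 1) * norm (y - y0)) \<le> e / 2 * norm (y - y0)"
      proof -
        have "e1 \<le> e / (4 * C * C * (K + 1))" "0 < 4 * C * C * (K + 1)" using C(1) K(1) by (simp_all add: e1_def)
        then have "e1 * (4 * C * C * (K + 1)) \<le> e" by (simp only: pos_le_divide_eq)
        then have "C * e1 * (2 * C * (K + 1)) \<le> e / 2" by (simp add: algebra_simps)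
        then show ?thesis using mult_right_mono[of "C * e1 * (2 * C * (K + 1))" "e / 2" "norm (y - y0)"]
          by (simp add: algebra_simps)
      qed
      also have "norm (L s) \<le> e / 2 * norm (y - y0)"
      proof -
        have "C * e2 \<le> e / 2" using C(1) by (simp add: e2_def min_def field_simps)
        then show ?thesis using Ls mult_right_mono[of "C * e2" "e / 2" "norm (y - y0)"] by simp
      qed
      finally show "norm (\<tau> y - \<tau> y0 - ?D (y - y0)) \<le> e * norm (y - y0)"
        by (simp add: u_def)
    qed (use d2 d3 d4 in auto)
  qed
  have der: "(\<tau> has_derivative ?D) (at y0)"
    unfolding has_derivative_at_alt using key bounded_linear_compose[OF bL bB] by (simp add: comp_def)
  have "((\<lambda>y. \<sigma> (\<tau> y)) has_derivative (\<lambda>v. A (?D v))) (at y0)"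
    using has_derivative_compose[OF der \<sigma>] .
  then have "(g has_derivative (\<lambda>v. A (?D v))) (at y0)"
    using has_derivative_transform_eventually[of _ _ y0 UNIV g] eq g0
    by (simp add: eventually_nhds_conv_at)
  then have "(\<lambda>v. A (?D v)) = B" using g has_derivative_unique by blast
  then show ?thesis using that[OF der] by (metis)
qed

lemma continuous_on_det:
  fixes A :: "'a::topological_space \<Rightarrow> real^'n^'n"
  assumes "\<And>i j. continuous_on S (\<lambda>x. A x $ i $ j)"
  shows "continuous_on S (\<lambda>x. det (A x))"
  unfolding det_def by (intro continuous_intros assms)

text \<open>By Cramer's rule the solution is a quotient of determinants with continuous
  entries.\<close>

lemma continuous_on_linear_solution:
  fixes A :: "'a::topological_space \<Rightarrow> real^'n \<Rightarrow> real^'n"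
  assumes lin: "\<And>x. x \<in> S \<Longrightarrow> linear (A x)" and inj: "\<And>x. x \<in> S \<Longrightarrow> inj (A x)"
    and cont: "\<And>v. continuous_on S (\<lambda>x. A x v)" "continuous_on S b"
    and sol: "\<And>x. x \<in> S \<Longrightarrow> A x (s x) = b x"
  shows "continuous_on S s"
proof -
  let ?M = "\<lambda>x. matrix (A x)"
  have ent: "continuous_on S (\<lambda>x. ?M x $ i $ j)" for i j
    unfolding matrix_def by (simp add: continuous_on_component[OF cont(1)])
  have det: "det (?M x) \<noteq> 0" if "x \<in> S" for x
    using det_nz_iff_inj[OF lin[OF that]] inj[OF that] by blast
  let ?N = "\<lambda>x k. \<chi> i j. if j = k then b x $ i else ?M x $ i $ j"
  have "s x = (\<chi> k. det (?N x k) / det (?M x))" if "x \<in> S" for x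
    using cramer[OF det[OF that], of "s x" "b x"] sol[OF that] matrix_works[of "A x" "s x"] lin[OF that]
    by (simp add: matrix_vector_mul)
  moreover have "continuous_on S (\<lambda>x. \<chi> k. det (?N x k) / det (?M x))"
  proof (intro continuous_on_vec_lambda continuous_on_divide continuous_on_det)
    fix k i j
    show "continuous_on S (\<lambda>x. ?N x k $ i $ j)"
      using ent continuous_on_component[OF cont(2)] by (cases "j = k") simp_all
  qed (use ent det in auto)
  ultimately show ?thesis by (simp cong: continuous_on_cong)
qed

abbreviation chart_inv :: "('a, 'n) chart \<Rightarrow> real^'n \<Rightarrow> 'a" where
  "chart_inv c \<equiv> inv_into (fst c) (snd c)"

lemma smooth_onD:
  assumes "smooth_on S f"
  shows "continuous_on S f" "x \<in> S \<Longrightarrow> (f has_derivative frechet_derivative f (at x)) (at x)"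
    "continuous_on S (\<lambda>x. frechet_derivative f (at x) v)"
proof -
  have "Ck_on 0 S f" "Ck_on 1 S f" using assms unfolding smooth_on_def by blast+
  then show "continuous_on S f" "x \<in> S \<Longrightarrow> (f has_derivative frechet_derivative f (at x)) (at x)"
    "continuous_on S (\<lambda>x. frechet_derivative f (at x) v)"
    by (auto simp: frechet_derivative_works[symmetric])
qed

section \<open>Charts and isometries in coordinates\<close>

locale riemannian_mfd =
  fixes M :: "('a::{t2_space, second_countable_topology}, 'n::finite) riemannian"
  assumes manifold: "riemannian_manifold M"
begin

lemma chart:
  assumes "c \<in> charts M"
  shows "openin (top_of_set (points M)) (fst c)" "fst c \<subseteq> points M" "open (snd c ` fst c)" "inj_on (snd c) (fst c)"
    "continuous_on (fst c) (snd c)" "continuous_on (snd c ` fst c) (chart_inv c)"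
proof -
  obtain \<psi> where h: "openin (top_of_set (points M)) (fst c)" "open (snd c ` fst c)"
    "homeomorphism (fst c) (snd c ` fst c) (snd c) \<psi>"
    using manifold assms by (auto simp: riemannian_manifold_def is_chart_def)
  have inj: "inj_on (snd c) (fst c)" using h(3) by (meson homeomorphism_def inj_on_inverseI)
  have "chart_inv c y = \<psi> y" if "y \<in> snd c ` fst c" for y
    using that h(3) inj by (auto simp: homeomorphism_def)
  moreover have "continuous_on (snd c ` fst c) \<psi>" using h(3) by (simp add: homeomorphism_def)
  ultimately show "continuous_on (snd c ` fst c) (chart_inv c)" by (simp cong: continuous_on_cong)
  show "openin (top_of_set (points M)) (fst c)" "open (snd c ` fst c)" "inj_on (snd c) (fst c)"
    "continuous_on (fst c) (snd c)" using h inj by (auto simp: homeomorphism_def)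
  then show "fst c \<subseteq> points M" by (simp add: openin_imp_subset)
qed

lemma chart_inv_left [simp]: "c \<in> charts M \<Longrightarrow> x \<in> fst c \<Longrightarrow> chart_inv c (snd c x) = x"
  using chart(4) by simp

lemma chart_inv_in: "c \<in> charts M \<Longrightarrow> y \<in> snd c ` fst c \<Longrightarrow> chart_inv c y \<in> fst c"
  by (rule inv_into_into)

lemma chart_inv_right: "c \<in> charts M \<Longrightarrow> y \<in> snd c ` fst c \<Longrightarrow> snd c (chart_inv c y) = y"
  by (rule f_inv_into_f)

lemma chart_exists: "x \<in> points M \<Longrightarrow> \<exists>c\<in>charts M. x \<in> fst c"
  using manifold by (auto simp: riemannian_manifold_def)

lemma open_chart_image:
  assumes c: "c \<in> charts M" and W: "openin (top_of_set (points M)) W" "W \<subseteq> fst c"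
  shows "open (snd c ` W)"
proof -
  have "openin (top_of_set (fst c)) W"
    using W chart(2)[OF c] by (meson openin_subset_trans)
  moreover have "chart_inv c ` snd c ` fst c \<subseteq> fst c" using c by auto
  ultimately have "openin (top_of_set (snd c ` fst c)) (snd c ` fst c \<inter> chart_inv c -` W)"
    using continuous_openin_preimage[OF chart(6)[OF c], of "fst c" W] by (simp add: image_subset_iff_funcset)
  moreover have "snd c ` fst c \<inter> chart_inv c -` W = snd c ` W"
  proof
    show "snd c ` fst c \<inter> chart_inv c -` W \<subseteq> snd c ` W"
    proof
      fix y assume "y \<in> snd c ` fst c \<inter> chart_inv c -` W"
      then have "chart_inv c y \<in> W" "snd c (chart_inv c y) = y" using chart_inv_right[OF c] by simp_all
      then show "y \<in> snd c ` W" by (metis imageI)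
    qed
    show "snd c ` W \<subseteq> snd c ` fst c \<inter> chart_inv c -` W" using W c by auto
  qed
  ultimately show ?thesis using chart(3)[OF c] by (metis openin_open_trans)
qed

lemma gram:
  assumes "c \<in> charts M"
  shows "continuous_on (snd c ` fst c) (gram M c)"
    "y \<in> snd c ` fst c \<Longrightarrow> v \<noteq> 0 \<Longrightarrow> v \<bullet> (gram M c y *v v) > 0"
  using manifold assms smooth_onD(1)[of "snd c ` fst c" "gram M c"] unfolding riemannian_manifold_def by blast+

end

definition transition :: "('a, 'n) chart \<Rightarrow> ('b, 'n) chart \<Rightarrow> ('a \<Rightarrow> 'b) \<Rightarrow> real^'n \<Rightarrow> real^'n" where
  "transition c c' f = snd c' \<circ> f \<circ> chart_inv c"

text \<open>
  Class \<open>C\<^sup>1\<close> suffices for the invariance of lengths and volumes, and it passes to deck transformations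
  without a smooth inverse function theorem.
\<close>

definition C1_isometry ::
    "('a::topological_space, 'n::finite) riemannian \<Rightarrow> ('b::topological_space, 'n) riemannian \<Rightarrow> ('a \<Rightarrow> 'b) \<Rightarrow> bool" where
  "C1_isometry M N f \<longleftrightarrow> continuous_on (points M) f \<and> f ` points M \<subseteq> points N \<and>
     (\<forall>c\<in>charts M. \<forall>c'\<in>charts N. \<exists>D.
        (\<forall>y\<in>snd c ` (fst c \<inter> f -` fst c'). (transition c c' f has_derivative D y) (at y) \<and>
           (\<forall>u v. u \<bullet> (gram M c y *v v) = D y u \<bullet> (gram N c' (transition c c' f y) *v D y v))) \<and>
        (\<forall>v. continuous_on (snd c ` (fst c \<inter> f -` fst c')) (\<lambda>y. D y v)))"

lemma C1_isometryE:
  assumes "C1_isometry M N f" "c \<in> charts M" "c' \<in> charts N"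
  obtains D where "\<And>y. y \<in> snd c ` (fst c \<inter> f -` fst c') \<Longrightarrow> (transition c c' f has_derivative D y) (at y)"
    "\<And>y u v. y \<in> snd c ` (fst c \<inter> f -` fst c') \<Longrightarrow>
      u \<bullet> (gram M c y *v v) = D y u \<bullet> (gram N c' (transition c c' f y) *v D y v)"
    "\<And>v. continuous_on (snd c ` (fst c \<inter> f -` fst c')) (\<lambda>y. D y v)"
proof -
  have "\<exists>D. (\<forall>y\<in>snd c ` (fst c \<inter> f -` fst c'). (transition c c' f has_derivative D y) (at y) \<and>
           (\<forall>u v. u \<bullet> (gram M c y *v v) = D y u \<bullet> (gram N c' (transition c c' f y) *v D y v))) \<and>
        (\<forall>v. continuous_on (snd c ` (fst c \<inter> f -` fst c')) (\<lambda>y. D y v))"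
    using assms(1) bspec[OF bspec[OF _ assms(2)] assms(3)] unfolding C1_isometry_def by auto
  then show ?thesis using that by metis
qed

lemma local_isometry_C1:
  assumes "local_isometry M N f" "continuous_on (points M) f" "f ` points M \<subseteq> points N"
  shows "C1_isometry M N f"
  unfolding C1_isometry_def
proof (intro conjI ballI)
  fix c c' assume "c \<in> charts M" "c' \<in> charts N"
  then have "smooth_on (snd c ` (fst c \<inter> f -` fst c')) (transition c c' f)"
    and "\<And>y u v. y \<in> snd c ` (fst c \<inter> f -` fst c') \<Longrightarrow> u \<bullet> (gram M c y *v v) =
      frechet_derivative (transition c c' f) (at y) u \<bullet>
      (gram N c' (transition c c' f y) *v frechet_derivative (transition c c' f) (at y) v)"
    using assms(1) unfolding local_isometry_def Let_def transition_def by blast+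
  then show "\<exists>D. (\<forall>y\<in>snd c ` (fst c \<inter> f -` fst c'). (transition c c' f has_derivative D y) (at y) \<and>
           (\<forall>u v. u \<bullet> (gram M c y *v v) = D y u \<bullet> (gram N c' (transition c c' f y) *v D y v))) \<and>
        (\<forall>v. continuous_on (snd c ` (fst c \<inter> f -` fst c')) (\<lambda>y. D y v))"
    using smooth_onD(2,3)[of "snd c ` (fst c \<inter> f -` fst c')" "transition c c' f"]
    by (intro exI[of _ "\<lambda>y. frechet_derivative (transition c c' f) (at y)"]) blast
qed (use assms in auto)

lemma (in riemannian_mfd) C1_isometry_id: "C1_isometry M M id"
  using manifold by (intro local_isometry_C1) (auto simp: riemannian_manifold_def)

lemma (in riemannian_mfd) open_transition_domain:
  assumes c: "c \<in> charts M" and f: "continuous_on (points M) f" "f ` points M \<subseteq> points N"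
    and c': "openin (top_of_set (points N)) (fst c')"
  shows "open (snd c ` (fst c \<inter> f -` fst c'))"
proof (rule open_chart_image[OF c])
  have "openin (top_of_set (points M)) (points M \<inter> f -` fst c')"
    using continuous_openin_preimage[OF f(1) _ c'] f(2) by blast
  then have "openin (top_of_set (points M)) (fst c \<inter> (points M \<inter> f -` fst c'))"
    using chart(1)[OF c] by (rule openin_Int[rotated])
  moreover have "fst c \<inter> (points M \<inter> f -` fst c') = fst c \<inter> f -` fst c'" using chart(2)[OF c] by blast
  ultimately show "openin (top_of_set (points M)) (fst c \<inter> f -` fst c')" by simp
qed blast

text \<open>
  In charts, \<open>p \<circ> f = p\<close> becomes \<open>\<sigma> \<circ> \<tau> = g\<close> with \<open>C\<^sup>1\<close> maps \<open>\<sigma>\<close> and \<open>g\<close>; the derivative of \<open>\<sigma>\<close> is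
  injective, so it determines that of \<open>\<tau>\<close>.
\<close>

lemma C1_isometry_lift:
  fixes N :: "('a::{t2_space, second_countable_topology}, 'n::finite) riemannian"
    and M :: "('b::{t2_space, second_countable_topology}, 'n) riemannian"
  assumes M: "riemannian_manifold M" and N: "riemannian_manifold N" and p: "C1_isometry M N p"
    and f: "continuous_on (points M) f" "f ` points M \<subseteq> points M" "\<And>x. x \<in> points M \<Longrightarrow> p (f x) = p x"
  shows "C1_isometry M M f"
  unfolding C1_isometry_def
proof (intro conjI ballI f(1,2))
  interpret M: riemannian_mfd M by unfold_locales fact
  interpret N: riemannian_mfd N by unfold_locales fact
  fix c c' assume c: "c \<in> charts M" and c': "c' \<in> charts M"
  let ?W = "snd c ` (fst c \<inter> f -` fst c')" and ?t = "transition c c' f"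
  let ?D = "\<lambda>y. frechet_derivative ?t (at y)"
  have pc: "continuous_on (points M) p" "p ` points M \<subseteq> points N" using p by (auto simp: C1_isometry_def)
  have oW: "open ?W" by (rule M.open_transition_domain[OF c f(1,2) M.chart(1)[OF c']])
  have tW: "?t y \<in> snd c' ` fst c'" "chart_inv c' (?t y) = f (chart_inv c y)" if "y \<in> ?W" for y
    using that c c' by (auto simp: transition_def)
  have "continuous_on ?W (chart_inv c)" using M.chart(6)[OF c] by (rule continuous_on_subset) blast
  then have "continuous_on ?W (f \<circ> chart_inv c)"
    by (rule continuous_on_compose)
      (rule continuous_on_subset[OF f(1)], use M.chart(2)[OF c] c in auto)
  then have ct: "continuous_on ?W ?t" unfolding transition_def comp_assoc
    by (rule continuous_on_compose) (rule continuous_on_subset[OF M.chart(5)[OF c']], use c in auto)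
  have local: "\<exists>W1. open W1 \<and> y0 \<in> W1 \<and> (\<forall>v. continuous_on W1 (\<lambda>y. ?D y v)) \<and>
      (\<forall>y\<in>W1. (?t has_derivative ?D y) (at y) \<and>
        (\<forall>u v. u \<bullet> (gram M c y *v v) = ?D y u \<bullet> (gram M c' (?t y) *v ?D y v)))"
    if y0: "y0 \<in> ?W" for y0
  proof -
    have "p (chart_inv c y0) \<in> points N"
    proof -
      have "chart_inv c y0 \<in> points M" using y0 M.chart(2)[OF c] c by auto
      then show ?thesis using pc(2) by blast
    qed
    then obtain d where d: "d \<in> charts N" "p (chart_inv c y0) \<in> fst d" using N.chart_exists by blast
    obtain B where B: "\<And>y. y \<in> snd c ` (fst c \<inter> p -` fst d) \<Longrightarrow> (transition c d p has_derivative B y) (at y)"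
      "\<And>y u v. y \<in> snd c ` (fst c \<inter> p -` fst d) \<Longrightarrow>
        u \<bullet> (gram M c y *v v) = B y u \<bullet> (gram N d (transition c d p y) *v B y v)"
      "\<And>v. continuous_on (snd c ` (fst c \<inter> p -` fst d)) (\<lambda>y. B y v)"
      using C1_isometryE[OF p c d(1)] by blast
    obtain A where A: "\<And>y. y \<in> snd c' ` (fst c' \<inter> p -` fst d) \<Longrightarrow> (transition c' d p has_derivative A y) (at y)"
      "\<And>y u v. y \<in> snd c' ` (fst c' \<inter> p -` fst d) \<Longrightarrow>
        u \<bullet> (gram M c' y *v v) = A y u \<bullet> (gram N d (transition c' d p y) *v A y v)"
      "\<And>v. continuous_on (snd c' ` (fst c' \<inter> p -` fst d)) (\<lambda>y. A y v)"
      using C1_isometryE[OF p c' d(1)] by blast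
    define S where "S = snd c' ` (fst c' \<inter> p -` fst d)"
    define W1 where "W1 = ?W \<inter> snd c ` (fst c \<inter> p -` fst d)"
    have oW1: "open W1" unfolding W1_def
      using oW M.open_transition_domain[OF c pc N.chart(1)[OF d(1)]] by blast
    have "y0 \<in> W1" using y0 d(2) c unfolding W1_def by auto
    have S: "?t y \<in> S \<and> transition c' d p (?t y) = transition c d p y" if y: "y \<in> W1" for y
    proof -
      obtain x where x: "x \<in> fst c" "f x \<in> fst c'" "y = snd c x" using y unfolding W1_def by auto
      obtain x' where x': "x' \<in> fst c" "p x' \<in> fst d" "y = snd c x'" using y unfolding W1_def by auto
      have "x' = x" using x x' M.chart(4)[OF c] by (auto dest: inj_onD)
      moreover have "p (f x) = p x" using f(3) x M.chart(2)[OF c] by auto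
      ultimately show ?thesis using x x' c c' by (auto simp: S_def transition_def)
    qed
    have Ainj: "linear (A z) \<and> inj (A z)" if z: "z \<in> S" for z
    proof
      show lin: "linear (A z)" using A(1) z has_derivative_linear unfolding S_def by blast
      have "v = 0" if "A z v = 0" for v
      proof (rule ccontr)
        assume "v \<noteq> 0"
        then have "v \<bullet> (gram M c' z *v v) > 0" using M.gram(2)[OF c'] z unfolding S_def by blast
        then show False using A(2)[of z v v] z that unfolding S_def by simp
      qed
      then show "inj (A z)" using linear_injective_0[OF lin] by blast
    qed
    have D: "(?t has_derivative ?D y) (at y) \<and> (\<forall>v. A (?t y) (?D y v) = B y v)" if y: "y \<in> W1" for y
    proof -
      have "(transition c' d p has_derivative A (?t y)) (at (?t y))" using A(1) S[OF y] unfolding S_def by blast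
      moreover have "inj (A (?t y))" using Ainj S[OF y] by blast
      moreover have "(transition c d p has_derivative B y) (at y)" using B(1) y unfolding W1_def by blast
      moreover have "isCont ?t y" using ct y unfolding W1_def continuous_on_eq_continuous_at[OF oW] by blast
      moreover have "\<forall>\<^sub>F z in nhds y. transition c' d p (?t z) = transition c d p z"
        using S oW1 y unfolding eventually_nhds by blast
      ultimately obtain D' where D': "(?t has_derivative D') (at y)" "\<And>v. A (?t y) (D' v) = B y v"
        using has_derivative_left_factor[of "transition c' d p" "A (?t y)" ?t y "transition c d p" "B y"] by blast
      have "?D y = D'" using frechet_derivative_at[OF D'(1)] by simp
      then show ?thesis using D' by simp
    qed
    have "u \<bullet> (gram M c y *v v) = ?D y u \<bullet> (gram M c' (?t y) *v ?D y v)" if y: "y \<in> W1" for y u v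
      using B(2)[of y u v] A(2)[of "?t y" "?D y u" "?D y v"] S[OF y] D[OF y] y unfolding S_def W1_def by simp
    \<comment> \<open>The derivative of the lift, applied to \<open>v\<close>, solves a linear
      equation whose coefficients and right-hand side vary continuously with the point.\<close>
    moreover have "continuous_on W1 (\<lambda>y. ?D y v)" for v
    proof (rule continuous_on_linear_solution)
      show "linear (A (?t y))" "inj (A (?t y))" "A (?t y) (?D y v) = B y v" if "y \<in> W1" for y
        using S[OF that] Ainj D[OF that] by blast+
      have "continuous_on W1 ?t" by (rule continuous_on_subset[OF ct]) (simp add: W1_def)
      then show "continuous_on W1 (\<lambda>y. A (?t y) w)" for w
        by (rule continuous_on_compose2[OF A(3)]) (use S in \<open>unfold S_def, blast\<close>)
      show "continuous_on W1 (\<lambda>y. B y v)" by (rule continuous_on_subset[OF B(3)]) (simp add: W1_def)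
    qed
    ultimately show ?thesis using oW1 \<open>y0 \<in> W1\<close> D by (intro exI[of _ W1]) blast
  qed
  have "continuous_on ?W (\<lambda>y. ?D y v)" for v
    unfolding continuous_on_eq_continuous_at[OF oW]
  proof
    fix y0 assume "y0 \<in> ?W"
    then obtain W1 where "open W1" "y0 \<in> W1" "continuous_on W1 (\<lambda>y. ?D y v)" using local[of y0] by blast
    then show "isCont (\<lambda>y. ?D y v) y0" using continuous_on_eq_continuous_at by blast
  qed
  moreover have "(?t has_derivative ?D y) (at y) \<and>
      (\<forall>u v. u \<bullet> (gram M c y *v v) = ?D y u \<bullet> (gram M c' (?t y) *v ?D y v))" if "y \<in> ?W" for y
    using local[OF that] by blast
  ultimately show "\<exists>D. (\<forall>y\<in>?W. (?t has_derivative D y) (at y) \<and>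
      (\<forall>u v. u \<bullet> (gram M c y *v v) = D y u \<bullet> (gram M c' (?t y) *v D y v))) \<and>
      (\<forall>v. continuous_on ?W (\<lambda>y. D y v))"
    by (intro exI[of _ ?D]) blast
qed

section \<open>Lengths of curves and the distance\<close>

text \<open>Derivatives are two-sided, so agreement on \<open>{a..b}\<close> transfers them only in
  the interior; the end points join the exceptional set.\<close>

lemma piecewise_C1_cong:
  fixes f g :: "real \<Rightarrow> 'a::real_normed_vector"
  assumes f: "f piecewise_C1_differentiable_on {a..b}" and eq: "\<And>t. t \<in> {a..b} \<Longrightarrow> f t = g t"
  shows "g piecewise_C1_differentiable_on {a..b}"
proof -
  obtain S D where S: "finite S" "continuous_on {a..b} f"
    "\<And>t. t \<in> {a..b} - S \<Longrightarrow> (f has_vector_derivative D t) (at t)" "continuous_on ({a..b} - S) D"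
    using f unfolding piecewise_C1_differentiable_on_def C1_differentiable_on_def by blast
  have "(g has_vector_derivative D t) (at t)" if "t \<in> {a..b} - (S \<union> {a, b})" for t
    by (rule has_vector_derivative_transform_within_open[OF S(3), of t "{a<..<b}"]) (use that eq in auto)
  moreover have "continuous_on ({a..b} - (S \<union> {a, b})) D" by (rule continuous_on_subset[OF S(4)]) auto
  ultimately have "g C1_differentiable_on ({a..b} - (S \<union> {a, b}))" unfolding C1_differentiable_on_def by blast
  moreover have "continuous_on {a..b} g" using continuous_on_eq[OF S(2)] eq by blast
  moreover have "finite (S \<union> {a, b})" using S(1) by simp
  ultimately show ?thesis unfolding piecewise_C1_differentiable_on_def by blast
qed

lemma piecewise_C1_append:
  fixes f :: "real \<Rightarrow> 'a::real_normed_vector"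
  assumes "f piecewise_C1_differentiable_on {a..b}" "f piecewise_C1_differentiable_on {b..c}" "a \<le> b" "b \<le> c"
  shows "f piecewise_C1_differentiable_on {a..c}"
  using piecewise_C1_differentiable_cases[OF assms] by simp

lemma nn_integral_cong_finite:
  fixes f g :: "real \<Rightarrow> ennreal"
  assumes S: "finite S" and eq: "\<And>t. t \<notin> S \<Longrightarrow> f t = g t"
  shows "(\<integral>\<^sup>+t. f t \<partial>lborel) = (\<integral>\<^sup>+t. g t \<partial>lborel)"
proof (rule nn_integral_cong_AE)
  have "AE t in lborel. t \<notin> S" using finite_imp_null_set_lborel[OF S] by (rule AE_not_in)
  then show "AE t in lborel. f t = g t" by eventually_elim (rule eq)
qed

context riemannian_mfd begin

text \<open>Bisection cuts a path into pieces inside single charts; phrased as an induction rule for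
  additive properties, this avoids explicit subdivisions in the lemmas on curves.\<close>

lemma path_chart_induct:
  fixes R :: "real \<Rightarrow> real \<Rightarrow> bool"
  assumes g: "path g" "path_image g \<subseteq> points M" and ab: "0 \<le> a" "a \<le> b" "b \<le> 1"
    and trans: "\<And>a b c. R a b \<Longrightarrow> R b c \<Longrightarrow> 0 \<le> a \<Longrightarrow> a \<le> b \<Longrightarrow> b \<le> c \<Longrightarrow> c \<le> 1 \<Longrightarrow> R a c"
    and local: "\<And>c s t. c \<in> charts M \<Longrightarrow> 0 \<le> s \<Longrightarrow> s \<le> t \<Longrightarrow> t \<le> 1 \<Longrightarrow> g ` {s..t} \<subseteq> fst c \<Longrightarrow> R s t"
  shows "R a b"
proof -
  define Q where "Q s t \<longleftrightarrow> (0 \<le> s \<and> t \<le> 1 \<longrightarrow> R s t)" for s t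
  have "Q a b"
  proof (rule Bolzano[OF ab(2)])
    fix x assume "a \<le> x" "x \<le> b"
    then have x: "x \<in> {0..1}" using ab by auto
    then have "g x \<in> points M" using g by (auto simp: path_image_def)
    then obtain c where c: "c \<in> charts M" "g x \<in> fst c" using chart_exists by blast
    obtain d where d: "d > 0" "\<And>t. t \<in> {0..1} \<Longrightarrow> \<bar>t - x\<bar> < d \<Longrightarrow> g t \<in> fst c"
      using preimage_interval[of g "points M" "fst c" x] g chart(1)[OF c(1)] c(2) x
      by (auto simp: path_def path_image_def)
    have "Q s t" if "s \<le> x" "x \<le> t" "t - s < d" for s t
      unfolding Q_def
    proof
      assume "0 \<le> s \<and> t \<le> 1"
      moreover from this have "g ` {s..t} \<subseteq> fst c" using d(2) that by (auto simp: abs_if)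
      ultimately show "R s t" using local[OF c(1), of s t] that by simp
    qed
    then show "\<exists>d>0. \<forall>s t. s \<le> x \<and> x \<le> t \<and> t - s < d \<longrightarrow> Q s t" using d(1) by blast
  qed (use trans in \<open>auto simp: Q_def\<close>)
  then show ?thesis using ab by (simp add: Q_def)
qed

lemma path_isometry:
  assumes f: "C1_isometry M M f" and g: "path g" "path_image g \<subseteq> points M"
  shows "path (f \<circ> g)" "path_image (f \<circ> g) \<subseteq> points M"
proof -
  have c: "continuous_on (points M) f" "f ` points M \<subseteq> points M" using f unfolding C1_isometry_def by blast+
  show "path (f \<circ> g)" by (rule path_continuous_image[OF g(1) continuous_on_subset[OF c(1) g(2)]])
  show "path_image (f \<circ> g) \<subseteq> points M" unfolding path_image_compose using c(2) g(2) by blast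
qed

lemma piecewise_C1_transition:
  assumes f: "C1_isometry M M f" and c: "c \<in> charts M" and c': "c' \<in> charts M"
    and g: "g ` {a..b} \<subseteq> fst c" "f ` g ` {a..b} \<subseteq> fst c'"
    and d: "(snd c \<circ> g) piecewise_C1_differentiable_on {a..b}"
  shows "(snd c' \<circ> (f \<circ> g)) piecewise_C1_differentiable_on {a..b}"
proof (rule piecewise_C1_cong)
  let ?W = "snd c ` (fst c \<inter> f -` fst c')" and ?t = "transition c c' f"
  obtain D where D: "\<And>y. y \<in> ?W \<Longrightarrow> (?t has_derivative D y) (at y)"
    "\<And>v. continuous_on ?W (\<lambda>y. D y v)"
    using C1_isometryE[OF f c c'] by metis
  obtain S v where S: "finite S" "continuous_on {a..b} (snd c \<circ> g)"
    "\<And>t. t \<in> {a..b} - S \<Longrightarrow> ((snd c \<circ> g) has_vector_derivative v t) (at t)" "continuous_on ({a..b} - S) v"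
    using d unfolding piecewise_C1_differentiable_on_def C1_differentiable_on_def by blast
  have W: "(snd c \<circ> g) t \<in> ?W" if "t \<in> {a..b}" for t
  proof -
    have "g t \<in> fst c" "f (g t) \<in> fst c'" using g that by blast+
    then show ?thesis by auto
  qed
  have "continuous_on ?W ?t"
    using D(1) by (meson continuous_at_imp_continuous_on has_derivative_continuous)
  then have c1: "continuous_on {a..b} (?t \<circ> (snd c \<circ> g))"
    using continuous_on_compose[OF S(2) continuous_on_subset] W by blast
  have c2: "((?t \<circ> (snd c \<circ> g)) has_vector_derivative D ((snd c \<circ> g) t) (v t)) (at t)"
    if "t \<in> {a..b} - S" for t
    using vector_derivative_diff_chain_within[of "snd c \<circ> g" "v t" t UNIV ?t "D ((snd c \<circ> g) t)"]
      S(3)[OF that] D(1)[OF W[of t]] that has_derivative_at_withinI by auto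
  have c3: "continuous_on ({a..b} - S) (\<lambda>t. D ((snd c \<circ> g) t) (v t))"
  proof (rule continuous_on_eq)
    \<comment> \<open>Continuity of the derivative is known for each fixed vector only, so the
      moving vector \<open>v t\<close> is expanded in the standard basis.\<close>
    show "continuous_on ({a..b} - S) (\<lambda>t. \<Sum>k\<in>UNIV. v t $ k *\<^sub>R D ((snd c \<circ> g) t) (axis k 1))"
    proof (intro continuous_on_sum continuous_on_scaleR)
      fix k
      show "continuous_on ({a..b} - S) (\<lambda>t. v t $ k)" using continuous_on_component[OF S(4)] .
      have c2: "continuous_on ({a..b} - S) (snd c \<circ> g)" by (rule continuous_on_subset[OF S(2)]) auto
      show "continuous_on ({a..b} - S) (\<lambda>t. D ((snd c \<circ> g) t) (axis k 1))"
        by (rule continuous_on_compose2[OF D(2) c2]) (use W in blast)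
    qed
    fix t assume t: "t \<in> {a..b} - S"
    have lin: "linear (D ((snd c \<circ> g) t))" using D(1)[OF W[of t]] t has_derivative_linear by blast
    have "v t = (\<Sum>k\<in>UNIV. v t $ k *\<^sub>R axis k 1)"
      using basis_expansion[of "v t"] by (simp add: scalar_mult_eq_scaleR)
    then have "D ((snd c \<circ> g) t) (v t) = D ((snd c \<circ> g) t) (\<Sum>k\<in>UNIV. v t $ k *\<^sub>R axis k 1)" by simp
    also have "\<dots> = (\<Sum>k\<in>UNIV. v t $ k *\<^sub>R D ((snd c \<circ> g) t) (axis k 1))"
      using lin by (simp add: linear_sum linear_cmul)
    finally show "(\<Sum>k\<in>UNIV. v t $ k *\<^sub>R D ((snd c \<circ> g) t) (axis k 1)) = D ((snd c \<circ> g) t) (v t)" by simp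
  qed
  have "(?t \<circ> (snd c \<circ> g)) C1_differentiable_on ({a..b} - S)"
    unfolding C1_differentiable_on_def using c2 c3 by (intro exI[of _ "\<lambda>t. D ((snd c \<circ> g) t) (v t)"]) simp
  then show "(?t \<circ> (snd c \<circ> g)) piecewise_C1_differentiable_on {a..b}"
    unfolding piecewise_C1_differentiable_on_def using c1 S(1) by blast
  show "(?t \<circ> (snd c \<circ> g)) t = (snd c' \<circ> (f \<circ> g)) t" if "t \<in> {a..b}" for t
  proof -
    have "g t \<in> fst c" using g that by blast
    then show ?thesis using c by (simp add: transition_def)
  qed
qed

lemma piecewise_C1_curve_isometry:
  assumes f: "C1_isometry M M f" and g: "piecewise_C1_curve M g"
  shows "piecewise_C1_curve M (f \<circ> g)"
  unfolding piecewise_C1_curve_def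
proof (intro conjI ballI allI impI)
  have pg: "path g" "path_image g \<subseteq> points M" using g by (auto simp: piecewise_C1_curve_def)
  show "path (f \<circ> g)" "path_image (f \<circ> g) \<subseteq> points M" using path_isometry[OF f pg] .
  fix c' a b assume c': "c' \<in> charts M" and ab: "0 \<le> a \<and> a \<le> b \<and> b \<le> 1 \<and> (f \<circ> g) ` {a..b} \<subseteq> fst c'"
  define R where "R s t \<longleftrightarrow> (a \<le> s \<and> t \<le> b \<longrightarrow> (snd c' \<circ> (f \<circ> g)) piecewise_C1_differentiable_on {s..t})" for s t
  have "R a b"
  proof (rule path_chart_induct[OF pg])
    fix r s t assume "R r s" "R s t" "r \<le> s" "s \<le> t"
    then show "R r t" unfolding R_def using piecewise_C1_append[of "snd c' \<circ> (f \<circ> g)" r s t] by linarith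
  next
    fix c s t assume c: "c \<in> charts M" and st: "0 \<le> s" "s \<le> t" "t \<le> 1" "g ` {s..t} \<subseteq> fst c"
    then have d: "(snd c \<circ> g) piecewise_C1_differentiable_on {s..t}" using g by (simp add: piecewise_C1_curve_def)
    show "R s t" unfolding R_def
    proof
      assume "a \<le> s \<and> t \<le> b"
      then have "(f \<circ> g) ` {s..t} \<subseteq> (f \<circ> g) ` {a..b}" by (intro image_mono) auto
      then have "f ` g ` {s..t} \<subseteq> fst c'" using ab by (metis image_comp subset_trans)
      then show "(snd c' \<circ> (f \<circ> g)) piecewise_C1_differentiable_on {s..t}"
        using piecewise_C1_transition[OF f c c' st(4) _ d] by blast
    qed
  qed (use ab in auto)
  then show "(snd c' \<circ> (f \<circ> g)) piecewise_C1_differentiable_on {a..b}" by (simp add: R_def)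
qed

lemma piecewise_C1_curve_in_chart:
  assumes c: "c \<in> charts M" and g: "path g" "g ` {0..1} \<subseteq> fst c"
    and d: "(snd c \<circ> g) piecewise_C1_differentiable_on {0..1}"
  shows "piecewise_C1_curve M g"
  unfolding piecewise_C1_curve_def
proof (intro conjI ballI allI impI)
  show "path_image g \<subseteq> points M" using g chart(2)[OF c] by (auto simp: path_image_def)
  fix c' a b assume c': "c' \<in> charts M" and ab: "0 \<le> a \<and> a \<le> b \<and> b \<le> 1 \<and> g ` {a..b} \<subseteq> fst c'"
  have "(snd c \<circ> g) piecewise_C1_differentiable_on {a..b}" "g ` {a..b} \<subseteq> fst c"
    using piecewise_C1_differentiable_on_subset[OF d, of "{a..b}"] g(2) ab by auto
  then have "(snd c' \<circ> (id \<circ> g)) piecewise_C1_differentiable_on {a..b}"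
    using piecewise_C1_transition[OF C1_isometry_id c c'] ab by simp
  then show "(snd c' \<circ> g) piecewise_C1_differentiable_on {a..b}" by simp
qed fact

lemma isometry_vector_derivative:
  assumes f: "C1_isometry M M f" and c: "c \<in> charts M" and c': "c' \<in> charts M"
    and g: "path g" "path_image g \<subseteq> points M" and t: "t \<in> {0<..<1}" "g t \<in> fst c" "f (g t) \<in> fst c'"
    and d: "((snd c \<circ> g) has_vector_derivative v) (at t)"
  obtains v' where "((snd c' \<circ> (f \<circ> g)) has_vector_derivative v') (at t)"
    "v' \<bullet> (gram M c' (snd c' (f (g t))) *v v') = v \<bullet> (gram M c (snd c (g t)) *v v)"
proof -
  let ?t = "transition c c' f" and ?y = "(snd c \<circ> g) t"
  obtain D where D: "\<And>y. y \<in> snd c ` (fst c \<inter> f -` fst c') \<Longrightarrow> (?t has_derivative D y) (at y)"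
    "\<And>y u v. y \<in> snd c ` (fst c \<inter> f -` fst c') \<Longrightarrow>
      u \<bullet> (gram M c y *v v) = D y u \<bullet> (gram M c' (?t y) *v D y v)"
    using C1_isometryE[OF f c c'] by metis
  have y: "?y \<in> snd c ` (fst c \<inter> f -` fst c')" using t by auto
  have "((?t \<circ> (snd c \<circ> g)) has_vector_derivative D ?y v) (at t)"
    using vector_derivative_diff_chain_within[of "snd c \<circ> g" v t UNIV ?t "D ?y"] d D(1)[OF y]
      has_derivative_at_withinI by auto
  moreover have t': "t \<in> {0..1}" using t by auto
  obtain e where e: "e > 0" "\<And>s. s \<in> {0..1} \<Longrightarrow> \<bar>s - t\<bar> < e \<Longrightarrow> g s \<in> fst c"
    using preimage_interval[of g "points M" "fst c" t] g chart(1)[OF c] t(2) t'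
    by (auto simp: path_def path_image_def)
  let ?S = "{0<..<1} \<inter> {t - e <..< t + e}"
  have "open ?S" "t \<in> ?S" using e(1) t(1) by auto
  moreover have "(?t \<circ> (snd c \<circ> g)) s = (snd c' \<circ> (f \<circ> g)) s" if "s \<in> ?S" for s
  proof -
    have "g s \<in> fst c" using e(2)[of s] that by (auto simp: abs_if)
    then show ?thesis using c by (simp add: transition_def)
  qed
  ultimately have "((snd c' \<circ> (f \<circ> g)) has_vector_derivative D ?y v) (at t)"
    using has_vector_derivative_transform_within_open by blast
  moreover have "?t ?y = snd c' (f (g t))" using t(2) c by (simp add: transition_def)
  ultimately show ?thesis using that[of "D ?y v"] D(2)[OF y, of v v] by simp
qed

text \<open>The chart inside \<open>speed\<close> is an arbitrary choice; the identity, read as an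
  isometry between that chart and \<open>c\<close>, converts one expression into the other.\<close>

lemma speed_eq:
  assumes c: "c \<in> charts M" and g: "path g" "path_image g \<subseteq> points M" and t: "t \<in> {0<..<1}" "g t \<in> fst c"
    and d: "((snd c \<circ> g) has_vector_derivative v) (at t)"
  shows "speed M g t = sqrt (v \<bullet> (gram M c (snd c (g t)) *v v))"
proof -
  let ?c = "SOME c. c \<in> charts M \<and> g t \<in> fst c"
  have c': "?c \<in> charts M \<and> g t \<in> fst ?c" by (rule someI[of _ c]) (use c t in simp)
  obtain v' where v': "((snd ?c \<circ> (id \<circ> g)) has_vector_derivative v') (at t)"
    "v' \<bullet> (gram M ?c (snd ?c (id (g t))) *v v') = v \<bullet> (gram M c (snd c (g t)) *v v)"
    using isometry_vector_derivative[OF C1_isometry_id c _ g t _ d, of ?c] c' by auto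
  have "vector_derivative (snd ?c \<circ> g) (at t) = v'" using v'(1) by (simp add: vector_derivative_at)
  then show ?thesis using v'(2) by (simp add: speed_def)
qed

text \<open>The end points are excluded because two-sided derivatives there would depend on values
  of \<open>g\<close> outside the unit interval.\<close>

definition regular_at :: "(real \<Rightarrow> 'a) \<Rightarrow> real \<Rightarrow> bool" where
  "regular_at g t \<longleftrightarrow> t \<in> {0<..<1} \<and> (\<exists>c\<in>charts M. \<exists>v. g t \<in> fst c \<and> ((snd c \<circ> g) has_vector_derivative v) (at t))"

lemma curve_regular:
  assumes g: "piecewise_C1_curve M g"
  obtains S where "finite S" "\<And>t. t \<in> {0..1} - S \<Longrightarrow> regular_at g t"
proof -
  have pg: "path g" "path_image g \<subseteq> points M" using g by (auto simp: piecewise_C1_curve_def)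
  define R where "R a b \<longleftrightarrow> (\<exists>S. finite S \<and> (\<forall>t\<in>{a..b} - S. regular_at g t))" for a b
  have "R 0 1"
  proof (rule path_chart_induct[OF pg])
    fix a b c assume "R a b" "R b c"
    then obtain S S' where S: "finite S" "\<forall>t\<in>{a..b} - S. regular_at g t" "finite S'" "\<forall>t\<in>{b..c} - S'. regular_at g t"
      unfolding R_def by blast
    then have "\<forall>t\<in>{a..c} - (S \<union> S'). regular_at g t" by (metis Diff_iff UnI1 UnI2 atLeastAtMost_iff linear)
    then show "R a c" unfolding R_def using S by (meson finite_UnI)
  next
    fix c s t assume c: "c \<in> charts M" and st: "0 \<le> s" "s \<le> t" "t \<le> 1" "g ` {s..t} \<subseteq> fst c"
    then have "(snd c \<circ> g) piecewise_C1_differentiable_on {s..t}" using g by (simp add: piecewise_C1_curve_def)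
    then obtain S v where S: "finite S" "\<And>r. r \<in> {s..t} - S \<Longrightarrow> ((snd c \<circ> g) has_vector_derivative v r) (at r)"
      unfolding piecewise_C1_differentiable_on_def C1_differentiable_on_def by blast
    have "regular_at g r" if "r \<in> {s..t} - (S \<union> {0, 1})" for r
      unfolding regular_at_def using S(2)[of r] c st that by (intro conjI bexI[of _ c] exI[of _ "v r"]) auto
    then show "R s t" unfolding R_def using S(1) by (intro exI[of _ "S \<union> {0, 1}"]) auto
  qed auto
  then show ?thesis using that unfolding R_def by blast
qed

lemma speed_isometry:
  assumes f: "C1_isometry M M f" and g: "path g" "path_image g \<subseteq> points M" and t: "regular_at g t"
  shows "speed M (f \<circ> g) t = speed M g t"
proof -
  obtain c v where c: "t \<in> {0<..<1}" "c \<in> charts M" "g t \<in> fst c" "((snd c \<circ> g) has_vector_derivative v) (at t)"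
    using t unfolding regular_at_def by blast
  have "g t \<in> points M" using c chart(2) by blast
  then have "f (g t) \<in> points M" using f by (auto simp: C1_isometry_def)
  then obtain c' where c': "c' \<in> charts M" "f (g t) \<in> fst c'" using chart_exists by blast
  obtain v' where v': "((snd c' \<circ> (f \<circ> g)) has_vector_derivative v') (at t)"
    "v' \<bullet> (gram M c' (snd c' (f (g t))) *v v') = v \<bullet> (gram M c (snd c (g t)) *v v)"
    using isometry_vector_derivative[OF f c(2) c'(1) g c(1,3) c'(2) c(4)] .
  show ?thesis
    using speed_eq[OF c'(1) path_isometry[OF f g] c(1) _ v'(1)] speed_eq[OF c(2) g c(1,3,4)] c' v'(2) by simp
qed

lemma speed_affine:
  assumes g: "path g" "path_image g \<subseteq> points M" and g': "path g'" "path_image g' \<subseteq> points M"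
    and t: "t \<in> {0<..<1}" "regular_at g (m * t + k)"
    and eq: "open S" "t \<in> S" "\<And>s. s \<in> S \<Longrightarrow> g' s = g (m * s + k)"
  shows "speed M g' t = \<bar>m\<bar> * speed M g (m * t + k)"
proof -
  let ?u = "m * t + k"
  obtain c v where c: "?u \<in> {0<..<1}" "c \<in> charts M" "g ?u \<in> fst c" "((snd c \<circ> g) has_vector_derivative v) (at ?u)"
    using t unfolding regular_at_def by blast
  have "((\<lambda>s. m * s + k) has_vector_derivative m) (at t)"
    by (auto intro!: derivative_eq_intros)
  then have "(((snd c \<circ> g) \<circ> (\<lambda>s. m * s + k)) has_vector_derivative m *\<^sub>R v) (at t)"
    using vector_diff_chain_at c(4) by blast
  then have "((snd c \<circ> g') has_vector_derivative m *\<^sub>R v) (at t)"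
    by (rule has_vector_derivative_transform_within_open[OF _ eq(1,2)]) (simp add: eq(3))
  moreover have gt: "g' t = g ?u" using eq by simp
  ultimately have "speed M g' t = sqrt (m\<^sup>2 * (v \<bullet> (gram M c (snd c (g ?u)) *v v)))"
    using speed_eq[OF c(2) g' t(1), of "m *\<^sub>R v"] c(3)
    by (simp add: matrix_vector_mult_scaleR power2_eq_square algebra_simps)
  then show ?thesis using speed_eq[OF c(2) g c(1,3,4)] by (simp add: real_sqrt_mult)
qed

lemma speed_measurable:
  assumes g: "piecewise_C1_curve M g"
  shows "(\<lambda>t. ennreal (speed M g t) * indicator {0..1} t) \<in> borel_measurable borel"
proof -
  have pg: "path g" "path_image g \<subseteq> points M" using g by (auto simp: piecewise_C1_curve_def)
  define R where "R a b \<longleftrightarrow> (\<lambda>t. ennreal (speed M g t) * indicator {a..b} t) \<in> borel_measurable borel" for a b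
  have "R 0 1"
  proof (rule path_chart_induct[OF pg])
    fix a b c assume ab: "R a b" "R b c" "a \<le> b" "b \<le> c"
    then have m: "(\<lambda>t. ennreal (speed M g t) * indicator {a..b} t + ennreal (speed M g t) * indicator {b..c} t)
        \<in> borel_measurable borel"
      unfolding R_def by measurable
    \<comment> \<open>The sum counts the common end point \<open>b\<close> twice, a change at one
      point only.\<close>
    show "R a c" unfolding R_def
      by (rule measurable_discrete_difference[OF m, of "{b}"]) (use ab in \<open>auto simp: indicator_def\<close>)
  next
    fix c s t assume c: "c \<in> charts M" and st: "0 \<le> s" "s \<le> t" "t \<le> 1" "g ` {s..t} \<subseteq> fst c"
    then have "(snd c \<circ> g) piecewise_C1_differentiable_on {s..t}" using g by (simp add: piecewise_C1_curve_def)
    then obtain S v where S: "finite S" "continuous_on {s..t} (snd c \<circ> g)"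
      "\<And>r. r \<in> {s..t} - S \<Longrightarrow> ((snd c \<circ> g) has_vector_derivative v r) (at r)" "continuous_on ({s..t} - S) v"
      unfolding piecewise_C1_differentiable_on_def C1_differentiable_on_def by blast
    let ?A = "{s..t} - (S \<union> {0, 1})"
    let ?F = "\<lambda>r. sqrt (v r \<bullet> (gram M c ((snd c \<circ> g) r) *v v r))"
    have cg: "continuous_on ?A (\<lambda>r. gram M c ((snd c \<circ> g) r))"
    proof (rule continuous_on_compose2[OF gram(1)[OF c]])
      show "continuous_on ?A (snd c \<circ> g)" by (rule continuous_on_subset[OF S(2)]) auto
    qed (use st in auto)
    have cv: "continuous_on ?A v" by (rule continuous_on_subset[OF S(4)]) auto
    have "continuous_on ?A ?F"
      unfolding inner_vec_def matrix_vector_mult_def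
      using cg cv by (auto intro!: continuous_intros)
    moreover have "?A \<in> sets borel"
    proof -
      have "closed {s..t}" "closed (S \<union> {0, 1})" using S(1) by (simp_all add: finite_imp_closed)
      then show ?thesis by (intro sets.Diff borel_closed)
    qed
    ultimately have "(\<lambda>r. indicator ?A r *\<^sub>R ?F r) \<in> borel_measurable borel"
      using borel_measurable_continuous_on_indicator by blast
    then have m: "(\<lambda>r. ennreal (indicator ?A r *\<^sub>R ?F r)) \<in> borel_measurable borel" by measurable
    have sp: "speed M g r = ?F r" if "r \<in> ?A" for r
    proof -
      have "g r \<in> fst c" using st(4) that by blast
      then show ?thesis using speed_eq[OF c pg, of r "v r"] S(3)[of r] that st by auto
    qed
    show "R s t" unfolding R_def
    proof (rule measurable_discrete_difference[OF m, of "S \<union> {0, 1}"])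
      fix r assume "r \<notin> S \<union> {0, 1}"
      then show "ennreal (indicator ?A r *\<^sub>R ?F r) = ennreal (speed M g r) * indicator {s..t} r"
        using sp[of r] by (cases "r \<in> {s..t}") auto
    qed (use S(1) in \<open>auto simp: countable_finite\<close>)
  qed auto
  then show ?thesis by (simp add: R_def)
qed

lemma curve_length_isometry:
  assumes f: "C1_isometry M M f" and g: "piecewise_C1_curve M g"
  shows "curve_length M (f \<circ> g) = curve_length M g"
proof -
  have pg: "path g" "path_image g \<subseteq> points M" using g by (auto simp: piecewise_C1_curve_def)
  obtain S where S: "finite S" "\<And>t. t \<in> {0..1} - S \<Longrightarrow> regular_at g t" using curve_regular[OF g] by metis
  show ?thesis unfolding curve_length_def
    by (rule nn_integral_cong_finite[of S])
      (use S speed_isometry[OF f pg] in \<open>auto simp: indicator_def\<close>)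
qed

section \<open>Joining and reversing curves\<close>

lemma piecewise_C1_curve_affine:
  assumes c: "c \<in> charts M" and g: "piecewise_C1_curve M g"
    and ab: "a \<le> b" and r: "\<And>t. t \<in> {a..b} \<Longrightarrow> m * t + k \<in> {0..1}"
    and eq: "\<And>t. t \<in> {a..b} \<Longrightarrow> g' t = g (m * t + k)" and im: "g' ` {a..b} \<subseteq> fst c"
  shows "(snd c \<circ> g') piecewise_C1_differentiable_on {a..b}"
proof (rule piecewise_C1_cong)
  have image: "(\<lambda>x. m * x + k) ` {a..b} = (if m \<ge> 0 then {m * a + k..m * b + k} else {m * b + k..m * a + k})"
    using ab image_affinity_atLeastAtMost[of m k a b] by auto
  then obtain s t where st: "(\<lambda>x. m * x + k) ` {a..b} = {s..t}" "s \<le> t"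
    using ab by (cases "m \<ge> 0") (auto simp: mult_left_mono mult_left_mono_neg)
  have "s \<in> (\<lambda>x. m * x + k) ` {a..b}" "t \<in> (\<lambda>x. m * x + k) ` {a..b}" using st by auto
  then have "0 \<le> s" "t \<le> 1" using r by auto
  moreover have "g ` {s..t} \<subseteq> fst c" unfolding st(1)[symmetric] using im eq by auto
  ultimately have "(snd c \<circ> g) piecewise_C1_differentiable_on ((\<lambda>x. m * x + k) ` {a..b})"
    using g c st by (simp add: piecewise_C1_curve_def)
  then show "((snd c \<circ> g) \<circ> (\<lambda>x. m *\<^sub>R x + k)) piecewise_C1_differentiable_on {a..b}"
    by (rule piecewise_C1_differentiable_affine)
qed (use eq in auto)

lemma curve_join:
  assumes g: "piecewise_C1_curve M g" and h: "piecewise_C1_curve M h" and e: "pathfinish g = pathstart h"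
  shows "piecewise_C1_curve M (g +++ h)" "curve_length M (g +++ h) = curve_length M g + curve_length M h"
proof -
  have pg: "path g" "path_image g \<subseteq> points M" and ph: "path h" "path_image h \<subseteq> points M"
    using g h by (auto simp: piecewise_C1_curve_def)
  have pj: "path (g +++ h)" "path_image (g +++ h) \<subseteq> points M"
    using pg ph e by (auto simp: path_image_join)
  have left: "(g +++ h) t = g (2 * t + 0)" if "t \<le> 1/2" for t using that by (simp add: joinpaths_def)
  have right: "(g +++ h) t = h (2 * t + (-1))" if "1/2 \<le> t" for t
  proof (cases "t = 1/2")
    case True
    show ?thesis unfolding True using e by (simp add: joinpaths_def pathfinish_def pathstart_def)
  qed (use that in \<open>simp add: joinpaths_def\<close>)
  show "piecewise_C1_curve M (g +++ h)"
    unfolding piecewise_C1_curve_def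
  proof (intro conjI ballI allI impI pj)
    fix c a b assume c: "c \<in> charts M" and ab: "0 \<le> a \<and> a \<le> b \<and> b \<le> 1 \<and> (g +++ h) ` {a..b} \<subseteq> fst c"
    have l: "(snd c \<circ> (g +++ h)) piecewise_C1_differentiable_on {s..t}" if "a \<le> s" "s \<le> t" "t \<le> b" "t \<le> 1/2" for s t
    proof -
      have "(g +++ h) ` {s..t} \<subseteq> (g +++ h) ` {a..b}" by (intro image_mono) (use that in auto)
      then show ?thesis
        using piecewise_C1_curve_affine[OF c g that(2), of 2 0 "g +++ h"] that ab left by auto
    qed
    have r: "(snd c \<circ> (g +++ h)) piecewise_C1_differentiable_on {s..t}" if "a \<le> s" "s \<le> t" "t \<le> b" "1/2 \<le> s" for s t
    proof -
      have "(g +++ h) ` {s..t} \<subseteq> (g +++ h) ` {a..b}" by (intro image_mono) (use that in auto)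
      then show ?thesis
        using piecewise_C1_curve_affine[OF c h that(2), of 2 "-1" "g +++ h"] that ab right by auto
    qed
    show "(snd c \<circ> (g +++ h)) piecewise_C1_differentiable_on {a..b}"
    proof -
      consider "b \<le> 1/2" | "1/2 \<le> a" | "a \<le> 1/2" "1/2 \<le> b" by linarith
      then show ?thesis
      proof cases
        case 3
        then show ?thesis using l[of a "1/2"] r[of "1/2" b] piecewise_C1_append[of _ a "1/2" b] by simp
      qed (use l[of a b] r[of a b] ab in auto)
    qed
  qed
  let ?G = "\<lambda>t. ennreal (speed M g t) * indicator {0..1} t" and ?H = "\<lambda>t. ennreal (speed M h t) * indicator {0..1} t"
  obtain S where S: "finite S" "\<And>t. t \<in> {0..1} - S \<Longrightarrow> regular_at g t" using curve_regular[OF g] by metis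
  obtain S' where S': "finite S'" "\<And>t. t \<in> {0..1} - S' \<Longrightarrow> regular_at h t" using curve_regular[OF h] by metis
  \<comment> \<open>Excluded are the rescaled exceptional parameters of both curves, the ends and
    the joint. Elsewhere each half runs at double speed, which the substitution of
    \<open>2 * t\<close> compensates.\<close>
  let ?E = "(\<lambda>t. t / 2) ` S \<union> (\<lambda>t. (t + 1) / 2) ` S' \<union> {0, 1/2, 1}"
  have sp: "ennreal (speed M (g +++ h) t) * indicator {0..1} t = 2 * ?G (0 + 2 * t) + 2 * ?H (-1 + 2 * t)"
    if t: "t \<notin> ?E" for t
  proof -
    have nS: "2 * t \<notin> S" "2 * t - 1 \<notin> S'"
    proof -
      show "2 * t \<notin> S" using t by (metis UnI1 image_eqI nonzero_mult_div_cancel_left zero_neq_numeral)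
      have "t = (2 * t - 1 + 1) / 2" by simp
      then show "2 * t - 1 \<notin> S'" using t by (metis UnI1 UnI2 image_eqI)
    qed
    consider "t < 0" | "t > 1" | "0 < t" "t < 1/2" | "1/2 < t" "t < 1" using t by fastforce
    then show ?thesis
    proof cases
      case 3
      then have "speed M (g +++ h) t = \<bar>2\<bar> * speed M g (2 * t + 0)"
        using left S(2)[of "2 * t"] nS
        by (intro speed_affine[OF pg pj, where S = "{..<1/2}"]) auto
      then show ?thesis using 3 by (simp add: ennreal_mult')
    next
      case 4
      then have "speed M (g +++ h) t = \<bar>2\<bar> * speed M h (2 * t + (-1))"
        using right S'(2)[of "2 * t - 1"] nS
        by (intro speed_affine[OF ph pj, where S = "{1/2<..}"]) auto
      then show ?thesis using 4 by (simp add: ennreal_mult')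
    qed (auto simp: indicator_def)
  qed
  note [measurable] = speed_measurable[OF g] speed_measurable[OF h]
  have "curve_length M (g +++ h) = (\<integral>\<^sup>+t. 2 * ?G (0 + 2 * t) + 2 * ?H (-1 + 2 * t) \<partial>lborel)"
    unfolding curve_length_def
    by (rule nn_integral_cong_finite[of ?E]) (use S(1) S'(1) sp in auto)
  also have "\<dots> = (\<integral>\<^sup>+t. 2 * ?G (0 + 2 * t) \<partial>lborel) + (\<integral>\<^sup>+t. 2 * ?H (-1 + 2 * t) \<partial>lborel)"
    by (rule nn_integral_add; measurable)
  also have "(\<integral>\<^sup>+t. 2 * ?G (0 + 2 * t) \<partial>lborel) = curve_length M g"
    using nn_integral_real_affine[OF speed_measurable[OF g], of 2 0] unfolding curve_length_def
    by (subst nn_integral_cmult; (measurable | simp))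
  also have "(\<integral>\<^sup>+t. 2 * ?H (-1 + 2 * t) \<partial>lborel) = curve_length M h"
    using nn_integral_real_affine[OF speed_measurable[OF h], of 2 "-1"] unfolding curve_length_def
    by (subst nn_integral_cmult; (measurable | simp))
  finally show "curve_length M (g +++ h) = curve_length M g + curve_length M h" .
qed

lemma curve_reverse:
  assumes g: "piecewise_C1_curve M g"
  shows "piecewise_C1_curve M (reversepath g)" "curve_length M (reversepath g) = curve_length M g"
proof -
  have pg: "path g" "path_image g \<subseteq> points M" using g by (auto simp: piecewise_C1_curve_def)
  have pr: "path (reversepath g)" "path_image (reversepath g) \<subseteq> points M" using pg by auto
  show "piecewise_C1_curve M (reversepath g)"
    unfolding piecewise_C1_curve_def
  proof (intro conjI ballI allI impI pr)
    fix c a b assume c: "c \<in> charts M" and ab: "0 \<le> a \<and> a \<le> b \<and> b \<le> 1 \<and> reversepath g ` {a..b} \<subseteq> fst c"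
    then show "(snd c \<circ> reversepath g) piecewise_C1_differentiable_on {a..b}"
      by (intro piecewise_C1_curve_affine[OF c g, of a b "-1" 1]) (auto simp: reversepath_def)
  qed
  let ?G = "\<lambda>t. ennreal (speed M g t) * indicator {0..1} t"
  obtain S where S: "finite S" "\<And>t. t \<in> {0..1} - S \<Longrightarrow> regular_at g t" using curve_regular[OF g] by metis
  let ?E = "(\<lambda>t. 1 - t) ` S \<union> {0, 1}"
  have sp: "ennreal (speed M (reversepath g) t) * indicator {0..1} t = ?G (1 + (-1) * t)"
    if t: "t \<notin> ?E" for t
  proof (cases "t \<in> {0<..<1}")
    case True
    have "t = 1 - (1 - t)" by simp
    then have "1 - t \<notin> S" using t by (metis UnI1 image_eqI)
    then have "speed M (reversepath g) t = \<bar>-1\<bar> * speed M g ((-1) * t + 1)"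
      using S(2)[of "1 - t"] True
      by (intro speed_affine[OF pg pr, where S = UNIV]) (auto simp: reversepath_def)
    then show ?thesis using True by (simp add: indicator_def)
  qed (use t in \<open>auto simp: indicator_def\<close>)
  have "curve_length M (reversepath g) = (\<integral>\<^sup>+t. ?G (1 + (-1) * t) \<partial>lborel)"
    unfolding curve_length_def
    by (rule nn_integral_cong_finite[of ?E]) (use S(1) sp in auto)
  also have "\<dots> = curve_length M g"
    using nn_integral_real_affine[OF speed_measurable[OF g], of "-1" 1] unfolding curve_length_def by simp
  finally show "curve_length M (reversepath g) = curve_length M g" .
qed

section \<open>Distance, small neighbourhoods and balls\<close>

lemma rdist_lessE:
  assumes "rdist M x y < r"
  obtains g where "piecewise_C1_curve M g" "pathstart g = x" "pathfinish g = y" "curve_length M g < r"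
  using assms unfolding rdist_def INF_less_iff by blast

lemma rdist_le: "piecewise_C1_curve M g \<Longrightarrow> rdist M (pathstart g) (pathfinish g) \<le> curve_length M g"
  unfolding rdist_def by (rule INF_lower) simp

text \<open>Strict upper bounds are witnessed by single curves. Stating the metric laws for them
  avoids computing with infima and infinite values, and it is the form in which displacements are
  estimated later.\<close>

lemma rdist_trans_less:
  assumes "rdist M x y < a" "rdist M y z < b"
  shows "rdist M x z < a + b"
proof -
  obtain g where g: "piecewise_C1_curve M g" "pathstart g = x" "pathfinish g = y" "curve_length M g < a"
    using rdist_lessE[OF assms(1)] .
  obtain h where h: "piecewise_C1_curve M h" "pathstart h = y" "pathfinish h = z" "curve_length M h < b"
    using rdist_lessE[OF assms(2)] .
  have "rdist M x z \<le> curve_length M g + curve_length M h"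
    using rdist_le[OF curve_join(1)[OF g(1) h(1)]] curve_join(2)[OF g(1) h(1)] g h by simp
  also have "\<dots> < a + b" using g(4) h(4) by (rule add_strict_mono)
  finally show ?thesis .
qed

lemma rdist_sym_less:
  assumes "rdist M x y < a"
  shows "rdist M y x < a"
proof -
  obtain g where g: "piecewise_C1_curve M g" "pathstart g = x" "pathfinish g = y" "curve_length M g < a"
    using rdist_lessE[OF assms(1)] .
  then show ?thesis using rdist_le[OF curve_reverse(1)[OF g(1)]] curve_reverse(2)[OF g(1)] by simp
qed

lemma rdist_isometry_less:
  assumes f: "C1_isometry M M f" and "rdist M x y < a"
  shows "rdist M (f x) (f y) < a"
proof -
  obtain g where g: "piecewise_C1_curve M g" "pathstart g = x" "pathfinish g = y" "curve_length M g < a"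
    using rdist_lessE[OF assms(2)] .
  then show ?thesis
    using rdist_le[OF piecewise_C1_curve_isometry[OF f g(1)]] curve_length_isometry[OF f g(1)]
    by (simp add: pathstart_compose pathfinish_compose)
qed

lemma gram_bound:
  assumes c: "c \<in> charts M" and K: "compact K" "K \<subseteq> snd c ` fst c"
  obtains C where "C > 0" "\<And>y v. y \<in> K \<Longrightarrow> sqrt (v \<bullet> (gram M c y *v v)) \<le> C * norm v"
proof -
  have "compact (gram M c ` K)"
    using compact_continuous_image[OF continuous_on_subset[OF gram(1)[OF c] K(2)] K(1)] .
  then obtain B where B: "B > 0" "\<forall>A\<in>gram M c ` K. norm A \<le> B"
    using compact_imp_bounded bounded_pos by metis
  have "sqrt (v \<bullet> (gram M c y *v v)) \<le> (sqrt (real CARD('n) * real CARD('n) * B)) * norm v" if y: "y \<in> K" for y v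
  proof -
    have e: "\<bar>gram M c y $ i $ j\<bar> \<le> B" for i j
    proof -
      have "norm (gram M c y) \<le> B" using B(2) y by blast
      then show ?thesis using Finite_Cartesian_Product.norm_nth_le[of "gram M c y" i]
          component_le_norm_cart[of "gram M c y $ i" j] by linarith
    qed
    have "v \<bullet> (gram M c y *v v) = (\<Sum>i\<in>UNIV. \<Sum>j\<in>UNIV. v $ i * (gram M c y $ i $ j * v $ j))"
      by (simp add: inner_vec_def matrix_vector_mult_def sum_distrib_left)
    also have "\<dots> \<le> (\<Sum>i\<in>(UNIV::'n set). \<Sum>j\<in>(UNIV::'n set). norm v * (B * norm v))"
    proof (intro sum_mono)
      fix i j
      have "v $ i * (gram M c y $ i $ j * v $ j) \<le> \<bar>v $ i\<bar> * (\<bar>gram M c y $ i $ j\<bar> * \<bar>v $ j\<bar>)"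
        by (metis abs_ge_self abs_mult)
      also have "\<dots> \<le> norm v * (B * norm v)"
        using e[of i j] component_le_norm_cart[of v i] component_le_norm_cart[of v j] B(1)
        by (intro mult_mono) auto
      finally show "v $ i * (gram M c y $ i $ j * v $ j) \<le> norm v * (B * norm v)" .
    qed
    also have "\<dots> = (real CARD('n) * real CARD('n) * B) * (norm v)\<^sup>2" by (simp add: power2_eq_square)
    finally have "sqrt (v \<bullet> (gram M c y *v v)) \<le> sqrt ((real CARD('n) * real CARD('n) * B) * (norm v)\<^sup>2)"
      by (rule real_sqrt_le_mono)
    then show ?thesis by (simp add: real_sqrt_mult)
  qed
  moreover have "sqrt (real CARD('n) * real CARD('n) * B) > 0" using B(1) by simp
  ultimately show ?thesis using that by blast
qed

text \<open>A straight segment in a chart gives a short curve, because on a compact coordinate ball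
  the metric is bounded by a multiple of the Euclidean one.\<close>

lemma rdist_small:
  assumes x: "x \<in> points M" and e: "e > 0"
  obtains N where "openin (top_of_set (points M)) N" "x \<in> N" "\<And>y. y \<in> N \<Longrightarrow> rdist M x y < ennreal e"
proof -
  obtain c where c: "c \<in> charts M" "x \<in> fst c" using chart_exists[OF x] by blast
  let ?V = "snd c ` fst c" and ?x = "snd c x"
  obtain r where r: "r > 0" "cball ?x r \<subseteq> ?V"
    using chart(3)[OF c(1)] c(2) open_contains_cball by (metis imageI)
  obtain C where C: "C > 0" "\<And>y v. y \<in> cball ?x r \<Longrightarrow> sqrt (v \<bullet> (gram M c y *v v)) \<le> C * norm v"
    using gram_bound[OF c(1) compact_cball r(2)] by blast
  \<comment> \<open>The bound \<open>d \<le> r\<close> keeps segments in the ball where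
    \<open>C\<close> is valid, and \<open>C * d \<le> e\<close> controls their lengths.\<close>
  define d where "d = min r (e / C)"
  have d: "d > 0" "d \<le> r" "C * d \<le> e" using r C(1) e by (auto simp: d_def min_def field_simps)
  let ?N = "fst c \<inter> snd c -` ball ?x d"
  have "openin (top_of_set (fst c)) ?N"
    using continuous_openin_preimage[OF chart(5)[OF c(1)], of UNIV "ball ?x d"] by auto
  then have "openin (top_of_set (points M)) ?N" using chart(1)[OF c(1)] openin_trans by blast
  moreover have "x \<in> ?N" using c d by simp
  moreover have "rdist M x y < ennreal e" if y: "y \<in> ?N" for y
  proof -
    let ?y = "snd c y"
    let ?l = "linepath ?x ?y"
    let ?g = "chart_inv c \<circ> ?l"
    have "?y \<in> ball ?x d" "?x \<in> ball ?x d" using y d by auto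
    then have seg: "closed_segment ?x ?y \<subseteq> ball ?x d" by (intro closed_segment_subset) auto
    have lV: "?l t \<in> ball ?x d" "?l t \<in> ?V" "?l t \<in> cball ?x r" if "t \<in> {0..1}" for t
    proof -
      show 1: "?l t \<in> ball ?x d" using seg that linepath_in_path by blast
      then show "?l t \<in> cball ?x r" using d by auto
      then show "?l t \<in> ?V" using r by blast
    qed
    have pg: "path ?g" using lV(2)
      by (intro path_continuous_image continuous_on_subset[OF chart(6)[OF c(1)]]) (auto simp: path_image_def simp del: path_image_linepath)
    have gU: "?g ` {0..1} \<subseteq> fst c" using lV(2) chart_inv_in[OF c(1)] by auto
    have eq: "(snd c \<circ> ?g) t = ?l t" if "t \<in> {0..1}" for t
      using chart_inv_right[OF c(1) lV(2)[OF that]] by simp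
    have ld: "(?l has_vector_derivative (?y - ?x)) (at t)" for t
      by (rule has_vector_derivative_linepath_within)
    have "?l C1_differentiable_on {0..1}"
      unfolding C1_differentiable_on_def using ld by (intro exI[of _ "\<lambda>_. ?y - ?x"]) simp
    then have "?l piecewise_C1_differentiable_on {0..1}" by (rule C1_differentiable_imp_piecewise)
    then have d1: "(snd c \<circ> ?g) piecewise_C1_differentiable_on {0..1}"
      by (rule piecewise_C1_cong) (rule eq[symmetric])
    have curve: "piecewise_C1_curve M ?g" by (rule piecewise_C1_curve_in_chart[OF c(1) pg gU d1])
    have ends: "pathstart ?g = x" "pathfinish ?g = y" using c y by (auto simp: pathstart_compose pathfinish_compose)
    have sp: "speed M ?g t \<le> C * norm (?y - ?x)" if t: "t \<in> {0<..<1}" for t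
    proof -
      have "((snd c \<circ> ?g) has_vector_derivative (?y - ?x)) (at t)"
        by (rule has_vector_derivative_transform_within_open[OF ld, where S = "{0<..<1}"]) (use eq t in auto)
      moreover have "?g t \<in> fst c" using gU t by auto
      moreover have "path_image ?g \<subseteq> points M" using curve by (simp add: piecewise_C1_curve_def)
      ultimately have "speed M ?g t = sqrt ((?y - ?x) \<bullet> (gram M c (snd c (?g t)) *v (?y - ?x)))"
        using speed_eq[OF c(1) pg _ t] by blast
      moreover have "snd c (?g t) \<in> cball ?x r" using eq[of t] lV(3)[of t] t by auto
      ultimately show ?thesis using C(2) by simp
    qed
    have "curve_length M ?g \<le> (\<integral>\<^sup>+t. ennreal (C * norm (?y - ?x)) * indicator {0..1::real} t \<partial>lborel)"
      unfolding curve_length_def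
    proof (rule nn_integral_mono_AE)
      have "AE t in lborel. t \<notin> {0, 1::real}"
        by (rule AE_not_in) (auto intro!: finite_imp_null_set_lborel)
      then show "AE t in lborel. ennreal (speed M ?g t) * indicator {0..1} t \<le>
          ennreal (C * norm (?y - ?x)) * indicator {0..1} t"
        by eventually_elim (use sp in \<open>auto simp: indicator_def intro!: ennreal_leI\<close>)
    qed
    also have "\<dots> = ennreal (C * norm (?y - ?x))" by (subst nn_integral_cmult_indicator) auto
    also have "\<dots> < ennreal e"
    proof -
      have "C * norm (?y - ?x) < C * d" using y C(1) by (simp add: dist_norm norm_minus_commute)
      then show ?thesis using d(3) e by (intro ennreal_lessI) auto
    qed
    finally have "curve_length M ?g < ennreal e" .
    then show ?thesis using rdist_le[OF curve] ends by simp
  qed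
  ultimately show ?thesis using that by blast
qed

lemma rdist_self: "x \<in> points M \<Longrightarrow> e > 0 \<Longrightarrow> rdist M x x < ennreal e"
  using rdist_small[of x e] by metis

lemma openin_rball:
  assumes "x \<in> points M"
  shows "openin (top_of_set (points M)) (rball M x R)"
proof (subst openin_subopen, intro ballI)
  fix y assume y: "y \<in> rball M x R"
  then have "rdist M x y < ennreal R" "y \<in> points M" by (auto simp: rball_def)
  then obtain s where s: "rdist M x y < s" "s < ennreal R" using dense by blast
  then obtain s' where s': "s = ennreal s'" "0 \<le> s'" by (cases s) auto
  then have "s' < R" using s(2) by (metis ennreal_less_iff)
  then obtain N where N: "openin (top_of_set (points M)) N" "y \<in> N" "\<And>z. z \<in> N \<Longrightarrow> rdist M y z < ennreal (R - s')"
    using rdist_small[OF \<open>y \<in> points M\<close>, of "R - s'"] by auto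
  have "N \<subseteq> rball M x R"
  proof
    fix z assume z: "z \<in> N"
    have "rdist M x z < s + ennreal (R - s')" using rdist_trans_less[OF s(1) N(3)[OF z]] .
    also have "\<dots> = ennreal R" using s' \<open>s' < R\<close> by (simp flip: ennreal_plus)
    finally show "z \<in> rball M x R" using z openin_imp_subset[OF N(1)] by (auto simp: rball_def)
  qed
  then show "\<exists>T. openin (top_of_set (points M)) T \<and> y \<in> T \<and> T \<subseteq> rball M x R" using N by blast
qed

end

section \<open>Change of variables for arbitrary finite index types\<close>

text \<open>
  The change of variables formula of the library needs a well-ordered index type; the type below is
  a copy of a finite type with some well-order.
\<close>

typedef 'n idx = "UNIV :: 'n set" by auto

instance idx :: (finite) finite
proof
  have "finite (range (Abs_idx :: 'a \<Rightarrow> 'a idx))" by simp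
  moreover have "range (Abs_idx :: 'a \<Rightarrow> 'a idx) = UNIV" by (metis Rep_idx_inverse surjI)
  ultimately show "finite (UNIV :: 'a idx set)" by simp
qed

instantiation idx :: (finite) wellorder
begin

definition less_eq_idx :: "'a idx \<Rightarrow> 'a idx \<Rightarrow> bool" where
  "x \<le> y \<longleftrightarrow> to_nat_on UNIV (Rep_idx x) \<le> to_nat_on UNIV (Rep_idx y)"

definition less_idx :: "'a idx \<Rightarrow> 'a idx \<Rightarrow> bool" where
  "x < y \<longleftrightarrow> to_nat_on UNIV (Rep_idx x) < to_nat_on UNIV (Rep_idx y)"

instance
proof
  fix x y :: "'a idx"
  assume "x \<le> y" "y \<le> x"
  then have "to_nat_on UNIV (Rep_idx x) = to_nat_on UNIV (Rep_idx y)" by (simp add: less_eq_idx_def)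
  moreover have "inj (to_nat_on (UNIV :: 'a set))" by (rule inj_on_to_nat_on[OF countable_finite]) simp
  ultimately show "x = y" by (auto simp: Rep_idx_inject dest: injD)
next
  fix P :: "'a idx \<Rightarrow> bool" and a
  assume step: "\<And>x. (\<And>y. y < x \<Longrightarrow> P y) \<Longrightarrow> P x"
  show "P a"
  proof (induction a rule: measure_induct_rule[where f = "\<lambda>x. to_nat_on UNIV (Rep_idx x)"])
    case (less x)
    show ?case by (rule step) (rule less, simp add: less_idx_def)
  qed
qed (auto simp: less_eq_idx_def less_idx_def)

end

lemma bij_Rep_idx: "bij Rep_idx"
  by (intro bijI injI surjI[of _ Abs_idx]) (simp_all add: Rep_idx_inject Abs_idx_inverse)

definition reindex :: "real^'n \<Rightarrow> real^('n idx)" where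
  "reindex v = (\<chi> i. v $ Rep_idx i)"

definition unindex :: "real^('n idx) \<Rightarrow> real^'n" where
  "unindex w = (\<chi> i. w $ Abs_idx i)"

lemma unindex_reindex [simp]: "unindex (reindex v) = v"
  by (simp add: unindex_def reindex_def Abs_idx_inverse vec_eq_iff)

lemma reindex_unindex [simp]: "reindex (unindex w) = w"
  by (simp add: unindex_def reindex_def Rep_idx_inverse vec_eq_iff)

lemma bounded_linear_reindex: "bounded_linear (reindex :: real^'n::finite \<Rightarrow> real^('n idx))"
  unfolding linear_conv_bounded_linear[symmetric]
  by (rule linearI) (simp_all add: reindex_def vec_eq_iff)

lemma bounded_linear_unindex: "bounded_linear (unindex :: real^('n::finite idx) \<Rightarrow> real^'n)"
  unfolding linear_conv_bounded_linear[symmetric]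
  by (rule linearI) (simp_all add: unindex_def vec_eq_iff)

lemma continuous_unindex: "continuous_on S (unindex :: real^('n::finite idx) \<Rightarrow> real^'n)"
  by (rule bounded_linear.continuous_on[OF bounded_linear_unindex continuous_on_id])

lemma unindex_measurable [measurable]: "(unindex :: real^('n::finite idx) \<Rightarrow> real^'n) \<in> borel_measurable borel"
  by (rule borel_measurable_continuous_onI[OF continuous_unindex])

text \<open>Renaming coordinates maps boxes to boxes with the same side lengths, and boxes determine
  Lebesgue measure.\<close>

lemma lborel_unindex: "distr lborel borel (unindex :: real^('n::finite idx) \<Rightarrow> real^'n) = lborel"
proof (rule lborel_eqI[symmetric])
  fix l u :: "real^'n"
  assume le: "\<And>b. b \<in> Basis \<Longrightarrow> l \<bullet> b \<le> u \<bullet> b"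
  have cart: "(\<Prod>b\<in>Basis. (x :: real^'k::finite) \<bullet> b) = (\<Prod>i\<in>UNIV. x $ i)" for x
  proof -
    have "(\<Prod>i\<in>UNIV. x $ i) = (\<Prod>i\<in>UNIV. x \<bullet> axis i 1)" by (simp add: inner_axis)
    also have "\<dots> = (\<Prod>b\<in>range (\<lambda>i. axis i 1). x \<bullet> b)"
      by (subst prod.reindex) (auto simp: inj_on_def axis_eq_axis)
    also have "range (\<lambda>i. axis i 1) = (Basis :: (real^'k) set)" by (auto simp: Basis_vec_def)
    finally show ?thesis by simp
  qed
  have "unindex -` box l u \<inter> space lborel = box (reindex l) (reindex u)"
  proof -
    have "w \<in> box (reindex l) (reindex u) \<longleftrightarrow> unindex w \<in> box l u" for w :: "real^('n idx)"
    proof -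
      have "w \<in> box (reindex l) (reindex u) \<longleftrightarrow> (\<forall>i. l $ Rep_idx i < w $ i \<and> w $ i < u $ Rep_idx i)"
        by (simp add: mem_box_cart reindex_def)
      also have "\<dots> \<longleftrightarrow> (\<forall>j. l $ j < w $ Abs_idx j \<and> w $ Abs_idx j < u $ j)"
        by (metis Abs_idx_inverse Rep_idx_inverse UNIV_I)
      finally show ?thesis by (simp add: mem_box_cart unindex_def)
    qed
    then show ?thesis by auto
  qed
  then have "emeasure (distr lborel borel unindex) (box l u) = emeasure lborel (box (reindex l) (reindex u))"
    by (subst emeasure_distr) auto
  also have "\<dots> = (\<Prod>b\<in>Basis. (reindex u - reindex l) \<bullet> b)"
  proof (rule emeasure_lborel_box)
    fix b :: "real^('n idx)" assume "b \<in> Basis"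
    then obtain i where "b = axis i 1" by (auto simp: Basis_vec_def)
    moreover have "l \<bullet> axis (Rep_idx i) 1 \<le> u \<bullet> axis (Rep_idx i) 1" by (rule le) (auto simp: Basis_vec_def)
    ultimately show "reindex l \<bullet> b \<le> reindex u \<bullet> b" by (simp add: inner_axis reindex_def)
  qed
  also have "(\<Prod>b\<in>Basis. (reindex u - reindex l) \<bullet> b) = (\<Prod>i\<in>UNIV. (u - l) $ Rep_idx i)"
    unfolding cart by (simp add: reindex_def)
  also have "\<dots> = (\<Prod>b\<in>Basis. (u - l) \<bullet> b)"
    unfolding cart by (rule prod.reindex_bij_betw[OF bij_Rep_idx])
  finally show "emeasure (distr lborel borel unindex) (box l u) = (\<Prod>b\<in>Basis. (u - l) \<bullet> b)" .
qed simp

lemma nn_integral_reindex: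
  fixes F :: "real^'n::finite \<Rightarrow> ennreal"
  assumes [measurable]: "F \<in> borel_measurable borel"
  shows "(\<integral>\<^sup>+y. F y \<partial>lborel) = (\<integral>\<^sup>+w. F (unindex w) \<partial>lborel)"
proof -
  have "(\<integral>\<^sup>+y. F y \<partial>lborel) = (\<integral>\<^sup>+y. F y \<partial>distr lborel borel (unindex :: real^('n idx) \<Rightarrow> real^'n))"
    by (simp add: lborel_unindex)
  also have "\<dots> = (\<integral>\<^sup>+w. F (unindex w) \<partial>lborel)" by (rule nn_integral_distr) auto
  finally show ?thesis .
qed

text \<open>Conjugation by the bijection of the indices is a sign-preserving bijection between the
  permutations in the two Leibniz sums.\<close>

lemma det_reindex:
  fixes A :: "real^'n::finite^'n"
  shows "det (\<chi> i j. A $ Rep_idx i $ Rep_idx j) = det A"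
proof -
  let ?f = "map_permutation UNIV (Rep_idx :: 'n idx \<Rightarrow> 'n)"
  have perm: "?f p permutes UNIV" if "p permutes UNIV" for p
    using map_permutation_permutes[OF bij_Rep_idx that] .
  have bij: "bij_betw ?f {p. p permutes UNIV} {p. p permutes UNIV}"
  proof (rule bij_betwI)
    show "map_permutation UNIV (Abs_idx :: 'n \<Rightarrow> 'n idx) (?f p) = p" if "p \<in> {p. p permutes UNIV}" for p
      using map_permutation_compose_inv[OF bij_Rep_idx, of p Abs_idx] that by (simp add: Rep_idx_inverse)
    have b: "bij (Abs_idx :: 'n \<Rightarrow> 'n idx)"
      by (intro bijI injI surjI[of _ Rep_idx]) (simp_all add: Abs_idx_inject Rep_idx_inverse)
    show "?f (map_permutation UNIV (Abs_idx :: 'n \<Rightarrow> 'n idx) p) = p" if "p \<in> {p. p permutes UNIV}" for p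
      using map_permutation_compose_inv[OF b, of p Rep_idx] that by (simp add: Abs_idx_inverse)
    show "map_permutation UNIV (Abs_idx :: 'n \<Rightarrow> 'n idx) \<in> {p. p permutes UNIV} \<rightarrow> {p. p permutes UNIV}"
      using map_permutation_permutes[OF b] by blast
  qed (use perm in blast)
  have "det (\<chi> i j. A $ Rep_idx i $ Rep_idx j) =
      (\<Sum>p\<in>{p. p permutes UNIV}. of_int (sign p) * (\<Prod>i\<in>UNIV. A $ Rep_idx i $ Rep_idx (p i)))"
    by (simp add: det_def)
  also have "\<dots> = (\<Sum>p\<in>{p. p permutes UNIV}. of_int (sign (?f p)) * (\<Prod>i\<in>UNIV. A $ i $ ?f p i))"
  proof (rule sum.cong[OF HOL.refl])
    fix p :: "'n idx \<Rightarrow> 'n idx" assume p: "p \<in> {p. p permutes UNIV}"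
    have inj: "inj (Rep_idx :: 'n idx \<Rightarrow> 'n)" using bij_Rep_idx by (rule bij_is_inj)
    have "(\<Prod>i\<in>UNIV. A $ i $ ?f p i) = (\<Prod>i\<in>UNIV. A $ Rep_idx i $ ?f p (Rep_idx i))"
      by (rule prod.reindex_bij_betw[OF bij_Rep_idx, symmetric])
    then show "of_int (sign p) * (\<Prod>i\<in>UNIV. A $ Rep_idx i $ Rep_idx (p i)) =
        of_int (sign (?f p)) * (\<Prod>i\<in>UNIV. A $ i $ ?f p i)"
      using sign_map_permutation[of Rep_idx UNIV p] map_permutation_apply[OF inj] p inj by simp
  qed
  also have "\<dots> = (\<Sum>p\<in>{p. p permutes UNIV}. of_int (sign p) * (\<Prod>i\<in>UNIV. A $ i $ p i))"
    by (rule sum.reindex_bij_betw[OF bij])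
  also have "\<dots> = det A" by (simp add: det_def)
  finally show ?thesis .
qed

lemma det_matrix_reindex:
  fixes L :: "real^'n::finite \<Rightarrow> real^'n"
  shows "det (matrix (reindex \<circ> L \<circ> unindex)) = det (matrix L)"
proof -
  have axis: "unindex (axis j 1) = axis (Rep_idx j) 1" for j :: "'n idx"
    by (auto simp: unindex_def axis_def vec_eq_iff Rep_idx_inverse) (metis Abs_idx_inverse UNIV_I)
  have "matrix (reindex \<circ> L \<circ> unindex) $ i $ j = matrix L $ Rep_idx i $ Rep_idx j" for i j
    by (simp add: matrix_def reindex_def axis)
  then have "matrix (reindex \<circ> L \<circ> unindex) = (\<chi> i j. matrix L $ Rep_idx i $ Rep_idx j)"
    by (simp add: vec_eq_iff)
  then show ?thesis by (simp add: det_reindex)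
qed

lemma nn_integral_set_integrable:
  fixes F :: "'a::euclidean_space \<Rightarrow> real"
  assumes S: "S \<in> sets borel" and F: "F \<in> borel_measurable borel" and nn: "\<And>x. x \<in> S \<Longrightarrow> 0 \<le> F x"
  shows "(\<integral>\<^sup>+x\<in>S. ennreal (F x) \<partial>lborel) < \<infinity> \<longleftrightarrow> F absolutely_integrable_on S"
    and "F absolutely_integrable_on S \<Longrightarrow> (\<integral>\<^sup>+x\<in>S. ennreal (F x) \<partial>lborel) = ennreal (integral S F)"
proof -
  let ?F = "\<lambda>x. indicator S x *\<^sub>R F x"
  have m: "?F \<in> borel_measurable borel" using S F by measurable
  have nn': "0 \<le> ?F x" for x using nn by (auto simp: indicator_def)
  have eq: "(\<integral>\<^sup>+x\<in>S. ennreal (F x) \<partial>lborel) = (\<integral>\<^sup>+x. ennreal (?F x) \<partial>lborel)"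
    by (intro nn_integral_cong) (auto simp: indicator_def)
  have int: "F absolutely_integrable_on S \<longleftrightarrow> integrable lborel ?F"
    unfolding set_integrable_def using m by (intro integrable_completion) simp
  show "(\<integral>\<^sup>+x\<in>S. ennreal (F x) \<partial>lborel) < \<infinity> \<longleftrightarrow> F absolutely_integrable_on S"
    unfolding int eq integrable_iff_bounded using m nn' by simp
  assume a: "F absolutely_integrable_on S"
  have "(\<integral>\<^sup>+x. ennreal (?F x) \<partial>lborel) = ennreal (integral\<^sup>L lborel ?F)"
    using a int nn' by (intro nn_integral_eq_integral) auto
  also have "integral\<^sup>L lborel ?F = integral\<^sup>L lebesgue ?F"
    using m by (intro integral_completion[symmetric]) simp
  also have "\<dots> = integral S F"
    using set_lebesgue_integral_eq_integral(2)[OF a] by (simp add: set_lebesgue_integral_def)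
  finally show "(\<integral>\<^sup>+x\<in>S. ennreal (F x) \<partial>lborel) = ennreal (integral S F)" using eq by simp
qed

text \<open>The formula for absolutely integrable functions with values in \<open>real^1\<close>
  also gives the equivalence of integrability on both sides; where it fails, both integrals are
  infinite. The function \<open>h\<close> is Borel on the whole space and agrees with the Jacobian
  expression on \<open>S\<close>, where alone the derivative is controlled.\<close>

lemma nn_integral_change_of_variables_wellorder:
  fixes g :: "real^'m::{finite,wellorder} \<Rightarrow> real^'m::_" and F h :: "real^'m::_ \<Rightarrow> real"
  assumes S: "S \<in> sets borel" "g ` S \<in> sets borel"
    and der: "\<And>x. x \<in> S \<Longrightarrow> (g has_derivative g' x) (at x)" and inj: "inj_on g S"
    and F: "F \<in> borel_measurable borel" "\<And>y. y \<in> g ` S \<Longrightarrow> 0 \<le> F y"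
    and h: "h \<in> borel_measurable borel" "\<And>x. x \<in> S \<Longrightarrow> h x = \<bar>det (matrix (g' x))\<bar> * F (g x)"
  shows "(\<integral>\<^sup>+x\<in>S. ennreal (h x) \<partial>lborel) = (\<integral>\<^sup>+y\<in>g ` S. ennreal (F y) \<partial>lborel)"
proof -
  let ?v = "vec :: real \<Rightarrow> real^1"
  have bl: "bounded_linear ?v" "bounded_linear (\<lambda>x :: real^1. x $ 1)"
    unfolding linear_conv_bounded_linear[symmetric] by (auto intro!: linearI simp: vec_eq_iff)
  have vec_int: "(\<lambda>x. ?v (k x)) absolutely_integrable_on T \<longleftrightarrow> k absolutely_integrable_on T"
    and vec_eq: "k absolutely_integrable_on T \<Longrightarrow> integral T (\<lambda>x. ?v (k x)) = ?v (integral T k)"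
    for k :: "real^'m::_ \<Rightarrow> real" and T
  proof -
    show "(\<lambda>x. ?v (k x)) absolutely_integrable_on T \<longleftrightarrow> k absolutely_integrable_on T"
      using absolutely_integrable_linear[OF _ bl(1), of T k] absolutely_integrable_linear[OF _ bl(2), of T "\<lambda>x. ?v (k x)"]
      by (auto simp: comp_def)
    assume "k absolutely_integrable_on T"
    then have "k integrable_on T" by (rule set_lebesgue_integral_eq_integral(1))
    then show "integral T (\<lambda>x. ?v (k x)) = ?v (integral T k)"
      using integral_linear[OF _ bl(1)] by (simp add: comp_def)
  qed
  have hv: "?v (h x) = \<bar>det (matrix (g' x))\<bar> *\<^sub>R ?v (F (g x))" if "x \<in> S" for x
    using h(2)[OF that] by (simp add: vec_eq_iff)
  have hnn: "0 \<le> h x" if "x \<in> S" for x using h(2)[OF that] F(2) that by simp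
  have cov: "(\<lambda>x. ?v (h x)) absolutely_integrable_on S \<and> integral S (\<lambda>x. ?v (h x)) = b
     \<longleftrightarrow> (\<lambda>y. ?v (F y)) absolutely_integrable_on (g ` S) \<and> integral (g ` S) (\<lambda>y. ?v (F y)) = b" for b
  proof -
    have "S \<in> sets lebesgue" using S(1) by simp
    then have "(\<lambda>x. \<bar>det (matrix (g' x))\<bar> *\<^sub>R ?v (F (g x))) absolutely_integrable_on S \<and>
           integral S (\<lambda>x. \<bar>det (matrix (g' x))\<bar> *\<^sub>R ?v (F (g x))) = b
       \<longleftrightarrow> (\<lambda>y. ?v (F y)) absolutely_integrable_on (g ` S) \<and> integral (g ` S) (\<lambda>y. ?v (F y)) = b"
      by (rule has_absolute_integral_change_of_variables) (use der inj has_derivative_at_withinI in blast)+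
    moreover have "(\<lambda>x. \<bar>det (matrix (g' x))\<bar> *\<^sub>R ?v (F (g x))) absolutely_integrable_on S
        \<longleftrightarrow> (\<lambda>x. ?v (h x)) absolutely_integrable_on S"
      unfolding set_integrable_def by (intro Bochner_Integration.integrable_cong) (auto simp: hv indicator_def)
    moreover have "integral S (\<lambda>x. \<bar>det (matrix (g' x))\<bar> *\<^sub>R ?v (F (g x))) = integral S (\<lambda>x. ?v (h x))"
      by (rule Henstock_Kurzweil_Integration.integral_cong) (simp add: hv)
    ultimately show ?thesis by simp
  qed
  show ?thesis
  proof (cases "F absolutely_integrable_on (g ` S)")
    case True
    then have *: "(\<lambda>x. ?v (h x)) absolutely_integrable_on S \<and> integral S (\<lambda>x. ?v (h x)) = ?v (integral (g ` S) F)"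
      using cov vec_int vec_eq by blast
    then have "h absolutely_integrable_on S" using vec_int by blast
    moreover from this have "integral S h = integral (g ` S) F" using * vec_eq by (simp add: vec_eq_iff)
    ultimately show ?thesis
      using True nn_integral_set_integrable(2)[OF S(1) h(1) hnn] nn_integral_set_integrable(2)[OF S(2) F] by simp
  next
    case False
    then have "\<not> h absolutely_integrable_on S" using cov vec_int by blast
    then show ?thesis
      using False nn_integral_set_integrable(1)[OF S(1) h(1) hnn] nn_integral_set_integrable(1)[OF S(2) F]
      by (metis infinity_ennreal_def less_top)
  qed
qed

lemma nn_integral_change_of_variables:
  fixes g :: "real^'n::finite \<Rightarrow> real^'n" and F h :: "real^'n \<Rightarrow> real"
  assumes S: "S \<in> sets borel" "g ` S \<in> sets borel"
    and der: "\<And>x. x \<in> S \<Longrightarrow> (g has_derivative g' x) (at x)" and inj: "inj_on g S"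
    and F: "F \<in> borel_measurable borel" "\<And>y. y \<in> g ` S \<Longrightarrow> 0 \<le> F y"
    and h: "h \<in> borel_measurable borel" "\<And>x. x \<in> S \<Longrightarrow> h x = \<bar>det (matrix (g' x))\<bar> * F (g x)"
  shows "(\<integral>\<^sup>+x\<in>S. ennreal (h x) \<partial>lborel) = (\<integral>\<^sup>+y\<in>g ` S. ennreal (F y) \<partial>lborel)"
proof -
  let ?u = "unindex :: real^('n idx) \<Rightarrow> real^'n" and ?r = "reindex :: real^'n \<Rightarrow> real^('n idx)"
  let ?g = "?r \<circ> g \<circ> ?u"
  have image: "?r ` T = ?u -` T" for T by (auto intro!: image_eqI[of _ _ "unindex _"])
  have meas: "?r ` T \<in> sets borel" if "T \<in> sets borel" for T
    unfolding image using measurable_sets[OF unindex_measurable that] by simp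
  have transport: "(\<integral>\<^sup>+y\<in>T. ennreal (k y) \<partial>lborel) = (\<integral>\<^sup>+w\<in>?r ` T. ennreal (k (?u w)) \<partial>lborel)"
    if "T \<in> sets borel" "k \<in> borel_measurable borel" for T k
  proof -
    have "(\<lambda>y. ennreal (k y) * indicator T y) \<in> borel_measurable borel" using that by measurable
    then have "(\<integral>\<^sup>+y\<in>T. ennreal (k y) \<partial>lborel) = (\<integral>\<^sup>+w. ennreal (k (?u w)) * indicator T (?u w) \<partial>lborel)"
      by (rule nn_integral_reindex)
    also have "\<dots> = (\<integral>\<^sup>+w\<in>?r ` T. ennreal (k (?u w)) \<partial>lborel)"
      by (intro nn_integral_cong) (auto simp: image indicator_def)
    finally show ?thesis .
  qed
  have gS: "?g ` ?r ` S = ?r ` g ` S" by (simp add: image_image)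
  have "(\<integral>\<^sup>+w\<in>?r ` S. ennreal (h (?u w)) \<partial>lborel) = (\<integral>\<^sup>+w\<in>?g ` ?r ` S. ennreal (F (?u w)) \<partial>lborel)"
  proof (rule nn_integral_change_of_variables_wellorder)
    show "?r ` S \<in> sets borel" "?g ` ?r ` S \<in> sets borel" using meas S unfolding gS by auto
    show "(?g has_derivative (?r \<circ> g' (?u w) \<circ> ?u)) (at w)" if "w \<in> ?r ` S" for w
    proof -
      have w: "?u w \<in> S" using that by auto
      have "(?u has_derivative ?u) (at w)" "(?r has_derivative ?r) (at (g (?u w)))"
        using bounded_linear_unindex bounded_linear_reindex by (auto intro: bounded_linear_imp_has_derivative)
      then show ?thesis using der[OF w]
        by (meson diff_chain_at comp_assoc)
    qed
    show "inj_on ?g (?r ` S)"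
      using inj by (auto simp: inj_on_def) (metis unindex_reindex)+
    show "(\<lambda>w. F (?u w)) \<in> borel_measurable borel" "(\<lambda>w. h (?u w)) \<in> borel_measurable borel"
      using F(1) h(1) by measurable
    show "0 \<le> F (?u w)" if "w \<in> ?g ` ?r ` S" for w using F(2) that by auto
    show "h (?u w) = \<bar>det (matrix (?r \<circ> g' (?u w) \<circ> ?u))\<bar> * F (?u (?g w))" if "w \<in> ?r ` S" for w
      using h(2) that by (auto simp: det_matrix_reindex)
  qed
  then show ?thesis using transport[OF S(1) h(1)] transport[OF S(2) F(1)] gS by simp
qed

section \<open>The Riemannian volume\<close>

lemma openin_sets_restrict_space:
  assumes "openin (top_of_set P) U"
  shows "U \<in> sets (restrict_space borel P)"
proof -
  obtain T where "open T" "U = P \<inter> T" using assms unfolding openin_open by blast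
  then show ?thesis unfolding sets_restrict_space by (intro image_eqI[of _ _ T]) simp_all
qed

lemma continuous_preimage_sets_restrict_space:
  assumes "continuous_on P f" "f ` P \<subseteq> Q" "B \<in> sets (restrict_space borel Q)"
  shows "P \<inter> f -` B \<in> sets (restrict_space borel P)"
proof -
  have "f \<in> measurable (restrict_space borel P) (restrict_space borel Q)"
    using borel_measurable_continuous_on_restrict[OF assms(1)] assms(2)
    by (intro measurable_restrict_space2) (auto simp: space_restrict_space)
  from measurable_sets[OF this assms(3)] show ?thesis by (simp add: space_restrict_space Int_commute)
qed

text \<open>All matrices on the segment from the identity to \<open>A\<close> are positive on
  nonzero vectors, hence invertible; so the determinant starts at one and never vanishes.\<close>

lemma det_pos_definite:
  fixes A :: "real^'n::finite^'n"
  assumes "\<And>v. v \<noteq> 0 \<Longrightarrow> v \<bullet> (A *v v) > 0"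
  shows "det A > 0"
proof -
  let ?B = "\<lambda>t. \<chi> i j. t * A $ i $ j + (1 - t) * (mat 1 :: real^'n^'n) $ i $ j"
  have B: "?B t *v v = t *\<^sub>R (A *v v) + (1 - t) *\<^sub>R v" for t v
  proof -
    have "?B t = t *\<^sub>R A + (1 - t) *\<^sub>R mat 1" by (simp add: vec_eq_iff)
    then show ?thesis by (simp add: matrix_vector_mult_add_rdistrib flip: scaleR_matrix_vector_assoc)
  qed
  have nz: "det (?B t) \<noteq> 0" if t: "0 \<le> t" "t \<le> 1" for t
  proof -
    have "v = 0" if v: "?B t *v v = 0" for v
    proof (rule ccontr)
      assume "v \<noteq> 0"
      then have p: "v \<bullet> (A *v v) > 0" "v \<bullet> v > 0" using assms by auto
      have "0 = v \<bullet> (?B t *v v)" using v by simp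
      also have "\<dots> = t * (v \<bullet> (A *v v)) + (1 - t) * (v \<bullet> v)" by (simp add: B inner_add_right)
      finally have eq: "t * (v \<bullet> (A *v v)) + (1 - t) * (v \<bullet> v) = 0" by simp
      show False
      proof (cases "t = 0")
        case False
        then have "t * (v \<bullet> (A *v v)) > 0" "(1 - t) * (v \<bullet> v) \<ge> 0" using t p by auto
        then show False using eq by linarith
      qed (use eq p in simp)
    qed
    then have "inj ((*v) (?B t))"
      using linear_injective_0[OF matrix_vector_mul_linear] by blast
    then show ?thesis using inj_matrix_vector_mult invertible_det_nz matrix_left_invertible_injective
        invertible_left_inverse by blast
  qed
  have cont: "continuous_on {0..1} (\<lambda>t. det (?B t))"
    by (rule continuous_on_det) (simp, intro continuous_intros)
  have d0: "det (?B 0) = 1"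
  proof -
    have "?B 0 = mat 1" by (simp add: vec_eq_iff)
    then show ?thesis by simp
  qed
  have "?B 1 = A" by (simp add: vec_eq_iff)
  moreover have "det (?B 1) > 0"
  proof (rule ccontr)
    assume "\<not> det (?B 1) > 0"
    then obtain t where "0 \<le> t" "t \<le> 1" "det (?B t) = 0"
      using IVT2'[of "\<lambda>t. det (?B t)" 1 0 0] cont d0 by auto
    then show False using nz by blast
  qed
  ultimately show ?thesis by simp
qed

section \<open>The volume in one chart\<close>

context riemannian_mfd begin

abbreviation borel_sets :: "'a set set" where
  "borel_sets \<equiv> sets (restrict_space borel (points M))"

abbreviation density_at :: "('a, 'n) chart \<Rightarrow> real^'n \<Rightarrow> real" where
  "density_at c y \<equiv> sqrt (det (gram M c y))"

definition chart_volume :: "('a, 'n) chart \<Rightarrow> 'a set \<Rightarrow> ennreal" where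
  "chart_volume c B = (\<integral>\<^sup>+y\<in>snd c ` B. ennreal (density_at c y) \<partial>lborel)"

lemma chart_sets: "c \<in> charts M \<Longrightarrow> fst c \<in> borel_sets"
  using openin_sets_restrict_space chart(1) by blast

lemma chart_image_sets:
  assumes c: "c \<in> charts M" and B: "B \<in> borel_sets" "B \<subseteq> fst c"
  shows "snd c ` B \<in> sets borel"
proof -
  have "snd c ` fst c \<inter> chart_inv c -` B \<in> sets (restrict_space borel (snd c ` fst c))"
    using chart_inv_in[OF c] chart(2)[OF c]
    by (intro continuous_preimage_sets_restrict_space[OF chart(6)[OF c] _ B(1)]) auto
  moreover have "snd c ` fst c \<inter> chart_inv c -` B = snd c ` B"
  proof
    show "snd c ` fst c \<inter> chart_inv c -` B \<subseteq> snd c ` B"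
    proof
      fix y assume "y \<in> snd c ` fst c \<inter> chart_inv c -` B"
      then have "chart_inv c y \<in> B" "snd c (chart_inv c y) = y" using chart_inv_right[OF c] by simp_all
      then show "y \<in> snd c ` B" by (metis imageI)
    qed
    show "snd c ` B \<subseteq> snd c ` fst c \<inter> chart_inv c -` B" using B c by auto
  qed
  moreover have "snd c ` fst c \<in> sets borel" using chart(3)[OF c] by simp
  ultimately show ?thesis by (simp add: sets_restrict_space_iff)
qed

lemma density_pos: "c \<in> charts M \<Longrightarrow> y \<in> snd c ` fst c \<Longrightarrow> density_at c y > 0"
  using det_pos_definite[of "gram M c y"] gram(2) by simp

lemma density_measurable:
  assumes c: "c \<in> charts M"
  shows "(\<lambda>y. indicator (snd c ` fst c) y * density_at c y) \<in> borel_measurable borel"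
proof -
  have "continuous_on (snd c ` fst c) (\<lambda>y. det (gram M c y))"
    by (intro continuous_on_det continuous_on_component gram(1)[OF c])
  then have "continuous_on (snd c ` fst c) (density_at c)" by (rule continuous_on_real_sqrt)
  moreover have "snd c ` fst c \<in> sets borel" using chart(3)[OF c] by simp
  ultimately have "(\<lambda>y. indicator (snd c ` fst c) y *\<^sub>R density_at c y) \<in> borel_measurable borel"
    using borel_measurable_continuous_on_indicator by blast
  then show ?thesis by simp
qed

text \<open>Cut off outside the chart, the density is Borel on the whole coordinate space.\<close>

lemma chart_volume_alt:
  assumes c: "c \<in> charts M" and B: "B \<subseteq> fst c"
  shows "chart_volume c B = (\<integral>\<^sup>+y\<in>snd c ` B. ennreal (indicator (snd c ` fst c) y * density_at c y) \<partial>lborel)"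
  unfolding chart_volume_def using B by (intro nn_integral_cong) (auto simp: indicator_def)

lemma chart_volume_suminf:
  assumes c: "c \<in> charts M" and A: "\<And>j::nat. A j \<in> borel_sets" "\<And>j. A j \<subseteq> fst c" "disjoint_family A"
  shows "chart_volume c (\<Union>j. A j) = (\<Sum>j. chart_volume c (A j))"
proof -
  let ?d = "\<lambda>y. ennreal (indicator (snd c ` fst c) y * density_at c y)"
  have [measurable]: "?d \<in> borel_measurable borel" using density_measurable[OF c] by measurable
  have [measurable]: "snd c ` A j \<in> sets borel" for j using chart_image_sets[OF c A(1,2)] .
  have dj: "disjoint_family (\<lambda>j. snd c ` A j)"
    unfolding disjoint_family_on_def
  proof (intro ballI impI)
    fix i j :: nat assume "i \<noteq> j"
    then have "A i \<inter> A j = {}" using A(3) by (auto simp: disjoint_family_on_def)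
    then have "snd c ` (A i \<inter> A j) = {}" by simp
    then show "snd c ` A i \<inter> snd c ` A j = {}" using inj_on_image_Int[OF chart(4)[OF c] A(2) A(2)] by simp
  qed
  have "chart_volume c (\<Union>j. A j) = (\<integral>\<^sup>+y. ?d y * indicator (\<Union>j. snd c ` A j) y \<partial>lborel)"
    using A(2) by (subst chart_volume_alt[OF c]) (auto simp: image_UN)
  also have "\<dots> = (\<integral>\<^sup>+y. (\<Sum>j. ?d y * indicator (snd c ` A j) y) \<partial>lborel)"
    by (simp add: suminf_indicator[OF dj, symmetric] ennreal_suminf_cmult)
  also have "\<dots> = (\<Sum>j. \<integral>\<^sup>+y. ?d y * indicator (snd c ` A j) y \<partial>lborel)"
    by (rule nn_integral_suminf) measurable
  also have "\<dots> = (\<Sum>j. chart_volume c (A j))" using chart_volume_alt[OF c A(2)] by simp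
  finally show ?thesis .
qed

text \<open>For \<open>f = id\<close> this is the independence of the volume of the coordinates.\<close>

lemma chart_volume_isometry:
  assumes f: "C1_isometry M M f" "inj_on f (points M)" and c: "c \<in> charts M" and c': "c' \<in> charts M"
    and B: "B \<in> borel_sets" "B \<subseteq> fst c" and fB: "f ` B \<in> borel_sets" "f ` B \<subseteq> fst c'"
  shows "chart_volume c' (f ` B) = chart_volume c B"
proof -
  let ?t = "transition c c' f"
  obtain D where D: "\<And>y. y \<in> snd c ` (fst c \<inter> f -` fst c') \<Longrightarrow> (?t has_derivative D y) (at y)"
    "\<And>y u v. y \<in> snd c ` (fst c \<inter> f -` fst c') \<Longrightarrow>
      u \<bullet> (gram M c y *v v) = D y u \<bullet> (gram M c' (?t y) *v D y v)"
    using C1_isometryE[OF f(1) c c'] by metis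
  have S: "snd c ` B \<subseteq> snd c ` (fst c \<inter> f -` fst c')"
  proof (rule image_mono, rule subsetI)
    fix x assume "x \<in> B"
    then have "f x \<in> f ` B" "x \<in> fst c" using B by blast+
    then show "x \<in> fst c \<inter> f -` fst c'" using fB by blast
  qed
  have tc: "?t (snd c x) = snd c' (f x)" if "x \<in> fst c" for x using that c by (simp add: transition_def)
  have image: "?t ` snd c ` B = snd c' ` f ` B"
    unfolding image_image using tc B(2) by (intro image_cong) auto
  \<comment> \<open>The Gram matrix of \<open>c\<close> arises from that of \<open>c'\<close> by
    congruence with the Jacobian matrix, so the determinants differ by the square of the
    Jacobian.\<close>
  have dens: "density_at c y = \<bar>det (matrix (D y))\<bar> * density_at c' (?t y)"
    if y: "y \<in> snd c ` (fst c \<inter> f -` fst c')" for y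
  proof -
    let ?A = "matrix (D y)"
    have lin: "linear (D y)" using D(1)[OF y] has_derivative_linear by blast
    have A: "D y v = ?A *v v" for v using matrix_vector_mul(2)[OF lin] by metis
    have "u \<bullet> (gram M c y *v v) = u \<bullet> ((transpose ?A ** gram M c' (?t y) ** ?A) *v v)" for u v
    proof -
      have "u \<bullet> (gram M c y *v v) = (?A *v u) \<bullet> (gram M c' (?t y) *v (?A *v v))"
        using D(2)[OF y, of u v] A by simp
      also have "\<dots> = u \<bullet> (transpose ?A *v (gram M c' (?t y) *v (?A *v v)))"
        by (metis dot_lmul_matrix transpose_matrix_vector vector_transpose_matrix inner_commute)
      finally show ?thesis by (simp add: matrix_vector_mul_assoc matrix_mul_assoc)
    qed
    then have "gram M c y *v v = (transpose ?A ** gram M c' (?t y) ** ?A) *v v" for v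
      using vector_eq_ldot by blast
    then have "gram M c y = transpose ?A ** gram M c' (?t y) ** ?A" using matrix_eq by blast
    then have "det (gram M c y) = (det ?A)\<^sup>2 * det (gram M c' (?t y))"
      by (simp add: det_mul det_transpose power2_eq_square)
    then show ?thesis by (simp add: real_sqrt_mult)
  qed
  let ?h = "\<lambda>y. indicator (snd c ` fst c) y * density_at c y"
  let ?F = "\<lambda>y. indicator (snd c' ` fst c') y * density_at c' y"
  have tin: "?t y \<in> snd c' ` fst c'" if "y \<in> snd c ` B" for y using that image fB(2) by blast
  have "(\<integral>\<^sup>+y\<in>snd c ` B. ennreal (?h y) \<partial>lborel) = (\<integral>\<^sup>+y\<in>?t ` snd c ` B. ennreal (?F y) \<partial>lborel)"
  proof (rule nn_integral_change_of_variables)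
    show "snd c ` B \<in> sets borel" using chart_image_sets[OF c B] .
    show "?t ` snd c ` B \<in> sets borel" unfolding image using chart_image_sets[OF c' fB] .
    show "(?t has_derivative D y) (at y)" if "y \<in> snd c ` B" for y using D(1) S that by blast
    show "inj_on ?t (snd c ` B)"
    proof (rule inj_onI)
      fix y z assume "y \<in> snd c ` B" "z \<in> snd c ` B" and eq: "?t y = ?t z"
      then obtain x x' where x: "x \<in> B" "y = snd c x" "x' \<in> B" "z = snd c x'" by blast
      then have "snd c' (f x) = snd c' (f x')" using eq tc[of x] tc[of x'] B(2) by (metis subsetD)
      then have "f x = f x'" using chart(4)[OF c'] fB(2) x by (auto dest: inj_onD)
      then have "x = x'" using f(2) x B(2) chart(2)[OF c] by (meson inj_onD subsetD)
      then show "y = z" using x by simp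
    qed
    show "?F \<in> borel_measurable borel" "?h \<in> borel_measurable borel"
      using density_measurable c c' by blast+
    show "0 \<le> ?F y" if "y \<in> ?t ` snd c ` B" for y
      using density_pos[OF c', of y] by (auto simp: indicator_def)
    show "?h y = \<bar>det (matrix (D y))\<bar> * ?F (?t y)" if "y \<in> snd c ` B" for y
      using dens[of y] tin[OF that] S that B(2) by auto
  qed
  then show ?thesis
    using chart_volume_alt[OF c B(2)] chart_volume_alt[OF c' fB(2)] image by simp
qed

end

section \<open>The volume measure from a countable atlas\<close>

locale covered_mfd = riemannian_mfd +
  fixes ch :: "nat \<Rightarrow> ('a, 'b) chart"
  assumes ch: "ch i \<in> charts M" and cover: "(\<Union>i. fst (ch i)) = points M"
begin

abbreviation piece :: "nat \<Rightarrow> 'a set" where "piece \<equiv> disjointed (\<lambda>i. fst (ch i))"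

lemma piece_subset: "piece i \<subseteq> fst (ch i)" by (rule disjointed_subset)

lemma piece_sets: "piece i \<in> borel_sets"
  using sets.range_disjointed_sets[of "\<lambda>i. fst (ch i)" "restrict_space borel (points M)"] chart_sets[OF ch] by blast

lemma piece_UN: "(\<Union>i. piece i) = points M" using cover by (simp add: UN_disjointed_eq)

lemma borel_sets_subset: "B \<in> borel_sets \<Longrightarrow> B \<subseteq> points M"
  using sets.sets_into_space[of B "restrict_space borel (points M)"] by (simp add: space_restrict_space)

lemma pieces_disjoint: "disjoint_family (\<lambda>i. B \<inter> piece i)"
  using disjoint_family_disjointed[of "\<lambda>i. fst (ch i)"] by (auto simp: disjoint_family_on_def)

lemma pieces_Un: "B \<in> borel_sets \<Longrightarrow> (\<Union>i. B \<inter> piece i) = B"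
  using piece_UN borel_sets_subset[of B] by blast

definition total_volume :: "'a set \<Rightarrow> ennreal" where
  "total_volume B = (\<Sum>i. chart_volume (ch i) (B \<inter> piece i))"

lemma chart_piece: "B \<in> borel_sets \<Longrightarrow> B \<inter> piece i \<in> borel_sets" "B \<inter> piece i \<subseteq> fst (ch i)"
  using piece_sets piece_subset by auto

text \<open>Pulling back the disjoint pieces of the cover cuts \<open>B\<close> into countably many
  sets to which \<open>chart_volume_isometry\<close> applies. For the identity this gives the right
  value of the measure in every chart, for deck transformations the invariance of volume.\<close>

lemma total_volume_isometry:
  assumes f: "C1_isometry M M f" "inj_on f (points M)" and c: "c \<in> charts M"
    and B: "B \<in> borel_sets" "B \<subseteq> fst c" and fB: "f ` B \<in> borel_sets"
  shows "total_volume (f ` B) = chart_volume c B"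
proof -
  have fc: "continuous_on (points M) f" "f ` points M \<subseteq> points M" using f by (auto simp: C1_isometry_def)
  let ?A = "\<lambda>i. B \<inter> f -` piece i"
  have im: "f ` ?A i = f ` B \<inter> piece i" for i by blast
  have A: "?A i \<in> borel_sets" for i
  proof -
    have "points M \<inter> f -` piece i \<in> borel_sets"
      using continuous_preimage_sets_restrict_space[OF fc piece_sets] .
    then have "B \<inter> (points M \<inter> f -` piece i) \<in> borel_sets" using B(1) by blast
    moreover have "B \<inter> (points M \<inter> f -` piece i) = ?A i" using borel_sets_subset[OF B(1)] by blast
    ultimately show ?thesis by simp
  qed
  have "total_volume (f ` B) = (\<Sum>i. chart_volume (ch i) (f ` ?A i))"
    unfolding total_volume_def im by simp
  also have "\<dots> = (\<Sum>i. chart_volume c (?A i))"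
  proof (rule arg_cong[of _ _ suminf], rule ext)
    fix i
    show "chart_volume (ch i) (f ` ?A i) = chart_volume c (?A i)"
    proof (rule chart_volume_isometry[of f c "ch i" "?A i", OF f c ch A])
      show "?A i \<subseteq> fst c" using B(2) by blast
      show "f ` ?A i \<in> borel_sets" "f ` ?A i \<subseteq> fst (ch i)" using chart_piece(1)[OF fB, of i] chart_piece(2)[of "f ` B" i] im by simp_all
    qed
  qed
  also have "\<dots> = chart_volume c (\<Union>i. ?A i)"
  proof (rule chart_volume_suminf[OF c A, symmetric])
    show "disjoint_family ?A"
      using disjoint_family_disjointed[of "\<lambda>i. fst (ch i)"] by (auto simp: disjoint_family_on_def)
  qed (use B(2) in blast)
  also have "(\<Union>i. ?A i) = B"
  proof -
    have "\<exists>i. f x \<in> piece i" if "x \<in> B" for x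
    proof -
      have "f x \<in> points M" using that fc(2) borel_sets_subset[OF B(1)] by blast
      then show ?thesis unfolding piece_UN[symmetric] by (rule UN_E) blast
    qed
    then show ?thesis by auto
  qed
  finally show ?thesis .
qed

definition volume_measure :: "'a measure" where
  "volume_measure = measure_of (points M) borel_sets total_volume"

lemma suminf_swap:
  fixes a :: "nat \<Rightarrow> nat \<Rightarrow> ennreal"
  shows "(\<Sum>i. \<Sum>j. a i j) = (\<Sum>j. \<Sum>i. a i j)"
proof -
  have "(\<Sum>i. \<Sum>j. a i j) = (\<integral>\<^sup>+i. (\<Sum>j. a i j) \<partial>count_space UNIV)" by (simp add: nn_integral_count_space_nat)
  also have "\<dots> = (\<Sum>j. \<integral>\<^sup>+i. a i j \<partial>count_space UNIV)" by (rule nn_integral_suminf) simp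
  also have "\<dots> = (\<Sum>j. \<Sum>i. a i j)" by (simp add: nn_integral_count_space_nat)
  finally show ?thesis .
qed

lemma emeasure_volume: "B \<in> borel_sets \<Longrightarrow> emeasure volume_measure B = total_volume B"
  unfolding volume_measure_def
proof (rule emeasure_measure_of_sigma)
  show "sigma_algebra (points M) borel_sets"
    using sets.sigma_algebra_axioms[of "restrict_space borel (points M)"] by (simp add: space_restrict_space)
  show "positive borel_sets total_volume"
    by (simp add: positive_def total_volume_def chart_volume_def)
  show "countably_additive borel_sets total_volume"
  proof (rule countably_additiveI)
    fix A :: "nat \<Rightarrow> 'a set" assume A: "range A \<subseteq> borel_sets" "disjoint_family A" "(\<Union>i. A i) \<in> borel_sets"
    have "(\<Sum>j. total_volume (A j)) = (\<Sum>i. \<Sum>j. chart_volume (ch i) (A j \<inter> piece i))"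
      unfolding total_volume_def by (rule suminf_swap)
    also have "\<dots> = (\<Sum>i. chart_volume (ch i) (\<Union>j. A j \<inter> piece i))"
    proof (rule arg_cong[of _ _ suminf], rule ext)
      fix i
      show "(\<Sum>j. chart_volume (ch i) (A j \<inter> piece i)) = chart_volume (ch i) (\<Union>j. A j \<inter> piece i)"
      proof (rule chart_volume_suminf[OF ch, symmetric])
        show "A j \<inter> piece i \<in> borel_sets" "A j \<inter> piece i \<subseteq> fst (ch i)" for j
          using chart_piece[of "A j" i] A(1) by auto
        show "disjoint_family (\<lambda>j. A j \<inter> piece i)" using A(2) by (auto simp: disjoint_family_on_def)
      qed
    qed
    also have "\<dots> = total_volume (\<Union>j. A j)" unfolding total_volume_def by (simp add: Int_UN_distrib2 flip: UN_simps)
    finally show "(\<Sum>j. total_volume (A j)) = total_volume (\<Union>j. A j)" .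
  qed
qed

lemma volume_measure_spec:
  "space volume_measure = points M" "sets volume_measure = borel_sets"
  "c \<in> charts M \<Longrightarrow> B \<in> borel_sets \<Longrightarrow> B \<subseteq> fst c \<Longrightarrow> emeasure volume_measure B = chart_volume c B"
proof -
  have sub: "borel_sets \<subseteq> Pow (points M)" using borel_sets_subset by blast
  show "space volume_measure = points M" unfolding volume_measure_def by (rule space_measure_of[OF sub])
  have "sigma_sets (points M) borel_sets = borel_sets"
    using sets.sigma_sets_eq[of "restrict_space borel (points M)"] by (simp add: space_restrict_space)
  then show "sets volume_measure = borel_sets" unfolding volume_measure_def by (simp add: sets_measure_of[OF sub])
  assume "c \<in> charts M" "B \<in> borel_sets" "B \<subseteq> fst c"
  then show "emeasure volume_measure B = chart_volume c B"
    using emeasure_volume total_volume_isometry[OF C1_isometry_id, of c B] by simp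
qed

text \<open>A measure with the defining property is determined on subsets of the pieces, each of
  which lies in a chart, and then everywhere by countable additivity.\<close>

lemma riemannian_volume_eq: "riemannian_volume M = volume_measure"
  unfolding riemannian_volume_def
proof (rule the_equality)
  show "space volume_measure = points M \<and> sets volume_measure = borel_sets \<and>
     (\<forall>c\<in>charts M. \<forall>B\<in>sets volume_measure. B \<subseteq> fst c \<longrightarrow>
        emeasure volume_measure B = (\<integral>\<^sup>+y\<in>snd c ` B. ennreal (sqrt (det (gram M c y))) \<partial>lborel))"
    using volume_measure_spec unfolding chart_volume_def by blast
next
  fix \<mu> :: "'a measure"
  assume \<mu>: "space \<mu> = points M \<and> sets \<mu> = borel_sets \<and>
     (\<forall>c\<in>charts M. \<forall>B\<in>sets \<mu>. B \<subseteq> fst c \<longrightarrow>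
        emeasure \<mu> B = (\<integral>\<^sup>+y\<in>snd c ` B. ennreal (sqrt (det (gram M c y))) \<partial>lborel))"
  show "\<mu> = volume_measure"
  proof (rule measure_eqI)
    show "sets \<mu> = sets volume_measure" using \<mu> volume_measure_spec(2) by simp
    fix B assume "B \<in> sets \<mu>"
    then have B: "B \<in> borel_sets" using \<mu> by simp
    have "emeasure \<mu> B = emeasure \<mu> (\<Union>i. B \<inter> piece i)" using pieces_Un[OF B] by simp
    also have "\<dots> = (\<Sum>i. emeasure \<mu> (B \<inter> piece i))"
      using chart_piece(1)[OF B] \<mu> by (intro suminf_emeasure[symmetric] pieces_disjoint) auto
    also have "\<dots> = total_volume B"
      unfolding total_volume_def chart_volume_def
      using \<mu> ch chart_piece(1)[OF B] chart_piece(2)[of B] by (intro arg_cong[of _ _ suminf] ext) simp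
    finally show "emeasure \<mu> B = emeasure volume_measure B" using emeasure_volume[OF B] by simp
  qed
qed

end

context riemannian_mfd begin

lemma chart_cover:
  assumes "points M \<noteq> {}"
  obtains ch where "covered_mfd M ch"
proof -
  obtain F where F: "F \<subseteq> fst ` charts M" "countable F" "\<Union>F = \<Union>(fst ` charts M)"
    by (rule Lindelof_openin[of "fst ` charts M" "points M"]) (use chart(1) in auto)
  have U: "\<Union>(fst ` charts M) = points M" using manifold by (auto simp: riemannian_manifold_def)
  then have ne: "F \<noteq> {}" using F assms by auto
  have "\<forall>i. \<exists>c. c \<in> charts M \<and> fst c = from_nat_into F i"
    using from_nat_into[OF ne] F(1) by (metis imageE subsetD)
  then obtain ch where ch: "\<And>i. ch i \<in> charts M \<and> fst (ch i) = from_nat_into F i" by metis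
  have "(\<Union>i. fst (ch i)) = \<Union>(range (from_nat_into F))" using ch by simp
  then have "(\<Union>i. fst (ch i)) = points M" using range_from_nat_into[OF ne F(2)] F(3) U by simp
  then have "covered_mfd M ch" using ch by unfold_locales auto
  then show ?thesis using that by blast
qed

lemma riemannian_volume:
  assumes "points M \<noteq> {}"
  shows "sets (riemannian_volume M) = borel_sets"
    "\<And>f c B. C1_isometry M M f \<Longrightarrow> inj_on f (points M) \<Longrightarrow> c \<in> charts M \<Longrightarrow> B \<in> borel_sets \<Longrightarrow> B \<subseteq> fst c \<Longrightarrow>
      f ` B \<in> borel_sets \<Longrightarrow> emeasure (riemannian_volume M) (f ` B) = emeasure (riemannian_volume M) B"
    "\<And>c B. c \<in> charts M \<Longrightarrow> B \<in> borel_sets \<Longrightarrow> B \<subseteq> fst c \<Longrightarrow> emeasure (riemannian_volume M) B = chart_volume c B"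
proof -
  obtain ch where "covered_mfd M ch" using chart_cover[OF assms] .
  then interpret covered_mfd M ch .
  show "sets (riemannian_volume M) = borel_sets" by (simp add: riemannian_volume_eq volume_measure_spec)
  show 3: "emeasure (riemannian_volume M) B = chart_volume c B" if "c \<in> charts M" "B \<in> borel_sets" "B \<subseteq> fst c" for c B
    using that by (simp add: riemannian_volume_eq volume_measure_spec(3))
  show "emeasure (riemannian_volume M) (f ` B) = emeasure (riemannian_volume M) B"
    if "C1_isometry M M f" "inj_on f (points M)" "c \<in> charts M" "B \<in> borel_sets" "B \<subseteq> fst c" "f ` B \<in> borel_sets" for f c B
    using that 3 by (simp add: riemannian_volume_eq emeasure_volume total_volume_isometry)
qed

text \<open>A positive density integrates to zero only over a null set, and nonempty open sets of
  coordinates are not null.\<close>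

lemma riemannian_volume_open_pos:
  assumes c: "c \<in> charts M" and V: "openin (top_of_set (points M)) V" "V \<subseteq> fst c" "V \<noteq> {}"
  shows "emeasure (riemannian_volume M) V > 0"
proof -
  have "points M \<noteq> {}" using V chart(2)[OF c] by blast
  moreover have VB: "V \<in> borel_sets" using V openin_sets_restrict_space by blast
  ultimately have eq: "emeasure (riemannian_volume M) V = chart_volume c V"
    using riemannian_volume(3) c V(2) by blast
  have o: "open (snd c ` V)" "snd c ` V \<noteq> {}" using open_chart_image[OF c V(1,2)] V(3) by auto
  let ?d = "\<lambda>y. ennreal (indicator (snd c ` fst c) y * density_at c y) * indicator (snd c ` V) y"
  have [measurable]: "snd c ` V \<in> sets borel" using o(1) by simp
  note [measurable] = density_measurable[OF c]
  have m: "?d \<in> borel_measurable lborel" by measurable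
  have "chart_volume c V \<noteq> 0"
  proof
    assume "chart_volume c V = 0"
    then have "AE y in lborel. ?d y = 0"
      using chart_volume_alt[OF c V(2)] nn_integral_0_iff_AE[OF m] by simp
    moreover have "?d y \<noteq> 0" if "y \<in> snd c ` V" for y
    proof -
      have "y \<in> snd c ` fst c" using that V(2) by blast
      then show ?thesis using density_pos[OF c, of y] that by simp
    qed
    ultimately have "AE y in lborel. y \<notin> snd c ` V" by (auto elim: eventually_mono)
    then have "snd c ` V \<in> null_sets lborel"
      using AE_iff_null_sets[of "snd c ` V" lborel] o(1) by simp
    then have "snd c ` V \<in> null_sets lebesgue" by (rule null_sets_completionI)
    then show False using open_not_negligible[OF o] by (simp add: negligible_iff_null_sets)
  qed
  then show ?thesis using eq by (simp add: zero_less_iff_neq_zero)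
qed

end

section \<open>Entropy of a free semigroup of isometries\<close>

context riemannian_mfd begin

lemma locally_path_connected: "locally path_connected (points M)"
  unfolding locally_def
proof (intro allI impI)
  fix w x assume w: "openin (top_of_set (points M)) w \<and> x \<in> w"
  then have "x \<in> points M" using openin_imp_subset by blast
  then obtain c where c: "c \<in> charts M" "x \<in> fst c" using chart_exists by blast
  let ?W = "w \<inter> fst c"
  have W: "openin (top_of_set (points M)) ?W" using w chart(1)[OF c(1)] by (auto intro: openin_Int)
  have "open (snd c ` ?W)" by (rule open_chart_image[OF c(1) W]) blast
  moreover have "snd c x \<in> snd c ` ?W" using w c by blast
  ultimately obtain r where r: "r > 0" "ball (snd c x) r \<subseteq> snd c ` ?W" using open_contains_ball by blast
  let ?V = "chart_inv c ` ball (snd c x) r"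
  have sub: "ball (snd c x) r \<subseteq> snd c ` fst c" using r(2) by blast
  have "path_connected ?V"
    by (intro path_connected_continuous_image continuous_on_subset[OF chart(6)[OF c(1)] sub]
        convex_imp_path_connected convex_ball)
  moreover have V: "?V = fst c \<inter> snd c -` ball (snd c x) r"
  proof
    show "?V \<subseteq> fst c \<inter> snd c -` ball (snd c x) r"
    proof
      fix y assume "y \<in> ?V"
      then obtain z where z: "z \<in> ball (snd c x) r" "y = chart_inv c z" by blast
      then have "z \<in> snd c ` fst c" using sub by blast
      then show "y \<in> fst c \<inter> snd c -` ball (snd c x) r"
        using z chart_inv_in[OF c(1)] chart_inv_right[OF c(1)] by simp
    qed
    show "fst c \<inter> snd c -` ball (snd c x) r \<subseteq> ?V"
    proof
      fix y assume y: "y \<in> fst c \<inter> snd c -` ball (snd c x) r"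
      then have "y = chart_inv c (snd c y)" using c(1) by simp
      then show "y \<in> ?V" using y by blast
    qed
  qed
  have "openin (top_of_set (fst c)) (fst c \<inter> snd c -` ball (snd c x) r)"
    using continuous_openin_preimage[OF chart(5)[OF c(1)], of UNIV "ball (snd c x) r"] by auto
  then have "openin (top_of_set (points M)) ?V" unfolding V using chart(1)[OF c(1)] openin_trans by blast
  moreover have "x \<in> ?V" unfolding V using c(2) r(1) by simp
  moreover have "?V \<subseteq> w"
  proof
    fix y assume "y \<in> ?V"
    then obtain z where z: "z \<in> ball (snd c x) r" "y = chart_inv c z" by blast
    then obtain y' where "y' \<in> ?W" "z = snd c y'" using r(2) by blast
    then show "y \<in> w" using z c(1) by simp
  qed
  ultimately show "\<exists>U V. openin (top_of_set (points M)) U \<and> path_connected V \<and> x \<in> U \<and> U \<subseteq> V \<and> V \<subseteq> w"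
    by blast
qed

lemma ln_ennreal_ge:
  assumes "v \<ge> ennreal a" "a > 0"
  shows "ln_ennreal v \<ge> ereal (ln a)"
proof (cases v)
  case (real r)
  then have "r \<ge> a" using assms by (simp add: ennreal_le_iff)
  then show ?thesis using assms real by (simp add: ln_ennreal_def ennreal_eq_0_iff)
qed (simp add: ln_ennreal_def)

text \<open>The \<open>2 ^ n\<close> translates of \<open>V\<close> by words of length
  \<open>n\<close> are disjoint, have equal volume and lie in the ball of radius
  \<open>n * r + 1\<close>, the one accounting for the size of \<open>V\<close>. The set
  \<open>V\<close> is kept inside a chart because the invariance of volume is available for such
  sets.\<close>

lemma entropy_bound:
  fixes A :: "bool list \<Rightarrow> 'a \<Rightarrow> 'a"
  assumes ent: "has_entropy M h" and x: "x \<in> points M" and r: "r > 0"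
    and A: "\<And>w. C1_isometry M M (A w)" "\<And>w. inj_on (A w) (points M)"
    and V: "openin (top_of_set (points M)) V" "x \<in> V" "c \<in> charts M" "V \<subseteq> fst c"
      "\<And>y. y \<in> V \<Longrightarrow> rdist M x y < ennreal 1"
    and AV: "\<And>w. openin (top_of_set (points M)) (A w ` V)"
    and dj: "\<And>v w. length v = length w \<Longrightarrow> v \<noteq> w \<Longrightarrow> A v ` V \<inter> A w ` V = {}"
    and d: "\<And>w. w \<noteq> [] \<Longrightarrow> rdist M x (A w x) < ennreal (real (length w) * r)"
  shows "ereal (ln 2 / r) \<le> h"
proof -
  let ?vol = "emeasure (riemannian_volume M)"
  have ne: "points M \<noteq> {}" using x by blast
  have VB: "V \<in> borel_sets" "A w ` V \<in> borel_sets" for w using V(1) AV openin_sets_restrict_space by blast+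
  have "?vol V > 0" using riemannian_volume_open_pos[OF V(3,1,4)] V(2) by blast
  \<comment> \<open>A finite positive lower bound suffices and also covers the case of infinite
    volume.\<close>
  then obtain a where a: "a > 0" "ennreal a \<le> ?vol V"
  proof (cases "?vol V")
    case (real q)
    then show ?thesis using that[of q] \<open>?vol V > 0\<close> by auto
  next
    case top
    then show ?thesis using that[of 1] by simp
  qed
  have growth: "ennreal (2 ^ n * a) \<le> ?vol (rball M x (real n * r + 1))" if n: "n > 0" for n
  proof -
    let ?L = "{w :: bool list. length w = n}"
    have L: "finite ?L" "card ?L = 2 ^ n"
      using finite_lists_length_eq[of "UNIV :: bool set" n] card_lists_length_eq[of "UNIV :: bool set" n] by simp_all
    have sub: "(\<Union>w\<in>?L. A w ` V) \<subseteq> rball M x (real n * r + 1)"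
    proof
      fix z assume "z \<in> (\<Union>w\<in>?L. A w ` V)"
      then obtain w y where w: "length w = n" "y \<in> V" "z = A w y" by blast
      then have "w \<noteq> []" using n by auto
      then have "rdist M x (A w x) < ennreal (real n * r)" using d w by blast
      moreover have "rdist M (A w x) (A w y) < ennreal 1" using rdist_isometry_less[OF A(1) V(5)] w by blast
      ultimately have "rdist M x z < ennreal (real n * r) + ennreal 1" using rdist_trans_less w by blast
      moreover have "ennreal (real n * r) + ennreal 1 = ennreal (real n * r + 1)" using r by (subst ennreal_plus) auto
      moreover have "z \<in> points M" using w AV[of w] openin_imp_subset by blast
      ultimately show "z \<in> rball M x (real n * r + 1)" by (simp add: rball_def)
    qed
    have "ennreal (2 ^ n * a) = (\<Sum>w\<in>?L. ennreal a)"
      using L a(1) by (simp add: ennreal_mult'' ennreal_power[symmetric])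
    also have "\<dots> \<le> (\<Sum>w\<in>?L. ?vol (A w ` V))"
      using riemannian_volume(2)[OF ne A(1,2) V(3) VB(1) V(4) VB(2)] a(2) by (intro sum_mono) simp
    also have "\<dots> = ?vol (\<Union>w\<in>?L. A w ` V)"
      using VB(2) riemannian_volume(1)[OF ne] dj L(1)
      by (intro sum_emeasure) (auto simp: disjoint_family_on_def)
    also have "\<dots> \<le> ?vol (rball M x (real n * r + 1))"
      using sub openin_sets_restrict_space[OF openin_rball[OF x]] riemannian_volume(1)[OF ne]
      by (intro emeasure_mono) auto
    finally show ?thesis .
  qed
  let ?R = "\<lambda>n. real n * r + 1"
  let ?f = "\<lambda>R. ereal (1 / R) * ln_ennreal (?vol (rball M x R))"
  \<comment> \<open>The entropy is a limit over all radii and may be evaluated along this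
    sequence.\<close>
  have "filterlim ?R at_top sequentially" using r by real_asymp
  moreover have "(?f \<longlongrightarrow> h) at_top" using ent x by (simp add: has_entropy_def)
  ultimately have lim: "(\<lambda>n. ?f (?R n)) \<longlonglongrightarrow> h" using filterlim_compose by blast
  have "(\<lambda>n. (real n * ln 2 + ln a) / (real n * r + 1)) \<longlonglongrightarrow> ln 2 * inverse r"
    using r by real_asymp
  then have "(\<lambda>n. (real n * ln 2 + ln a) / (real n * r + 1)) \<longlonglongrightarrow> ln 2 / r"
    unfolding divide_inverse[of "ln 2" r] .
  then have "(\<lambda>n. ereal ((real n * ln 2 + ln a) / (real n * r + 1))) \<longlonglongrightarrow> ereal (ln 2 / r)" by simp
  moreover have "\<forall>\<^sub>F n in sequentially. ereal ((real n * ln 2 + ln a) / ?R n) \<le> ?f (?R n)"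
  proof (rule eventually_mono[OF eventually_gt_at_top[of 0]])
    fix n :: nat assume n: "n > 0"
    have "ereal (real n * ln 2 + ln a) \<le> ln_ennreal (?vol (rball M x (?R n)))"
      using ln_ennreal_ge[OF growth[OF n]] a(1) by (simp add: ln_mult ln_realpow)
    then have "ereal (1 / ?R n) * ereal (real n * ln 2 + ln a) \<le> ?f (?R n)"
      using r by (intro ereal_mult_left_mono) auto
    then show "ereal ((real n * ln 2 + ln a) / ?R n) \<le> ?f (?R n)" by simp
  qed
  ultimately show ?thesis using tendsto_le[OF sequentially_bot lim] by blast
qed

end


section \<open>The diastole\<close>

locale deck_action = pointed_universal_covering P p X y0 + group \<Gamma>
  for P :: "'b::t2_space set" and p :: "'b \<Rightarrow> 'a::topological_space" and X :: "'a set" and y0 :: 'b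
    and \<Gamma> :: "'g monoid" (structure) +
  fixes \<psi> :: "(real \<Rightarrow> 'a) set \<Rightarrow> 'g"
  assumes \<psi>: "\<psi> \<in> iso \<pi> \<Gamma>"
begin

text \<open>The deck transformation with a given class is unique on \<open>P\<close> only, so the
  laws of the action are stated for points of \<open>P\<close>.\<close>

definition act :: "'g \<Rightarrow> 'b \<Rightarrow> 'b" where
  "act g = (SOME f. f \<in> deck \<and> \<psi> (deck_class f) = g)"

lemma \<psi>_inj: "inj_on \<psi> (carrier \<pi>)" and \<psi>_image: "\<psi> ` carrier \<pi> = carrier \<Gamma>"
  and \<psi>_mult: "a \<in> carrier \<pi> \<Longrightarrow> b \<in> carrier \<pi> \<Longrightarrow> \<psi> (a \<otimes>\<^bsub>\<pi>\<^esub> b) = \<psi> a \<otimes> \<psi> b"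
proof -
  have h: "\<psi> \<in> hom \<pi> \<Gamma>" "bij_betw \<psi> (carrier \<pi>) (carrier \<Gamma>)" using \<psi> unfolding iso_def by blast+
  show "inj_on \<psi> (carrier \<pi>)" "\<psi> ` carrier \<pi> = carrier \<Gamma>"
    using bij_betw_imp_inj_on[OF h(2)] bij_betw_imp_surj_on[OF h(2)] .
  show "\<psi> (a \<otimes>\<^bsub>\<pi>\<^esub> b) = \<psi> a \<otimes> \<psi> b" if "a \<in> carrier \<pi>" "b \<in> carrier \<pi>"
    using h(1) that by (rule hom_mult)
qed

lemma act:
  assumes "g \<in> carrier \<Gamma>"
  shows "act g \<in> deck" "\<psi> (deck_class (act g)) = g"
proof -
  have "g \<in> \<psi> ` carrier \<pi>" using assms by (simp only: \<psi>_image)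
  then obtain c where "c \<in> carrier \<pi>" "\<psi> c = g" by blast
  then have "\<exists>f. f \<in> deck \<and> \<psi> (deck_class f) = g" using deck_class_surj by metis
  then have "act g \<in> deck \<and> \<psi> (deck_class (act g)) = g" unfolding act_def by (rule someI_ex)
  then show "act g \<in> deck" "\<psi> (deck_class (act g)) = g" by auto
qed

lemma act_in [simp]: "g \<in> carrier \<Gamma> \<Longrightarrow> z \<in> P \<Longrightarrow> act g z \<in> P"
  using deckD(2)[OF act(1)] .

lemma act_mult:
  assumes g: "g \<in> carrier \<Gamma>" and h: "h \<in> carrier \<Gamma>" and z: "z \<in> P"
  shows "act (g \<otimes> h) z = act g (act h z)"
proof -
  have c: "act g \<circ> act h \<in> deck" using comp_deck act(1) g h by blast
  have "\<psi> (deck_class (act g \<circ> act h)) = g \<otimes> h"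
    using deck_class_comp[OF act(1)[OF g] act(1)[OF h]] \<psi>_mult deck_class_closed act g h by simp
  then have "deck_class (act (g \<otimes> h)) = deck_class (act g \<circ> act h)"
    by (intro inj_onD[OF \<psi>_inj] deck_class_closed act(1) c) (use act(2)[of "g \<otimes> h"] g h in simp_all)
  then show ?thesis using deck_class_inj[OF act(1)[of "g \<otimes> h"] c _ z] g h by simp
qed

lemma act_one: "z \<in> P \<Longrightarrow> act \<one> z = z"
  using act_mult[of \<one> \<one> z] deckD(5)[OF act(1)[of \<one>]] by (auto dest: inj_onD)

lemma act_inj:
  assumes g: "g \<in> carrier \<Gamma>" and h: "h \<in> carrier \<Gamma>" and z: "z \<in> P" "act g z = act h z"
  shows "g = h"
proof -
  have "act g y0 = act h y0" using deck_eq[OF act(1)[OF g] act(1)[OF h] z y0] .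
  then show ?thesis using deck_class_cong act(2) g h by metis
qed

lemma deck_act:
  assumes f: "f \<in> deck" and z: "z \<in> P" "f z \<noteq> z"
  obtains g where "g \<in> carrier \<Gamma>" "g \<noteq> \<one>" "\<And>y. y \<in> P \<Longrightarrow> f y = act g y"
proof -
  let ?g = "\<psi> (deck_class f)"
  have g: "?g \<in> carrier \<Gamma>" using deck_class_closed[OF f] \<psi>_image by blast
  have "deck_class (act ?g) = deck_class f"
    using act[OF g] \<psi>_inj deck_class_closed[OF f] deck_class_closed[OF act(1)[OF g]] by (auto dest: inj_onD)
  then have eq: "f y = act ?g y" if "y \<in> P" for y using deck_class_inj[OF f act(1)[OF g]] that by simp
  moreover have "?g \<noteq> \<one>" using eq[OF z(1)] z act_one by auto
  ultimately show ?thesis using that g by blast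
qed

text \<open>The relation passes from \<open>g\<close> to the map \<open>act g\<close> and on to its
  class; the laws of \<open>\<pi>\<close> used on the way are read off from the composition of deck
  transformations.\<close>

lemma no_2_torsion:
  assumes t: "without_2_torsion \<pi>" and g: "g \<in> carrier \<Gamma>" "g \<otimes> g = \<one>"
  shows "g = \<one>"
proof -
  let ?f = "act g"
  note f = act(1)[OF g(1)]
  have "(?f \<circ> ?f) y0 = id y0" using act_mult[OF g(1) g(1) y0] g(2) act_one[OF y0] by simp
  then have "deck_class ?f \<otimes>\<^bsub>\<pi>\<^esub> deck_class ?f = \<one>\<^bsub>\<pi>\<^esub>"
    using deck_class_cong deck_class_comp[OF f f] deck_class_id by metis
  moreover have "\<one>\<^bsub>\<pi>\<^esub> \<otimes>\<^bsub>\<pi>\<^esub> deck_class ?f = deck_class ?f"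
    using deck_class_comp[OF id_deck(1) f] deck_class_id by simp
  ultimately have "deck_class ?f [^]\<^bsub>\<pi>\<^esub> (2::nat) = \<one>\<^bsub>\<pi>\<^esub>"
    by (simp add: nat_pow_def numeral_2_eq_2)
  then have "deck_class ?f = \<one>\<^bsub>\<pi>\<^esub>"
    using t deck_class_closed[OF f] unfolding without_2_torsion_def by blast
  then have "act g y0 = act \<one> y0"
    using deck_class_inj[OF f id_deck(1) _ y0] deck_class_id act_one[OF y0] by simp
  then show ?thesis using act_inj[OF g(1) _ y0] by simp
qed

end

text \<open>By definition deck transformations are only homeomorphisms over \<open>p\<close>; being
  lifts of the local isometry \<open>p\<close> through itself, they inherit its regularity and
  preserve the metric.\<close>

lemma deck_C1_isometry:
  assumes X: "riemannian_manifold X" and cov: "riemannian_universal_covering Xt p X"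
    and f: "f \<in> deck_transformations (points Xt) p"
  shows "C1_isometry Xt Xt f" "inj_on f (points Xt)"
    "openin (top_of_set (points Xt)) V \<Longrightarrow> openin (top_of_set (points Xt)) (f ` V)"
proof -
  have Xt: "riemannian_manifold Xt" and c: "covering_space (points Xt) p (points X)" and l: "local_isometry Xt X p"
    using cov by (auto simp: riemannian_universal_covering_def)
  obtain g where g: "homeomorphism (points Xt) (points Xt) f g" "\<forall>x\<in>points Xt. p (f x) = p x"
    using f unfolding deck_transformations_def by blast
  have "C1_isometry Xt X p"
    using local_isometry_C1[OF l covering_space_imp_continuous[OF c]] covering_space_imp_surjective[OF c] by blast
  moreover have "continuous_on (points Xt) f" "f ` points Xt \<subseteq> points Xt"
    using g(1) unfolding homeomorphism_def by blast+
  ultimately show "C1_isometry Xt Xt f" by (rule C1_isometry_lift[OF Xt X]) (use g(2) in blast)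
  show "inj_on f (points Xt)" by (rule inj_on_inverseI[of _ g]) (use g in \<open>simp add: homeomorphism_def\<close>)
  show "openin (top_of_set (points Xt)) (f ` V)" if "openin (top_of_set (points Xt)) V"
    using homeomorphism_imp_open_map[OF g(1) that] .
qed

lemma diastole_less:
  assumes "diastole Xt p < L" "x \<in> points Xt"
  obtains f z where "f \<in> deck_transformations (points Xt) p" "z \<in> points Xt" "f z \<noteq> z" "rdist Xt x (f x) < L"
proof -
  have "(INF f \<in> {f \<in> deck_transformations (points Xt) p. \<exists>z\<in>points Xt. f z \<noteq> z}. rdist Xt x (f x)) \<le> diastole Xt p"
    unfolding diastole_def by (rule SUP_upper) fact
  then have "(INF f \<in> {f \<in> deck_transformations (points Xt) p. \<exists>z\<in>points Xt. f z \<noteq> z}. rdist Xt x (f x)) < L"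
    using assms(1) by (rule le_less_trans)
  then show ?thesis using that unfolding INF_less_iff by blast
qed

theorem theorem1p1:
  fixes X :: "('a::{t2_space, second_countable_topology}, 'n::finite) riemannian"
    and Xt :: "('b::{t2_space, second_countable_topology}, 'n) riemannian"
    and p :: "'b \<Rightarrow> 'a" and x0 :: 'a and H :: real and h :: ereal
  assumes "H > 0"
    and "riemannian_manifold X"
    and "connected (points X)"
    and "x0 \<in> points X"
    and "riemannian_universal_covering Xt p X"
    and "has_entropy Xt h" and "h \<le> ereal H"
    and "decomposable (fundamental_group (points X) x0)"
    and "without_2_torsion (fundamental_group (points X) x0)"
  shows "diastole Xt p \<ge> ennreal (ln 3 / (6 * H))"
proof (rule ccontr)
  define L where "L = ln 3 / (6 * H)"
  assume "\<not> diastole Xt p \<ge> ennreal (ln 3 / (6 * H))"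
  then have dias: "diastole Xt p < ennreal L" by (simp add: L_def)
  have L: "L > 0" using assms(1) by (simp add: L_def)
  let ?P = "points Xt"
  have Xt: "riemannian_manifold Xt" "simply_connected ?P" "covering_space ?P p (points X)"
    using assms(5) by (auto simp: riemannian_universal_covering_def)
  interpret M: riemannian_mfd Xt by unfold_locales fact
  have "x0 \<in> p ` ?P" using covering_space_imp_surjective[OF Xt(3)] assms(4) by simp
  then obtain y0 where yP: "y0 \<in> ?P" "p y0 = x0" by blast
  interpret pointed_universal_covering ?P p "points X" y0
    using Xt M.locally_path_connected yP(1) by unfold_locales auto
  obtain A B :: "(real \<Rightarrow> 'a) set monoid" where AB: "group A" "group B"
    "carrier A \<noteq> {\<one>\<^bsub>A\<^esub>}" "carrier B \<noteq> {\<one>\<^bsub>B\<^esub>}" and iso: "\<pi> \<cong> free_product A B"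
    using assms(8) yP(2) unfolding decomposable_def by blast
  obtain \<psi> where \<psi>: "\<psi> \<in> iso \<pi> (free_product A B)" using iso unfolding is_iso_def by blast
  let ?G = "free_product A B"
  interpret G: group ?G by (rule free_product_group[OF AB(1,2)])
  interpret deck_action ?P p "points X" y0 ?G \<psi> by unfold_locales fact
  interpret AB: group_pair A B using AB(1,2) by (simp add: group_pair_def)
  obtain nf :: "_ \<Rightarrow> ((real \<Rightarrow> 'a) set + (real \<Rightarrow> 'a) set) list" where nf: "normal_forms ?G nf isl"
    using AB.free_product_normal_forms[OF AB(3,4)] by blast
  have tor: "g = \<one>\<^bsub>?G\<^esub>" if "g \<in> carrier ?G" "g \<otimes>\<^bsub>?G\<^esub> g = \<one>\<^bsub>?G\<^esub>" for g
    using no_2_torsion[OF _ that] assms(9) yP(2) by simp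
  interpret N: normal_forms_no_2_torsion ?G nf isl
    by (rule normal_forms_no_2_torsion.intro[OF nf], rule normal_forms_no_2_torsion_axioms.intro) (rule tor)
  note isom = deck_C1_isometry[OF assms(2,5) act(1)]
  define S where "S x = {g \<in> carrier ?G. g \<noteq> \<one>\<^bsub>?G\<^esub> \<and> rdist Xt x (act g x) < ennreal L}" for x
  have S_ne: "S x \<noteq> {}" if x: "x \<in> ?P" for x
  proof -
    obtain f z where f: "f \<in> deck" "z \<in> ?P" "f z \<noteq> z" "rdist Xt x (f x) < ennreal L"
      using diastole_less[OF dias x] .
    obtain g where "g \<in> carrier ?G" "g \<noteq> \<one>\<^bsub>?G\<^esub>" "\<And>y. y \<in> ?P \<Longrightarrow> f y = act g y"
      using deck_act[OF f(1-3)] by metis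
    then show ?thesis using f(4) x unfolding S_def by auto
  qed
  have act_trans: "rdist Xt x (act (u \<otimes>\<^bsub>?G\<^esub> v) x) < a + b"
    if "u \<in> carrier ?G" "v \<in> carrier ?G" "x \<in> ?P" "rdist Xt x (act u x) < a" "rdist Xt x (act v x) < b" for u v x a b
    using M.rdist_trans_less[OF that(4) M.rdist_isometry_less[OF isom(1)[OF that(1)] that(5)]] act_mult[OF that(1-3)] by simp
  have act_inv: "rdist Xt x (act (inv\<^bsub>?G\<^esub> u) x) < a"
    if "u \<in> carrier ?G" "x \<in> ?P" "rdist Xt x (act u x) < a" for u x a
  proof -
    have "act (inv\<^bsub>?G\<^esub> u) (act u x) = x" using act_mult[of "inv\<^bsub>?G\<^esub> u" u x] act_one that by simp
    then show ?thesis
      using M.rdist_isometry_less[OF isom(1)[of "inv\<^bsub>?G\<^esub> u"] M.rdist_sym_less[OF that(3)]] that by simp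
  qed
  have local: "N.min_edges g = N.min_edges k" if x: "x \<in> ?P" and g: "g \<in> S x" and k: "k \<in> S x" for x g k
  proof (rule ccontr)
    assume ne: "N.min_edges g \<noteq> N.min_edges k"
    have gk: "g \<in> carrier ?G" "g \<noteq> \<one>\<^bsub>?G\<^esub>" "rdist Xt x (act g x) < ennreal L"
      "k \<in> carrier ?G" "k \<noteq> \<one>\<^bsub>?G\<^esub>" "rdist Xt x (act k x) < ennreal L"
      using g k by (auto simp: S_def)
    obtain a b where ab: "a \<in> N.short_products g k" "b \<in> N.short_products g k" "G.free_pair a b"
      using N.free_pair_exists[OF gk(1,2,4,5) ne] by blast
    have one: "rdist Xt x (act \<one>\<^bsub>?G\<^esub> x) < ennreal L" using M.rdist_self[OF x L] act_one[OF x] by simp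
    have letter: "u \<in> carrier ?G \<and> rdist Xt x (act u x) < ennreal L"
      if "u \<in> {\<one>\<^bsub>?G\<^esub>, g, k, inv\<^bsub>?G\<^esub> g, inv\<^bsub>?G\<^esub> k}" for u
      using that gk one act_inv[OF gk(1) x gk(3)] act_inv[OF gk(4) x gk(6)] by auto
    have short: "u \<in> carrier ?G \<and> rdist Xt x (act u x) < ennreal (3 * L)" if u: "u \<in> N.short_products g k" for u
    proof -
      obtain u1 u2 u3 where u': "u = u1 \<otimes>\<^bsub>?G\<^esub> u2 \<otimes>\<^bsub>?G\<^esub> u3"
        "{u1, u2, u3} \<subseteq> {\<one>\<^bsub>?G\<^esub>, g, k, inv\<^bsub>?G\<^esub> g, inv\<^bsub>?G\<^esub> k}"
        using u unfolding N.short_products_def by blast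
      have l: "u1 \<in> carrier ?G \<and> rdist Xt x (act u1 x) < ennreal L"
        "u2 \<in> carrier ?G \<and> rdist Xt x (act u2 x) < ennreal L"
        "u3 \<in> carrier ?G \<and> rdist Xt x (act u3 x) < ennreal L"
        using u'(2) by (simp_all only: insert_subset letter)
      have "rdist Xt x (act (u1 \<otimes>\<^bsub>?G\<^esub> u2) x) < ennreal L + ennreal L" using act_trans[of u1 u2 x] l x by blast
      then have "rdist Xt x (act u x) < ennreal L + ennreal L + ennreal L"
        unfolding u'(1) using act_trans[of "u1 \<otimes>\<^bsub>?G\<^esub> u2" u3 x] l x by blast
      moreover have "ennreal L + ennreal L + ennreal L = ennreal (3 * L)" using L by (simp flip: ennreal_plus)
      ultimately show ?thesis using l u'(1) by simp
    qed
    note a = short[OF ab(1)] and b = short[OF ab(2)]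
    let ?w = "G.word_product a b"
    have wc: "?w w \<in> carrier ?G" for w using a b by simp
    have wd: "rdist Xt x (act (?w w) x) < ennreal (real (length w) * (3 * L))" if "w \<noteq> []" for w
      using that
    proof (induction w)
      case (Cons s w)
      let ?c = "if s then a else b"
      have c: "?c \<in> carrier ?G" "rdist Xt x (act ?c x) < ennreal (3 * L)" using a b by auto
      show ?case
      proof (cases "w = []")
        case True
        then show ?thesis using c by simp
      next
        case False
        then have "rdist Xt x (act (?c \<otimes>\<^bsub>?G\<^esub> ?w w) x) < ennreal (3 * L) + ennreal (real (length w) * (3 * L))"
          using act_trans[OF c(1) wc x c(2)] Cons.IH by blast
        also have "\<dots> = ennreal (real (length (s # w)) * (3 * L))"
          using L by (subst ennreal_plus[symmetric]) (auto simp: algebra_simps)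
        finally show ?thesis by simp
      qed
    qed simp
    \<comment> \<open>On a sheet \<open>p\<close> is injective, so a nontrivial deck transformation
      moves the sheet off itself. Its intersection with a chart and a unit ball is the set whose
      translates are counted.\<close>
    obtain T u q where u: "p x \<in> T" "openin (top_of_set (points X)) T" "x \<in> u" "openin (top_of_set ?P) u" "homeomorphism u T p q"
      using covering_space_sheet[OF Xt(3) x] .
    obtain c where c: "c \<in> charts Xt" "x \<in> fst c" using M.chart_exists[OF x] by blast
    obtain W where W: "openin (top_of_set ?P) W" "x \<in> W" "\<And>y. y \<in> W \<Longrightarrow> rdist Xt x y < ennreal 1"
      using M.rdist_small[OF x zero_less_one] by blast
    let ?V = "u \<inter> fst c \<inter> W"
    have V: "openin (top_of_set ?P) ?V" using u(4) M.chart(1)[OF c(1)] W(1) by (intro openin_Int)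
    have dj: "act g1 ` ?V \<inter> act g2 ` ?V = {}" if g12: "g1 \<in> carrier ?G" "g2 \<in> carrier ?G" "g1 \<noteq> g2" for g1 g2
    proof (rule ccontr)
      assume "act g1 ` ?V \<inter> act g2 ` ?V \<noteq> {}"
      then obtain y z where yz: "y \<in> u" "z \<in> u" "act g1 y = act g2 z" by blast
      then have P: "y \<in> ?P" "z \<in> ?P" using openin_imp_subset[OF u(4)] by auto
      have "p y = p z" using deckD(3)[OF act(1)] g12 P yz(3) by metis
      then have "y = z" using u(5) yz(1,2) unfolding homeomorphism_def by metis
      then show False using act_inj[OF g12(1,2) P(1)] yz(3) g12(3) by simp
    qed
    have "ereal (ln 2 / (3 * L)) \<le> h"
    proof (rule M.entropy_bound[OF assms(6) x _ _ _ V _ c(1), where A = "\<lambda>w. act (?w w)"])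
      show "act (?w v) ` ?V \<inter> act (?w w) ` ?V = {}" if "length v = length w" "v \<noteq> w" for v w
      proof -
        have "?w v \<noteq> ?w w" using ab(3) that unfolding G.free_pair_def inj_on_def by blast
        then show ?thesis using dj wc by blast
      qed
    qed (use L isom wc V wd u(3) c(2) W(2,3) in auto)
    then have "ln 2 / (3 * L) \<le> H" using assms(7) by (metis ereal_less_eq(3) order_trans)
    then have "2 * ln 2 \<le> ln (3 :: real)" using assms(1) by (simp add: L_def field_simps)
    moreover have "2 * ln 2 = ln (4 :: real)" using ln_realpow[of 2 2] by simp
    ultimately show False by simp
  qed
  \<comment> \<open>The relation is transitive because no \<open>S y\<close> is empty; it would be
    vacuous at a point with empty \<open>S y\<close>.\<close>
  have const: "\<forall>g\<in>S x. \<forall>k\<in>S y. N.min_edges g = N.min_edges k" if xy: "x \<in> ?P" "y \<in> ?P" for x y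
  proof (rule connected_equivalence_relation[OF simply_connected_connected[OF Xt(2)] xy,
        of "\<lambda>x y. \<forall>g\<in>S x. \<forall>k\<in>S y. N.min_edges g = N.min_edges k"])
    fix x y z
    assume "\<forall>g\<in>S x. \<forall>k\<in>S y. N.min_edges g = N.min_edges k" "\<forall>g\<in>S y. \<forall>k\<in>S z. N.min_edges g = N.min_edges k" "y \<in> ?P"
    then show "\<forall>g\<in>S x. \<forall>k\<in>S z. N.min_edges g = N.min_edges k" using S_ne by (metis ex_in_conv)
  next
    fix x assume x: "x \<in> ?P"
    obtain g where g: "g \<in> S x" using S_ne[OF x] by blast
    then have g': "g \<in> carrier ?G" "g \<noteq> \<one>\<^bsub>?G\<^esub>" "rdist Xt x (act g x) < ennreal L" by (auto simp: S_def)
    obtain s where s: "rdist Xt x (act g x) < s" "s < ennreal L" using dense[OF g'(3)] by blast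
    then obtain s' where s': "s = ennreal s'" "0 \<le> s'" by (cases s) auto
    then have "s' < L" using s(2) by (metis ennreal_less_iff)
    \<comment> \<open>Half of the slack is spent at each end: passing from \<open>x\<close> to
      \<open>y\<close> changes the bound on the displacement by \<open>2 * e\<close>, so the same
      \<open>g\<close> also belongs to \<open>S y\<close>.\<close>
    define e where "e = (L - s') / 2"
    have e: "e > 0" "ennreal e + s + ennreal e = ennreal L"
      using \<open>s' < L\<close> s' by (simp_all add: e_def flip: ennreal_plus)
    obtain W where W: "openin (top_of_set ?P) W" "x \<in> W" "\<And>y. y \<in> W \<Longrightarrow> rdist Xt x y < ennreal e"
      using M.rdist_small[OF x e(1)] by blast
    have "\<forall>g\<in>S x. \<forall>k\<in>S y. N.min_edges g = N.min_edges k" if y: "y \<in> W" for y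
    proof -
      have yP: "y \<in> ?P" using y openin_imp_subset[OF W(1)] by blast
      have "rdist Xt y (act g y) < ennreal e + s + ennreal e"
        using M.rdist_trans_less[OF M.rdist_trans_less[OF M.rdist_sym_less[OF W(3)[OF y]] s(1)]
            M.rdist_isometry_less[OF isom(1)[OF g'(1)] W(3)[OF y]]] .
      then have "g \<in> S y" using g' e(2) by (simp add: S_def)
      show ?thesis
      proof (intro ballI)
        fix a b assume "a \<in> S x" "b \<in> S y"
        then show "N.min_edges a = N.min_edges b"
          using local[OF x _ g, of a] local[OF yP \<open>g \<in> S y\<close>, of b] by simp
      qed
    qed
    then show "\<exists>T. openin (top_of_set ?P) T \<and> x \<in> T \<and> (\<forall>y\<in>T. \<forall>g\<in>S x. \<forall>k\<in>S y. N.min_edges g = N.min_edges k)"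
      using W(1,2) by blast
  qed auto
  obtain g where g: "g \<in> S y0" using S_ne[OF yP(1)] by blast
  then have g': "g \<in> carrier ?G" "g \<noteq> \<one>\<^bsub>?G\<^esub>" "rdist Xt y0 (act g y0) < ennreal L" by (auto simp: S_def)
  obtain k where k: "k \<in> carrier ?G" "N.min_edges (k \<otimes>\<^bsub>?G\<^esub> g \<otimes>\<^bsub>?G\<^esub> inv\<^bsub>?G\<^esub> k) \<noteq> N.min_edges g"
    using N.min_edges_not_invariant[OF g'(1,2)] by blast
  let ?g = "k \<otimes>\<^bsub>?G\<^esub> g \<otimes>\<^bsub>?G\<^esub> inv\<^bsub>?G\<^esub> k"
  \<comment> \<open>The conjugate moves the translated point \<open>act k y0\<close> as
    \<open>g\<close> moves \<open>y0\<close>, so it belongs to the set \<open>S\<close> of that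
    point.\<close>
  have "act ?g (act k y0) = act (?g \<otimes>\<^bsub>?G\<^esub> k) y0" using act_mult[of ?g k y0] k(1) g'(1) yP(1) by simp
  also have "?g \<otimes>\<^bsub>?G\<^esub> k = k \<otimes>\<^bsub>?G\<^esub> g" using k(1) g'(1) by (simp add: G.m_assoc)
  finally have "act ?g (act k y0) = act k (act g y0)" using act_mult k(1) g'(1) yP(1) by simp
  then have "rdist Xt (act k y0) (act ?g (act k y0)) < ennreal L"
    using M.rdist_isometry_less[OF isom(1)[OF k(1)] g'(3)] by simp
  then have "?g \<in> S (act k y0)"
    using k(1) g' N.conj_one_iff[of k g] by (simp add: S_def)
  then show False using const[OF yP(1) act_in[OF k(1) yP(1)]] g k(2) by metis
qed

end
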